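(* Let $P_h\to X$ be a (topologically) nontrivial principal $S^1$ bundle with Kaluza-Klein metric $G=G(g,h,\nabla)$. For all $m\neq0$ and every joint eigenfunction $\phi_{m,j}$ of weight $m$, the nodal set $\mathcal{N}_{\Re\phi_{m,j}}=\{p\in P_h:\Re\phi_{m,j}(p)=0\}$ is connected.
   Context: $X$ is a compact connected surface with Riemannian metric $g$ and compatible complex structure; $(L,h)\to X$ is a holomorphic line bundle with Hermitian metric $h$ and $h$-compatible connection $\nabla$; $P_h=\{(z,\lambda)\in L^*:|\lambda|_{h^*}=1\}$ with projection $\pi:P_h\to X$ and generator $\partial/\partial\theta$ of the $S^1$ action. With $TP_h=H\oplus V$ the splitting given by $\nabla$, the Kaluza-Klein metric $G$ is the $S^1$-invariant metric with $H\perp V$, $d\pi:H_p\to T_{\pi(p)}X$ isometric and $|\partial/\partial\theta|_G=1$. Joint eigenfunctions satisfy $\Delta_G\phi_{m,j}=-\lambda_{m,j}\phi_{m,j}$ and $\frac{\partial}{\partial\theta}\phi_{m,j}=im\phi_{m,j}$, $m\in\mathbb{Z}$. *)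

theory Defs
  imports "HOL-Analysis.Analysis"
begin

section \<open>Charts, smoothness and differentials\<close>

text \<open>Smoothness is only used on open sets, where the total derivative is unambiguous.\<close>

primrec Ck_on :: "nat \<Rightarrow> 'e::euclidean_space set \<Rightarrow> ('e \<Rightarrow> 'b::real_normed_vector) \<Rightarrow> bool" where
  "Ck_on 0 S f \<longleftrightarrow> continuous_on S f"
| "Ck_on (Suc k) S f \<longleftrightarrow>
     (\<forall>x\<in>S. f differentiable (at x)) \<and>
     (\<forall>v. Ck_on k S (\<lambda>x. frechet_derivative f (at x) v))"

definition smooth_on :: "'e::euclidean_space set \<Rightarrow> ('e \<Rightarrow> 'b::real_normed_vector) \<Rightarrow> bool" where
  "smooth_on S f \<longleftrightarrow> (\<forall>k. Ck_on k S f)"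

text \<open>A chart is a domain together with a coordinate map that is meaningful on that domain only.
  A tangent vector at \<open>p\<close> is given by its coordinate vector in a chart around \<open>p\<close>; a tensor is a
  family of coordinate expressions, one per chart, that transform by the differentials of
  the coordinate changes.\<close>

type_synonym ('m, 'e) chart = "'m set \<times> ('m \<Rightarrow> 'e)"

type_synonym ('m, 'e) metric = "('m, 'e) chart \<Rightarrow> 'm \<Rightarrow> 'e \<Rightarrow> 'e \<Rightarrow> real"

definition chart_image :: "('m, 'e) chart \<Rightarrow> 'e set" where
  "chart_image c = snd c ` fst c"

definition chart_inv :: "('m, 'e) chart \<Rightarrow> 'e \<Rightarrow> 'm" where
  "chart_inv c = inv_into (fst c) (snd c)"

definition smooth_map ::
  "('m, 'e::euclidean_space) chart set \<Rightarrow> ('m \<Rightarrow> 'b::real_normed_vector) \<Rightarrow> bool" where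
  "smooth_map A f \<longleftrightarrow> (\<forall>c\<in>A. smooth_on (chart_image c) (f \<circ> chart_inv c))"

definition differential ::
  "('m, 'e::euclidean_space) chart \<Rightarrow> ('m \<Rightarrow> 'b::real_normed_vector) \<Rightarrow> 'm \<Rightarrow> 'e \<Rightarrow> 'b" where
  "differential c f p = frechet_derivative (f \<circ> chart_inv c) (at (snd c p))"

text \<open>The differential at \<open>p\<close> of a map \<open>F\<close> between manifolds, in the chart \<open>c\<close> around \<open>p\<close> and
  the chart \<open>d\<close> around \<open>F p\<close>. For \<open>F = id\<close> this is the change of coordinates of tangent vectors.\<close>

definition tangent_map ::
  "('m, 'e::euclidean_space) chart \<Rightarrow> ('n, 'f::euclidean_space) chart \<Rightarrow> ('m \<Rightarrow> 'n) \<Rightarrow> 'm \<Rightarrow> 'e \<Rightarrow> 'f" where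
  "tangent_map c d F p = differential c (snd d \<circ> F) p"


section \<open>Riemannian metrics and the Laplacian\<close>

definition riemannian_metric ::
  "('m, 'e::euclidean_space) chart set \<Rightarrow> ('m, 'e) metric \<Rightarrow> bool" where
  "riemannian_metric A g \<longleftrightarrow>
     (\<forall>c\<in>A. \<forall>p\<in>fst c.
        bilinear (g c p) \<and>
        (\<forall>v w. g c p v w = g c p w v) \<and>
        (\<forall>v. v \<noteq> 0 \<longrightarrow> 0 < g c p v v)) \<and>
     (\<forall>c\<in>A. \<forall>v w. smooth_on (chart_image c) (\<lambda>x. g c (chart_inv c x) v w)) \<and>
     (\<forall>c\<in>A. \<forall>d\<in>A. \<forall>p\<in>fst c \<inter> fst d. \<forall>v w.
        g d p (tangent_map c d id p v) (tangent_map c d id p w) = g c p v w)"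

definition gram :: "('m, real^'n) metric \<Rightarrow> ('m, real^'n) chart \<Rightarrow> 'm \<Rightarrow> real^'n^'n" where
  "gram g c p = (\<chi> i j. g c p (axis i 1) (axis j 1))"

definition partial_deriv ::
  "'n::finite \<Rightarrow> (real^'n \<Rightarrow> 'b::real_normed_vector) \<Rightarrow> real^'n \<Rightarrow> 'b" where
  "partial_deriv i f x = frechet_derivative f (at x) (axis i 1)"

text \<open>The Laplace-Beltrami operator \<open>div grad\<close>, a nonpositive operator, in the chart \<open>c\<close>:
  \<open>|g|^(-1/2) \<partial>_i (|g|^(1/2) g^(ij) \<partial>_j f)\<close>.\<close>

definition laplace_beltrami ::
  "('m, real^'n) metric \<Rightarrow> ('m, real^'n) chart \<Rightarrow> ('m \<Rightarrow> complex) \<Rightarrow> 'm \<Rightarrow> complex" where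
  "laplace_beltrami g c f p =
     (let a = (\<lambda>x. gram g c (chart_inv c x)); r = (\<lambda>x. sqrt (det (a x))) in
      (1 / r (snd c p)) *\<^sub>R
      (\<Sum>i\<in>UNIV. partial_deriv i
         (\<lambda>x. \<Sum>j\<in>UNIV. (r x * matrix_inv (a x) $ i $ j) *\<^sub>R partial_deriv j (f \<circ> chart_inv c) x)
         (snd c p)))"


section \<open>Riemann surfaces\<close>

definition riemann_surface :: "('a::t2_space, complex) chart set \<Rightarrow> bool" where
  "riemann_surface A \<longleftrightarrow>
     \<Union>(fst ` A) = UNIV \<and>
     (\<forall>c\<in>A. open (fst c) \<and> open (chart_image c) \<and>
        (\<exists>k. homeomorphism (fst c) (chart_image c) (snd c) k)) \<and>
     (\<forall>c\<in>A. \<forall>d\<in>A. (snd d \<circ> chart_inv c) holomorphic_on (snd c ` (fst c \<inter> fst d)))"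

text \<open>Compatibility of metric and complex structure: the rotation \<open>J\<close>, which is multiplication by
  \<open>\<i>\<close> in every holomorphic chart, is an isometry of each tangent plane.\<close>

definition conformal_metric ::
  "('a, complex) chart set \<Rightarrow> ('a, complex) metric \<Rightarrow> bool" where
  "conformal_metric A g \<longleftrightarrow>
     (\<forall>c\<in>A. \<forall>z\<in>fst c. \<forall>v w. g c z (\<i> * v) (\<i> * w) = g c z v w)"


section \<open>Holomorphic line bundles, Hermitian metrics, connections\<close>

text \<open>The total space is the type \<open>'l\<close>. Addition is meaningful for two vectors of the same fibre
  only. A local trivialization is an open set \<open>V\<close> together with the fibre coordinate on the part
  of the total space that lies over \<open>V\<close>.\<close>

record ('a, 'l) line_bundle =
  proj :: "'l \<Rightarrow> 'a"
  fadd :: "'l \<Rightarrow> 'l \<Rightarrow> 'l"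
  fscale :: "complex \<Rightarrow> 'l \<Rightarrow> 'l"
  trivs :: "('a set \<times> ('l \<Rightarrow> complex)) set"

definition fibre :: "('a, 'l) line_bundle \<Rightarrow> 'a \<Rightarrow> 'l set" where
  "fibre L z = {v. proj L v = z}"

definition frame :: "('a, 'l) line_bundle \<Rightarrow> 'a set \<times> ('l \<Rightarrow> complex) \<Rightarrow> 'a \<Rightarrow> 'l" where
  "frame L t z = (THE v. v \<in> fibre L z \<and> snd t v = 1)"

definition holomorphic_line_bundle ::
  "('a::t2_space, complex) chart set \<Rightarrow> ('a, 'l::topological_space) line_bundle \<Rightarrow> bool" where
  "holomorphic_line_bundle A L \<longleftrightarrow>
     \<Union>(fst ` trivs L) = UNIV \<and>
     (\<forall>t\<in>trivs L. open (fst t) \<and> open (proj L -` fst t) \<and>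
        (\<exists>k. homeomorphism (proj L -` fst t) (fst t \<times> UNIV) (\<lambda>v. (proj L v, snd t v)) k)) \<and>
     (\<forall>t\<in>trivs L. \<forall>z\<in>fst t. \<forall>v\<in>fibre L z. \<forall>w\<in>fibre L z. \<forall>a.
        fadd L v w \<in> fibre L z \<and> snd t (fadd L v w) = snd t v + snd t w \<and>
        fscale L a v \<in> fibre L z \<and> snd t (fscale L a v) = a * snd t v) \<and>
     (\<forall>t\<in>trivs L. \<forall>u\<in>trivs L. \<forall>c\<in>A.
        (\<lambda>x. snd u (frame L t (chart_inv c x)))
          holomorphic_on (snd c ` (fst c \<inter> fst t \<inter> fst u)))"

definition smooth_section ::
  "('a, complex) chart set \<Rightarrow> ('a, 'l) line_bundle \<Rightarrow> ('a \<Rightarrow> 'l) \<Rightarrow> bool" where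
  "smooth_section A L s \<longleftrightarrow>
     (\<forall>z. s z \<in> fibre L z) \<and>
     (\<forall>t\<in>trivs L. \<forall>c\<in>A.
        smooth_on (snd c ` (fst c \<inter> fst t)) (\<lambda>x. snd t (s (chart_inv c x))))"

definition hermitian_metric ::
  "('a, complex) chart set \<Rightarrow> ('a, 'l) line_bundle \<Rightarrow> ('l \<Rightarrow> 'l \<Rightarrow> complex) \<Rightarrow> bool" where
  "hermitian_metric A L h \<longleftrightarrow>
     (\<forall>z. \<forall>u\<in>fibre L z. \<forall>v\<in>fibre L z. \<forall>w\<in>fibre L z. \<forall>a.
        h (fadd L u v) w = h u w + h v w \<and>
        h (fscale L a v) w = a * h v w \<and>
        h w v = cnj (h v w) \<and>
        (v \<noteq> fscale L 0 v \<longrightarrow> 0 < Re (h v v))) \<and>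
     (\<forall>s s'. smooth_section A L s \<longrightarrow> smooth_section A L s' \<longrightarrow> smooth_map A (\<lambda>z. h (s z) (s' z)))"

text \<open>A connection: \<open>D c z \<xi> s\<close> is the covariant derivative at \<open>z\<close> of the smooth section \<open>s\<close> in
  the direction of the tangent vector with coordinates \<open>\<xi>\<close> in the chart \<open>c\<close>.\<close>

type_synonym ('a, 'l) conn = "('a, complex) chart \<Rightarrow> 'a \<Rightarrow> complex \<Rightarrow> ('a \<Rightarrow> 'l) \<Rightarrow> 'l"

definition connection ::
  "('a, complex) chart set \<Rightarrow> ('a, 'l) line_bundle \<Rightarrow> ('a, 'l) conn \<Rightarrow> bool" where
  "connection A L D \<longleftrightarrow>
     (\<forall>s. smooth_section A L s \<longrightarrow>
        (\<forall>c\<in>A. \<forall>z\<in>fst c. \<forall>\<xi> \<eta>. \<forall>a b :: real.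
           D c z \<xi> s \<in> fibre L z \<and>
           D c z (a *\<^sub>R \<xi> + b *\<^sub>R \<eta>) s =
             fadd L (fscale L (of_real a) (D c z \<xi> s)) (fscale L (of_real b) (D c z \<eta> s))) \<and>
        (\<forall>c\<in>A. \<forall>d\<in>A. \<forall>z\<in>fst c \<inter> fst d. \<forall>\<xi>. D d z (tangent_map c d id z \<xi>) s = D c z \<xi> s) \<and>
        (\<forall>c\<in>A. \<forall>t\<in>trivs L. \<forall>\<xi>.
           smooth_on (snd c ` (fst c \<inter> fst t)) (\<lambda>x. snd t (D c (chart_inv c x) \<xi> s)))) \<and>
     (\<forall>s s'. smooth_section A L s \<longrightarrow> smooth_section A L s' \<longrightarrow>
        (\<forall>c\<in>A. \<forall>z\<in>fst c. \<forall>\<xi>.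
           D c z \<xi> (\<lambda>y. fadd L (s y) (s' y)) = fadd L (D c z \<xi> s) (D c z \<xi> s'))) \<and>
     (\<forall>s (f :: 'a \<Rightarrow> complex). smooth_section A L s \<longrightarrow> smooth_map A f \<longrightarrow>
        (\<forall>c\<in>A. \<forall>z\<in>fst c. \<forall>\<xi>.
           D c z \<xi> (\<lambda>y. fscale L (f y) (s y)) =
             fadd L (fscale L (differential c f z \<xi>) (s z)) (fscale L (f z) (D c z \<xi> s))))"

definition metric_connection ::
  "('a, complex) chart set \<Rightarrow> ('a, 'l) line_bundle \<Rightarrow> ('l \<Rightarrow> 'l \<Rightarrow> complex) \<Rightarrow> ('a, 'l) conn \<Rightarrow> bool" where
  "metric_connection A L h D \<longleftrightarrow>
     connection A L D \<and>
     (\<forall>s s'. smooth_section A L s \<longrightarrow> smooth_section A L s' \<longrightarrow>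
        (\<forall>c\<in>A. \<forall>z\<in>fst c. \<forall>\<xi>.
           differential c (\<lambda>y. h (s y) (s' y)) z \<xi> = h (D c z \<xi> s) (s' z) + h (s z) (D c z \<xi> s')))"


section \<open>The unit circle bundle of the dual line bundle\<close>

text \<open>Functionals on a fibre are extended by \<open>0\<close> to the whole total space, so that they are
  determined by their values on the fibre.\<close>

definition dual_bundle :: "('a, 'l) line_bundle \<Rightarrow> ('a \<times> ('l \<Rightarrow> complex)) set" where
  "dual_bundle L = {(z, l).
     (\<forall>v\<in>fibre L z. \<forall>w\<in>fibre L z. \<forall>a.
        l (fadd L v w) = l v + l w \<and> l (fscale L a v) = a * l v) \<and>
     (\<forall>v. v \<notin> fibre L z \<longrightarrow> l v = 0)}"

definition dual_norm ::
  "('a, 'l) line_bundle \<Rightarrow> ('l \<Rightarrow> 'l \<Rightarrow> complex) \<Rightarrow> 'a \<times> ('l \<Rightarrow> complex) \<Rightarrow> real" where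
  "dual_norm L h p = Sup {cmod (snd p v) | v. v \<in> fibre L (fst p) \<and> sqrt (Re (h v v)) \<le> 1}"

definition circle_bundle ::
  "('a, 'l) line_bundle \<Rightarrow> ('l \<Rightarrow> 'l \<Rightarrow> complex) \<Rightarrow> ('a \<times> ('l \<Rightarrow> complex)) set" where
  "circle_bundle L h = {p \<in> dual_bundle L. dual_norm L h p = 1}"

text \<open>The vector bundle topology on the dual bundle: it is generated by the open subsets of
  \<open>V \<times> \<complex>\<close>, pulled back by the dual trivializations \<open>(z, l) \<mapsto> (z, l (e z))\<close>, \<open>e\<close> the frame over \<open>V\<close>.
  (The product topology of the ambient type is a different one.)\<close>

definition dual_topology ::
  "('a::t2_space, 'l) line_bundle \<Rightarrow> ('a \<times> ('l \<Rightarrow> complex)) topology" where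
  "dual_topology L = topology_generated_by
     {{(z, l) \<in> dual_bundle L. z \<in> fst t \<and> (z, l (frame L t z)) \<in> W} | t W. t \<in> trivs L \<and> open W}"

definition circle_topology ::
  "('a::t2_space, 'l) line_bundle \<Rightarrow> ('l \<Rightarrow> 'l \<Rightarrow> complex) \<Rightarrow> ('a \<times> ('l \<Rightarrow> complex)) topology" where
  "circle_topology L h = subtopology (dual_topology L) (circle_bundle L h)"

definition circle_act :: "complex \<Rightarrow> 'a \<times> ('l \<Rightarrow> complex) \<Rightarrow> 'a \<times> ('l \<Rightarrow> complex)" where
  "circle_act u p = (fst p, \<lambda>v. u * snd p v)"

definition trivial_circle_bundle ::
  "('a::t2_space, 'l) line_bundle \<Rightarrow> ('l \<Rightarrow> 'l \<Rightarrow> complex) \<Rightarrow> bool" where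
  "trivial_circle_bundle L h \<longleftrightarrow>
     (\<exists>F. homeomorphic_map (circle_topology L h)
            (prod_topology (euclidean :: 'a topology) (top_of_set (sphere (0::complex) 1))) F \<and>
          (\<forall>p\<in>circle_bundle L h. fst (F p) = fst p \<and>
             (\<forall>u\<in>sphere 0 1. F (circle_act u p) = (fst p, u * snd (F p)))))"

text \<open>The smooth structure of the circle bundle: the coordinates are \<open>(x, y, \<theta>)\<close>, where \<open>x + iy\<close>
  is a holomorphic coordinate of the base point and \<open>\<theta>\<close> is the branch with values in the interval
  \<open>(\<theta>0 - \<pi>, \<theta>0 + \<pi>)\<close> of the argument of the fibre coordinate \<open>l (e z)\<close>.\<close>

definition angle_chart ::
  "('a, 'l) line_bundle \<Rightarrow> ('l \<Rightarrow> 'l \<Rightarrow> complex) \<Rightarrow> ('a, complex) chart \<Rightarrow> 'a set \<times> ('l \<Rightarrow> complex)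
     \<Rightarrow> real \<Rightarrow> ('a \<times> ('l \<Rightarrow> complex), real^3) chart" where
  "angle_chart L h c t \<theta>0 =
     ({(z, l) \<in> circle_bundle L h. z \<in> fst c \<inter> fst t \<and> cis (- \<theta>0) * l (frame L t z) \<notin> \<real>\<^sub>\<le>\<^sub>0},
      \<lambda>(z, l). vector [Re (snd c z), Im (snd c z), \<theta>0 + Arg (cis (- \<theta>0) * l (frame L t z))])"

definition circle_atlas ::
  "('a, complex) chart set \<Rightarrow> ('a, 'l) line_bundle \<Rightarrow> ('l \<Rightarrow> 'l \<Rightarrow> complex)
     \<Rightarrow> ('a \<times> ('l \<Rightarrow> complex), real^3) chart set" where
  "circle_atlas A L h = {angle_chart L h c t \<theta>0 | c t \<theta>0. c \<in> A \<and> t \<in> trivs L}"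


section \<open>Kaluza-Klein metrics and joint eigenfunctions\<close>

definition theta_field ::
  "('a \<times> ('l \<Rightarrow> complex), real^3) chart \<Rightarrow> 'a \<times> ('l \<Rightarrow> complex) \<Rightarrow> real^3" where
  "theta_field k p = vector_derivative (\<lambda>s. snd k (circle_act (cis s) p)) (at 0)"

text \<open>The horizontal space of the connection: \<open>v\<close> is horizontal at \<open>p = (z, l)\<close> if functionals
  moving with velocity \<open>v\<close> are parallel for the dual connection, that is, if along \<open>v\<close> the derivative
  of \<open>(z, l) \<mapsto> l (s z)\<close> is \<open>l (\<nabla> s)\<close>, for every section \<open>s\<close>.\<close>

definition horizontal ::
  "('a, complex) chart set \<Rightarrow> ('a, 'l) line_bundle \<Rightarrow> ('a, 'l) conn
     \<Rightarrow> ('a \<times> ('l \<Rightarrow> complex), real^3) chart \<Rightarrow> 'a \<times> ('l \<Rightarrow> complex) \<Rightarrow> (real^3) set" where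
  "horizontal A L D k p =
     {v. \<forall>s. smooth_section A L s \<longrightarrow> (\<forall>c\<in>A. fst p \<in> fst c \<longrightarrow>
        differential k (\<lambda>q. snd q (s (fst q))) p v = snd p (D c (fst p) (tangent_map k c fst p v) s))}"

definition vertical ::
  "('a, complex) chart set \<Rightarrow> ('a \<times> ('l \<Rightarrow> complex), real^3) chart \<Rightarrow> 'a \<times> ('l \<Rightarrow> complex)
     \<Rightarrow> (real^3) set" where
  "vertical A k p = {v. \<forall>c\<in>A. fst p \<in> fst c \<longrightarrow> tangent_map k c fst p v = 0}"

definition kaluza_klein_metric ::
  "('a, complex) chart set \<Rightarrow> ('a, complex) metric \<Rightarrow> ('a, 'l) line_bundle \<Rightarrow> ('l \<Rightarrow> 'l \<Rightarrow> complex)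
     \<Rightarrow> ('a, 'l) conn \<Rightarrow> ('a \<times> ('l \<Rightarrow> complex), real^3) metric \<Rightarrow> bool" where
  "kaluza_klein_metric A g L h D G \<longleftrightarrow>
     riemannian_metric (circle_atlas A L h) G \<and>
     (\<forall>u\<in>sphere 0 1. \<forall>k\<in>circle_atlas A L h. \<forall>k'\<in>circle_atlas A L h.
        \<forall>p\<in>fst k. circle_act u p \<in> fst k' \<longrightarrow>
          (\<forall>v w. G k' (circle_act u p)
                   (tangent_map k k' (circle_act u) p v) (tangent_map k k' (circle_act u) p w)
                 = G k p v w)) \<and>
     (\<forall>k\<in>circle_atlas A L h. \<forall>p\<in>fst k.
        (\<forall>v\<in>horizontal A L D k p. \<forall>w\<in>vertical A k p. G k p v w = 0) \<and>
        (\<forall>c\<in>A. fst p \<in> fst c \<longrightarrow>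
           (\<forall>v\<in>horizontal A L D k p. \<forall>w\<in>horizontal A L D k p.
              g c (fst p) (tangent_map k c fst p v) (tangent_map k c fst p w) = G k p v w)) \<and>
        sqrt (G k p (theta_field k p) (theta_field k p)) = 1)"

definition joint_eigenfunction ::
  "('a, complex) chart set \<Rightarrow> ('a, 'l) line_bundle \<Rightarrow> ('l \<Rightarrow> 'l \<Rightarrow> complex)
     \<Rightarrow> ('a \<times> ('l \<Rightarrow> complex), real^3) metric \<Rightarrow> int \<Rightarrow> real
     \<Rightarrow> ('a \<times> ('l \<Rightarrow> complex) \<Rightarrow> complex) \<Rightarrow> bool" where
  "joint_eigenfunction A L h G m ev \<phi> \<longleftrightarrow>
     smooth_map (circle_atlas A L h) \<phi> \<and>
     (\<exists>p\<in>circle_bundle L h. \<phi> p \<noteq> 0) \<and>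
     (\<forall>k\<in>circle_atlas A L h. \<forall>p\<in>fst k. laplace_beltrami G k \<phi> p = - (of_real ev * \<phi> p)) \<and>
     (\<forall>p\<in>circle_bundle L h.
        ((\<lambda>s. \<phi> (circle_act (cis s) p)) has_vector_derivative \<i> * of_int m * \<phi> p) (at 0))"

definition nodal_set ::
  "('a, 'l) line_bundle \<Rightarrow> ('l \<Rightarrow> 'l \<Rightarrow> complex) \<Rightarrow> ('a \<times> ('l \<Rightarrow> complex) \<Rightarrow> real)
     \<Rightarrow> ('a \<times> ('l \<Rightarrow> complex)) set" where
  "nodal_set L h f = {p \<in> circle_bundle L h. f p = 0}"

end

theory Submission
  imports Defs "HOL-Complex_Analysis.Complex_Analysis"
begin

text \<open>Only the continuity of \<open>\<phi>\<close> and its weight \<open>m\<close> matter. Suppose that the nodal set is a disjoint union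
  of two nonempty closed sets \<open>N\<^sub>1\<close>, \<open>N\<^sub>2\<close>. Their projections to \<open>X\<close> are closed and cover \<open>X\<close>, so they
  meet, as \<open>X\<close> is connected. A fibre on which \<open>\<phi>\<close> vanishes is a connected subset of the nodal set and
  cannot meet both parts; over the remaining points the nodal set is a covering with \<open>2\<bar>m\<bar>\<close> sheets, so
  the intersection of the projections is also open. Hence it is all of \<open>X\<close>, and \<open>\<phi>\<close> has no zeros.

  A map \<open>\<phi>\<close> without zeros trivializes the \<open>m\<close>-th power of the bundle, and such a torsion bundle over a
  compact Riemann surface is trivial. Indeed, working disc by disc one finds a section with finitely many
  singularities, and dragging these along \<open>X\<close> merges them into a single point \<open>p\<close>. Comparing the
  \<open>m\<close>-th power of the section with \<open>\<phi>\<close> gives a circle-valued map on \<open>X - {p}\<close> whose index at \<open>p\<close> is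
  \<open>m\<close> times that of the section. The indices of a circle-valued map on \<open>X\<close> sum to \<open>0\<close>: redefining the
  map to be \<open>1\<close> on one disc after another does not change the sum, by additivity of winding
  numbers in slightly larger discs. So the section has index \<open>0\<close> and extends over \<open>p\<close>.\<close>

section \<open>Local index of planar maps into the punctured plane\<close>

text \<open>The torsion step stands for c_1(L^m) = m c_1(L) in H^2(X, Z) = Z, a group without
  torsion. The Chern number appears only as the index of a unit section at its one singularity, so
  that continuous circle-valued functions suffice. Compactness enters through finite covers by
  coordinate discs, the orientation through holomorphic coordinate changes. Two obstacles shape the
  text. Boundary circles of discs have to miss finitely many singularities; hence covers by discs of
  half the radius, the actual radius being chosen later. And the Hermitian metric is smooth by
  definition only along pairs of global smooth sections, while the unitary cocycle needs the length
  of a local holomorphic frame to be continuous. Global sections are therefore built from local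
  frames with a bump function, and this is why a calculus for \<open>Ck_on\<close> is
  developed.\<close>

lemma continuous_exp_eq_1_constant:
  fixes h :: "'a::topological_space \<Rightarrow> complex"
  assumes "connected S" "continuous_on S h" "\<And>x. x \<in> S \<Longrightarrow> exp (h x) = 1"
  shows "\<exists>k::int. \<forall>x\<in>S. h x = 2 * of_real pi * \<i> * of_int k"
proof (cases "S = {}")
  case False
  have k: "\<exists>k::int. h x = 2 * of_real pi * \<i> * of_int k" if xS: "x \<in> S" for x
  proof -
    obtain k :: int where "Re (h x) = 0" "Im (h x) = of_int (2 * k) * pi"
      using assms(3)[OF xS] unfolding exp_eq_1 by metis
    then show ?thesis by (intro exI[of _ k]) (simp add: complex_eq_iff)
  qed
  from False obtain x0 where x0: "x0 \<in> S" by auto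
  have "h constant_on S"
  proof (rule continuous_discrete_range_constant[OF assms(1,2)])
    fix x assume x: "x \<in> S"
    \<comment> \<open>The values lie in 2 \<pi> i Z, whose distinct points are at least 2 \<pi>
      apart; this gap makes the range discrete.\<close>
    have "2 * pi \<le> cmod (h y - h x)" if y: "y \<in> S" "h y \<noteq> h x" for y
    proof -
      obtain i j :: int where ij: "h y = 2 * of_real pi * \<i> * of_int i" "h x = 2 * of_real pi * \<i> * of_int j"
        using k x y by metis
      then have "i \<noteq> j" using y by auto
      then have "(1::real) \<le> \<bar>of_int (i - j)\<bar>" by linarith
      moreover have "h y - h x = of_real (2 * pi * of_int (i - j)) * \<i>" 
        unfolding ij by (simp add: algebra_simps)
      ultimately show ?thesis by (simp only: norm_mult norm_of_real norm_ii) (simp add: abs_mult)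
    qed
    then show "\<exists>e>0. \<forall>y. y \<in> S \<and> h y \<noteq> h x \<longrightarrow> e \<le> cmod (h y - h x)"
      by (intro exI[of _ "2*pi"]) auto
  qed
  then have "h x = h x0" if "x \<in> S" for x using that x0 by (auto simp: constant_on_def)
  then show ?thesis using k[OF x0] by metis
qed auto

text \<open>Along one turn of the circle a logarithm of (z - a)^n gains 2 \<pi> i n, whereas
  \<open>l\<close> returns to its initial value. Uniqueness of indices and the comparison of index
  sums both reduce to this.\<close>

lemma circle_powi_eq_exp_imp_zero:
  fixes a :: complex
  assumes "r > 0" "continuous_on (sphere a r) l"
    and "\<And>z. z \<in> sphere a r \<Longrightarrow> (z - a) powi n = exp (l z)"
  shows "n = 0"
proof -
  \<comment> \<open>Parametrizing through \<open>exp\<close> makes (z - a)^n the exponential of a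
    linear function of t. The difference \<open>h\<close> of the two logarithms is then
    constant.\<close>
  define \<gamma> where "\<gamma> = (\<lambda>t::real. a + exp (of_real (ln r) + \<i> * of_real t))"
  have \<gamma>: "\<gamma> t \<in> sphere a r" for t
    using assms(1) by (simp add: \<gamma>_def dist_norm)
  define h where "h = (\<lambda>t. l (\<gamma> t) - of_int n * (of_real (ln r) + \<i> * of_real t))"
  have "continuous_on UNIV (\<lambda>t. l (\<gamma> t))"
    by (rule continuous_on_compose2[OF assms(2)]) (use \<gamma> in \<open>auto simp: \<gamma>_def intro!: continuous_intros\<close>)
  then have "continuous_on UNIV h" unfolding h_def by (intro continuous_intros)
  moreover have "exp (h t) = 1" for t
  proof -
    have "exp (l (\<gamma> t)) = exp (of_real (ln r) + \<i> * of_real t) powi n"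
      using assms(3)[OF \<gamma>, of t] by (simp add: \<gamma>_def)
    also have "\<dots> = exp (of_int n * (of_real (ln r) + \<i> * of_real t))"
      by (simp add: exp_power_int)
    finally show ?thesis by (simp add: h_def exp_diff)
  qed
  ultimately obtain k :: int where k: "\<And>t. h t = 2 * of_real pi * \<i> * of_int k"
    using continuous_exp_eq_1_constant[of UNIV h] by auto
  have "\<gamma> (2 * pi) = \<gamma> 0"
    by (simp add: \<gamma>_def exp_add mult.assoc[symmetric] mult.commute[of \<i>])
  moreover have "h (2*pi) = h 0" using k by metis
  ultimately have "of_int n * (\<i> * of_real (2*pi)) = 0" by (simp add: h_def algebra_simps)
  then show ?thesis by simp
qed

text \<open>The winding number of \<open>g\<close> around \<open>a\<close>, encoded as a
  factorization instead of an integral. It makes sense for merely continuous \<open>g\<close>,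
  ignores the value at \<open>a\<close>, and turns products and powers into sums and multiples of
  exponents.\<close>

definition local_index :: "(complex \<Rightarrow> complex) \<Rightarrow> complex \<Rightarrow> int \<Rightarrow> bool" where
  "local_index g a n \<longleftrightarrow> (\<exists>r>0. \<exists>l. continuous_on (ball a r - {a}) l \<and>
     (\<forall>z\<in>ball a r - {a}. g z = (z - a) powi n * exp (l z)))"

lemma local_indexI:
  assumes "r > 0" "continuous_on (ball a r - {a}) l"
    "\<And>z. z \<in> ball a r - {a} \<Longrightarrow> g z = (z - a) powi n * exp (l z)"
  shows "local_index g a n"
  using assms unfolding local_index_def by blast

lemma local_indexE:
  assumes "local_index g a n" "e > 0"
  obtains r l where "r > 0" "r < e" "continuous_on (ball a r - {a}) l"
    "\<And>z. z \<in> ball a r - {a} \<Longrightarrow> g z = (z - a) powi n * exp (l z)"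
proof -
  obtain r l where rl: "r > 0" "continuous_on (ball a r - {a}) l"
     "\<And>z. z \<in> ball a r - {a} \<Longrightarrow> g z = (z - a) powi n * exp (l z)"
    using assms(1) by (auto simp: local_index_def)
  show thesis
  proof (rule that)
    show "min r (e/2) > 0" "min r (e/2) < e" using rl(1) assms(2) by auto
    show "continuous_on (ball a (min r (e/2)) - {a}) l"
      by (rule continuous_on_subset[OF rl(2)]) auto
  qed (use rl(3) in auto)
qed

lemma local_index_cong:
  assumes "local_index g a n" "e > 0" "\<And>z. z \<in> ball a e - {a} \<Longrightarrow> g z = g' z"
  shows "local_index g' a n"
proof -
  obtain r l where rl: "r > 0" "r < e" "continuous_on (ball a r - {a}) l"
    "\<And>z. z \<in> ball a r - {a} \<Longrightarrow> g z = (z - a) powi n * exp (l z)"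
    by (rule local_indexE[OF assms(1,2)]) blast
  show ?thesis
    by (rule local_indexI[OF rl(1,3)]) (use rl(2,4) assms(3) in force)
qed

lemma local_index_mult:
  assumes "local_index f a m" "local_index g a n"
  shows "local_index (\<lambda>z. f z * g z) a (m + n)"
proof -
  obtain r k where rk: "r > 0" "continuous_on (ball a r - {a}) k"
    "\<And>z. z \<in> ball a r - {a} \<Longrightarrow> f z = (z - a) powi m * exp (k z)"
    by (rule local_indexE[OF assms(1) zero_less_one]) blast
  obtain s l where sl: "s > 0" "s < r" "continuous_on (ball a s - {a}) l"
    "\<And>z. z \<in> ball a s - {a} \<Longrightarrow> g z = (z - a) powi n * exp (l z)"
    by (rule local_indexE[OF assms(2) rk(1)]) blast
  have "continuous_on (ball a s - {a}) k"
    by (rule continuous_on_subset[OF rk(2)]) (use sl in auto)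
  then show ?thesis
    using sl rk(3) by (intro local_indexI[of s a "\<lambda>z. k z + l z"])
      (auto intro!: continuous_intros simp: exp_add power_int_add)
qed

lemma local_index_powi:
  assumes "local_index f a n"
  shows "local_index (\<lambda>z. f z powi m) a (m * n)"
proof -
  obtain r k where rk: "r > 0" "continuous_on (ball a r - {a}) k"
    "\<And>z. z \<in> ball a r - {a} \<Longrightarrow> f z = (z - a) powi n * exp (k z)"
    by (rule local_indexE[OF assms(1) zero_less_one]) blast
  show ?thesis
    using rk by (intro local_indexI[of r a "\<lambda>z. of_int m * k z"])
      (auto intro!: continuous_intros simp: power_int_mult_distrib exp_power_int
        power_int_mult[symmetric] mult.commute[of n m])
qed

lemma local_index_nonzero:
  assumes "r > 0" "continuous_on (ball a r) g" "\<And>z. z \<in> ball a r \<Longrightarrow> g z \<noteq> 0"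
  shows "local_index g a 0"
proof -
  obtain l where l: "continuous_on (ball a r) l" "\<And>z. z \<in> ball a r \<Longrightarrow> g z = exp (l z)"
    using continuous_logarithm_on_ball[OF assms(2,3)] by blast
  show ?thesis
    by (rule local_indexI[OF assms(1) continuous_on_subset[OF l(1)]]) (use l in auto)
qed

lemma local_index_power_diff: "local_index (\<lambda>z. (z - a) powi n) a n"
  by (rule local_indexI[of 1 a "\<lambda>z. 0"]) auto

text \<open>The quotient of \<open>g\<close> by itself is 1 near \<open>a\<close>, but the two
  hypotheses give it the index m - n. So (z - a)^(m - n) has a continuous logarithm on a small
  circle.\<close>

lemma local_index_unique:
  assumes "local_index g a m" "local_index g a n"
  shows "m = n"
proof -
  have "local_index (\<lambda>z. g z powi 1 * g z powi (-1)) a (m + (- 1) * n)"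
    by (rule local_index_mult[OF _ local_index_powi[OF assms(2)]])
      (use local_index_powi[OF assms(1), of 1] in simp)
  then obtain r l where rl: "r > 0" "continuous_on (ball a r - {a}) l"
    "\<And>z. z \<in> ball a r - {a} \<Longrightarrow> g z powi 1 * g z powi (-1) = (z - a) powi (m - n) * exp (l z)"
    by (rule local_indexE[OF _ zero_less_one]) auto
  obtain s k where sk: "s > 0" "s < r"
    "\<And>z. z \<in> ball a s - {a} \<Longrightarrow> g z = (z - a) powi m * exp (k z)"
    by (rule local_indexE[OF assms(1) rl(1)]) blast
  have "m - n = 0"
  proof (rule circle_powi_eq_exp_imp_zero[of "s/2" a "\<lambda>z. - l z"])
    show "continuous_on (sphere a (s/2)) (\<lambda>z. - l z)"
      by (intro continuous_intros continuous_on_subset[OF rl(2)]) (use sk in auto)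
    fix z assume "z \<in> sphere a (s/2)"
    then have z: "z \<in> ball a s - {a}" "z \<in> ball a r - {a}" using sk by auto
    then have "g z \<noteq> 0" using sk(3) by auto
    then have "(z - a) powi (m - n) * exp (l z) = 1"
      using rl(3)[OF z(2)] by (simp add: power_int_minus)
    then show "(z - a) powi (m - n) = exp (- l z)"
      by (simp add: exp_minus field_simps)
  qed (use sk in auto)
  then show ?thesis by simp
qed

text \<open>The map sending w to a + exp w on the half plane Re w < ln r is the universal cover of
  the punctured disc. There \<open>g\<close> has a logarithm \<open>l\<close>, whose increment under
  translation by 2 \<pi> i is a constant 2 \<pi> i n. Subtracting n w leaves a periodic function,
  and this descends to the punctured disc.\<close>

lemma local_index_exists:
  assumes "r > 0" "continuous_on (ball a r - {a}) g" "\<And>z. z \<in> ball a r - {a} \<Longrightarrow> g z \<noteq> 0"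
  shows "\<exists>n. local_index g a n"
proof -
  define S where "S = {w::complex. Re w < ln r}"
  have "convex S" unfolding S_def by (rule convex_halfspace_Re_lt)
  have inS: "a + exp w \<in> ball a r - {a}" if "w \<in> S" for w
  proof -
    have "exp (Re w) < r" using that assms(1) unfolding S_def by (metis exp_less_mono exp_ln mem_Collect_eq)
    then show ?thesis by (simp add: dist_norm)
  qed
  have Sin: "w \<in> S" if "exp w = z - a" "z \<in> ball a r - {a}" for w z
  proof -
    have "exp (Re w) = norm (z - a)" using that(1) by (metis norm_exp_eq_Re)
    also have "\<dots> < r" using that by (simp add: dist_norm norm_minus_commute)
    finally have "Re w < ln r" using assms(1) by (metis exp_less_cancel_iff exp_ln)
    then show ?thesis by (simp add: S_def)
  qed
  have "continuous_on S (\<lambda>w. g (a + exp w))"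
    by (rule continuous_on_compose2[OF assms(2)]) (use inS in \<open>auto intro!: continuous_intros\<close>)
  then obtain l where l: "continuous_on S l" "\<And>w. w \<in> S \<Longrightarrow> g (a + exp w) = exp (l w)"
    using continuous_logarithm_on_contractible[of S "\<lambda>w. g (a + exp w)"] inS assms(3)
      convex_imp_contractible[OF \<open>convex S\<close>] by metis
  have S2: "w + 2 * of_real pi * \<i> * of_int k \<in> S" if "w \<in> S" for w and k :: int
    using that by (simp add: S_def)
  have ex: "exp (w + 2 * of_real pi * \<i> * of_int k) = exp w" for w and k :: int
    by (rule exp_plus_2pin[THEN trans[rotated]]) (simp add: algebra_simps)
  have "continuous_on S (\<lambda>w. l (w + 2 * of_real pi * \<i> * of_int 1) - l w)"
    by (intro continuous_intros continuous_on_compose2[OF l(1)] l(1)) (use S2[of _ 1] in auto)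
  moreover have "exp (l (w + 2 * of_real pi * \<i> * of_int 1) - l w) = 1" if "w \<in> S" for w
    using l(2)[OF S2[OF that, of 1]] l(2)[OF that] ex[of w 1] inS[OF that] assms(3)
    by (auto simp: exp_diff)
  ultimately obtain n :: int
    where n: "\<forall>w\<in>S. l (w + 2 * of_real pi * \<i> * of_int 1) - l w = 2 * of_real pi * \<i> * of_int n"
    using continuous_exp_eq_1_constant[OF convex_connected[OF \<open>convex S\<close>]] by blast
  define M where "M = (\<lambda>w. l w - of_int n * w)"
  have M1: "M (w + 2 * of_real pi * \<i> * of_int 1) = M w" if "w \<in> S" for w
    using n that by (auto simp: M_def algebra_simps)
  have Mk: "M (w + 2 * of_real pi * \<i> * of_int k) = M w" if "w \<in> S" for w and k :: int
  proof (induction k rule: int_induct[of _ 0])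
    case (step1 i)
    have "w + 2 * of_real pi * \<i> * of_int (i+1) = (w + 2 * of_real pi * \<i> * of_int i) + 2 * of_real pi * \<i> * of_int 1"
      by (simp add: algebra_simps)
    then show ?case using M1[OF S2[OF that, of i]] step1 by metis
  next
    case (step2 i)
    have "w + 2 * of_real pi * \<i> * of_int i = (w + 2 * of_real pi * \<i> * of_int (i-1)) + 2 * of_real pi * \<i> * of_int 1"
      by (simp add: algebra_simps)
    then show ?case using M1[OF S2[OF that, of "i-1"]] step2 by metis
  qed simp
  \<comment> \<open>The principal \<open>Ln\<close> jumps along its slit, but \<open>M\<close> has
    period 2 \<pi> i, so any other logarithm of z - a yields the same value.\<close>
  define L where "L = (\<lambda>z. M (Ln (z - a)))"
  have LM: "L z = M w" if ew: "exp w = z - a" "z \<in> ball a r - {a}" for w z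
  proof -
    have "exp (Ln (z - a)) = z - a" using ew by auto
    then obtain k :: int where "w = Ln (z - a) + (of_int (2 * k) * pi) * \<i>"
      using ew(1) exp_eq[of w "Ln (z - a)"] by metis
    then have "w = Ln (z - a) + 2 * of_real pi * \<i> * of_int k" by (simp add: algebra_simps)
    then show ?thesis using Mk Sin[OF \<open>exp (Ln (z - a)) = z - a\<close> ew(2)] by (simp add: L_def)
  qed
  have contM: "continuous_on S M" unfolding M_def by (intro continuous_intros l(1))
  \<comment> \<open>Two oppositely slit discs; on the second one Ln (-(z - a)) + i \<pi> serves as
    the continuous branch.\<close>
  define O1 where "O1 = (ball a r - {a}) \<inter> {z. z - a \<notin> \<real>\<^sub>\<le>\<^sub>0}"
  define O2 where "O2 = (ball a r - {a}) \<inter> {z. - (z - a) \<notin> \<real>\<^sub>\<le>\<^sub>0}"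
  have c1: "continuous_on O1 L" unfolding L_def
  proof (rule continuous_on_compose2[OF contM])
    show "continuous_on O1 (\<lambda>z. Ln (z - a))"
      by (intro continuous_intros) (auto simp: O1_def)
    show "(\<lambda>z. Ln (z - a)) ` O1 \<subseteq> S"
    proof safe
      fix z assume "z \<in> O1"
      then show "Ln (z - a) \<in> S" by (intro Sin[of _ z]) (auto simp: O1_def)
    qed
  qed
  have "continuous_on O2 (\<lambda>z. M (Ln (- (z - a)) + of_real pi * \<i>))"
  proof (rule continuous_on_compose2[OF contM])
    show "continuous_on O2 (\<lambda>z. Ln (- (z - a)) + of_real pi * \<i>)"
      by (intro continuous_intros) (auto simp: O2_def)
    show "(\<lambda>z. Ln (- (z - a)) + of_real pi * \<i>) ` O2 \<subseteq> S"
    proof safe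
      fix z assume "z \<in> O2"
      then show "Ln (- (z - a)) + of_real pi * \<i> \<in> S" by (intro Sin[of _ z]) (auto simp: O2_def exp_add)
    qed
  qed
  then have c2: "continuous_on O2 L"
  proof (rule continuous_on_eq)
    fix z assume z: "z \<in> O2"
    have "exp (Ln (- (z - a)) + of_real pi * \<i>) = z - a" using z by (auto simp: O2_def exp_add)
    from LM[OF this] show "M (Ln (- (z - a)) + of_real pi * \<i>) = L z" using z by (simp add: O2_def)
  qed
  have "open O1" "open O2"
  proof -
    have "open (- \<real>\<^sub>\<le>\<^sub>0 :: complex set)" by (intro open_Compl closed_nonpos_Reals_complex)
    then have "open ((\<lambda>z. z - a) -` (- \<real>\<^sub>\<le>\<^sub>0))" "open ((\<lambda>z. - (z - a)) -` (- \<real>\<^sub>\<le>\<^sub>0))"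
      by (intro open_vimage continuous_intros; simp)+
    moreover have "(\<lambda>z. z - a) -` (- \<real>\<^sub>\<le>\<^sub>0) = {z. z - a \<notin> \<real>\<^sub>\<le>\<^sub>0}"
      "(\<lambda>z. - (z - a)) -` (- \<real>\<^sub>\<le>\<^sub>0) = {z. - (z - a) \<notin> \<real>\<^sub>\<le>\<^sub>0}" by auto
    ultimately have "open {z. z - a \<notin> \<real>\<^sub>\<le>\<^sub>0}" "open {z. - (z - a) \<notin> \<real>\<^sub>\<le>\<^sub>0}" by metis+
    then show "open O1" "open O2" unfolding O1_def O2_def by (auto intro!: open_Int open_Diff)
  qed
  moreover have "w = 0" if "w \<in> \<real>\<^sub>\<le>\<^sub>0" "- w \<in> \<real>\<^sub>\<le>\<^sub>0" for w :: complex
    using that by (simp add: complex_nonpos_Reals_iff complex_eq_iff)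
  then have "z - a \<notin> \<real>\<^sub>\<le>\<^sub>0 \<or> - (z - a) \<notin> \<real>\<^sub>\<le>\<^sub>0" if "z \<noteq> a" for z
    using that by (metis eq_iff_diff_eq_0)
  then have "O1 \<union> O2 = ball a r - {a}"
    unfolding O1_def O2_def by blast
  ultimately have "continuous_on (ball a r - {a}) L"
    using continuous_on_open_Un[OF _ _ c1 c2] by metis
  moreover have "g z = (z - a) powi n * exp (L z)" if z: "z \<in> ball a r - {a}" for z
  proof -
    have e: "exp (Ln (z - a)) = z - a" using that by auto
    have "(z - a) powi n = exp (of_int n * Ln (z - a))" 
      by (subst e[symmetric]) (simp add: exp_power_int)
    moreover have "g z = exp (l (Ln (z - a)))"
      using l(2)[OF Sin[OF e z]] e by simp
    ultimately show ?thesis unfolding L_def M_def by (simp add: exp_diff)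
  qed
  ultimately show ?thesis using local_indexI[OF assms(1)] by blast
qed

text \<open>Write T z - T b = (z - b) q(z). Here \<open>q\<close> is holomorphic, and it has no
  zeros because \<open>T\<close> is injective. It therefore has a logarithm on a small disc, and its
  n-th power is absorbed by the exponential factor.\<close>

lemma local_index_compose:
  assumes "local_index g (T b) n" "open S" "b \<in> S" "T holomorphic_on S" "inj_on T S"
  shows "local_index (g \<circ> T) b n"
proof -
  define q where "q = (\<lambda>z. if z = b then deriv T b else (T z - T b) / (z - b))"
  have "q holomorphic_on S"
    unfolding q_def using assms by (intro pole_lemma) (auto simp: interior_open)
  then have cq: "continuous_on S q" by (rule holomorphic_on_imp_continuous_on)
  have q0: "q z \<noteq> 0" if "z \<in> S" for z
    using that assms holomorphic_injective_imp_regular[OF assms(4,2,5)] by (auto simp: q_def inj_on_def)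
  obtain r l where rl: "r > 0" "continuous_on (ball (T b) r - {T b}) l"
    "\<And>z. z \<in> ball (T b) r - {T b} \<Longrightarrow> g z = (z - T b) powi n * exp (l z)"
    by (rule local_indexE[OF assms(1) zero_less_one]) blast
  have cT: "continuous_on S T" using assms(4) by (rule holomorphic_on_imp_continuous_on)
  have "open (T -` ball (T b) r \<inter> S)"
    using continuous_open_preimage[OF cT assms(2) open_ball] by (simp add: Int_commute)
  then obtain s where s: "s > 0" "ball b s \<subseteq> T -` ball (T b) r \<inter> S"
    using assms(3) rl(1) by (metis IntI centre_in_ball openE vimageI)
  obtain k where k: "continuous_on (ball b s) k" "\<And>z. z \<in> ball b s \<Longrightarrow> q z = exp (k z)"
    using continuous_logarithm_on_ball[of b s q] q0 s(2) continuous_on_subset[OF cq] by blast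
  have Tz: "T z \<in> ball (T b) r - {T b}" if "z \<in> ball b s - {b}" for z
  proof -
    have "z \<in> S" "T z \<in> ball (T b) r" "z \<noteq> b" using s(2) that by auto
    then show ?thesis using assms(3,5) by (auto simp: inj_on_def)
  qed
  show ?thesis
  proof (rule local_indexI[OF s(1)])
    show "continuous_on (ball b s - {b}) (\<lambda>z. of_int n * k z + l (T z))"
      by (intro continuous_intros continuous_on_compose2[OF rl(2)] continuous_on_subset[OF k(1)]
          continuous_on_subset[OF cT]) (use s Tz in auto)
    fix z assume z: "z \<in> ball b s - {b}"
    have "T z - T b = (z - b) * exp (k z)"
      using k(2)[of z] z by (simp add: q_def divide_simps mult.commute split: if_splits)
    then show "(g \<circ> T) z = (z - b) powi n * exp (of_int n * k z + l (T z))"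
      using rl(3)[OF Tz[OF z]]
      by (simp add: power_int_mult_distrib exp_add exp_power_int mult.commute[of _ "of_int n"])
  qed
qed

lemma extend_continuous_sphere:
  fixes l :: "'a::euclidean_space \<Rightarrow> 'b::euclidean_space"
  assumes "continuous_on (sphere a r) l"
  obtains l' where "continuous_on UNIV l'" "\<And>z. z \<in> sphere a r \<Longrightarrow> l' z = l z"
  using Tietze_unbounded[of "sphere a r" l UNIV] assms by auto

text \<open>Exponent 0 means that \<open>h\<close> itself has a logarithm on a punctured disc. Its
  restriction to a circle extends by Tietze, and the exponential of the extension fills the disc
  without zeros.\<close>

lemma index_zero_remove:
  assumes "local_index h x 0" "e > 0"
  obtains h' d where "0 < d" "d < e" "continuous_on (cball x d) h'"
    "\<And>z. z \<in> cball x d \<Longrightarrow> h' z \<noteq> 0"  "\<And>z. z \<in> sphere x d \<Longrightarrow> h' z = h z"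
proof -
  obtain r l where rl: "r > 0" "r < e" "continuous_on (ball x r - {x}) l"
    "\<And>z. z \<in> ball x r - {x} \<Longrightarrow> h z = (z - x) powi 0 * exp (l z)"
    by (rule local_indexE[OF assms]) blast
  have sub: "sphere x (r/2) \<subseteq> ball x r - {x}" using rl(1) by auto
  obtain l' where l': "continuous_on UNIV l'" "\<And>z. z \<in> sphere x (r/2) \<Longrightarrow> l' z = l z"
    using extend_continuous_sphere[OF continuous_on_subset[OF rl(3) sub]] by blast
  show thesis
  proof (rule that)
    show "0 < r/2" "r/2 < e" using rl by auto
    show "continuous_on (cball x (r/2)) (\<lambda>z. exp (l' z))"
      by (intro continuous_intros continuous_on_subset[OF l'(1)]) auto
    show "exp (l' z) = h z" if "z \<in> sphere x (r/2)" for z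
      using rl(4)[of z] l'(2)[OF that] that sub by auto
  qed simp
qed

text \<open>A continuous argument principle, removing one singularity \<open>x\<close> at a time:
  multiplication by (z - x)^(-n x) makes its index 0, so a small disc around it can be refilled. On
  the outer circle, z - x differs from z - a by a factor that has a logarithm.\<close>

lemma sphere_sum_local_index:
  fixes n :: "complex \<Rightarrow> int"
  assumes "finite K" "K \<subseteq> ball a r" "r > 0"
    and "continuous_on (cball a r - K) g" "\<And>z. z \<in> cball a r - K \<Longrightarrow> g z \<noteq> 0"
    and "\<And>x. x \<in> K \<Longrightarrow> local_index g x (n x)"
  shows "\<exists>l. continuous_on (sphere a r) l \<and>
    (\<forall>z\<in>sphere a r. g z = (z - a) powi (\<Sum>x\<in>K. n x) * exp (l z))"
  using assms
proof (induction K arbitrary: g rule: finite_induct)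
  case empty
  then obtain l where "continuous_on (cball a r) l" "\<And>z. z \<in> cball a r \<Longrightarrow> g z = exp (l z)"
    using continuous_logarithm_on_cball[of a r g] by auto
  then show ?case by (intro exI[of _ l]) (auto intro: continuous_on_subset)
next
  case (insert x K)
  have xr: "x \<in> ball a r" using insert.prems by auto
  define f where "f = (\<lambda>z. g z * (z - x) powi (- n x))"
  have fc: "continuous_on (cball a r - insert x K) f" unfolding f_def
    by (intro continuous_intros insert.prems) auto
  have f0: "f z \<noteq> 0" if "z \<in> cball a r - insert x K" for z
    using insert.prems(4)[OF that] that by (simp add: f_def)
  have "local_index f x (n x + (- n x))" unfolding f_def
    by (intro local_index_mult insert.prems(5) local_index_power_diff) auto
  then have fx: "local_index f x 0" by simp
  have fy: "local_index f y (n y)" if "y \<in> K" for y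
  proof -
    have "y \<noteq> x" using that insert.hyps by auto
    have "local_index (\<lambda>z. (z - x) powi (- n x)) y 0"
      by (rule local_index_nonzero[of "dist x y"]) (use \<open>y \<noteq> x\<close> in \<open>auto intro!: continuous_intros simp: dist_commute\<close>)
    from local_index_mult[OF insert.prems(5)[of y] this] show ?thesis
      using that by (simp add: f_def)
  qed
  \<comment> \<open>The refilled disc is kept inside the large one and off \<open>K\<close>, so that
    neither the boundary values nor the other indices change.\<close>
  have "open (ball a r - K)" using insert.hyps by (auto intro!: open_Diff finite_imp_closed)
  then obtain e where e: "e > 0" "cball x e \<subseteq> ball a r - K"
    using xr insert.hyps open_contains_cball by (metis DiffI)
  obtain h' d where h': "0 < d" "d < e" "continuous_on (cball x d) h'"
    "\<And>z. z \<in> cball x d \<Longrightarrow> h' z \<noteq> 0"  "\<And>z. z \<in> sphere x d \<Longrightarrow> h' z = f z"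
    by (rule index_zero_remove[OF fx e(1)]) blast
  have de: "cball x d \<subseteq> ball a r - K" using e h'(2) by (meson dual_order.trans less_imp_le subset_cball)
  define h where "h = (\<lambda>z. if z \<in> cball x d then h' z else f z)"
  have "continuous_on ((cball x d) \<union> (cball a r - K - ball x d)) h"
    unfolding h_def
  proof (rule continuous_on_Un_local)
    have *: "cball x d \<union> (cball a r - K - ball x d) = cball a r - K" using de by auto
    show "closedin (top_of_set (cball x d \<union> (cball a r - K - ball x d))) (cball x d)"
      by (auto simp: closedin_closed intro!: exI[of _ "cball x d"])
    show "closedin (top_of_set (cball x d \<union> (cball a r - K - ball x d))) (cball a r - K - ball x d)"
      using * by (auto simp: closedin_closed intro!: exI[of _ "- ball x d"])
    show "continuous_on (cball x d) (\<lambda>z. if z \<in> cball x d then h' z else f z)"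
      using h'(3) by (rule continuous_on_eq) simp
    have "continuous_on (cball a r - K - ball x d) f"
      by (rule continuous_on_subset[OF fc]) (use h'(1) in auto)
    then show "continuous_on (cball a r - K - ball x d) (\<lambda>z. if z \<in> cball x d then h' z else f z)"
      by (rule continuous_on_eq) (use h'(5) in auto)
  qed
  moreover have "(cball x d) \<union> (cball a r - K - ball x d) = cball a r - K" using de by auto
  ultimately have hc: "continuous_on (cball a r - K) h" by simp
  have h0: "h z \<noteq> 0" if "z \<in> cball a r - K" for z
  proof (cases "z \<in> cball x d")
    case True
    then show ?thesis using h'(4) by (simp add: h_def)
  next
    case False
    then have "z \<noteq> x" using h'(1) by auto
    then show ?thesis using False f0[of z] that by (simp add: h_def)
  qed
  have hy: "local_index h y (n y)" if y: "y \<in> K" for y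
  proof -
    have "open (- cball x d)" "y \<in> - cball x d" using de y by auto
    then obtain s where "s > 0" "ball y s \<subseteq> - cball x d" by (meson openE)
    then show ?thesis
      by (intro local_index_cong[OF fy[OF y], of s]) (auto simp: h_def)
  qed
  obtain l where l: "continuous_on (sphere a r) l"
      "\<And>z. z \<in> sphere a r \<Longrightarrow> h z = (z - a) powi (\<Sum>x\<in>K. n x) * exp (l z)"
    using insert.IH[OF _ insert.prems(2) hc h0 hy] insert.prems(1) by auto
  \<comment> \<open>This is (z - x) / (z - a). On the circle |x - a| < |z - a|, so its real part is
    positive and the principal logarithm is continuous on its values.\<close>
  define q where "q = (\<lambda>z. 1 - (x - a) / (z - a))"
  have qRe: "q z \<notin> \<real>\<^sub>\<le>\<^sub>0" "z - x = (z - a) * q z" if z: "z \<in> sphere a r" for z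
  proof -
    have "z \<noteq> a" using z insert.prems(2) by auto
    then show "z - x = (z - a) * q z" by (simp add: q_def field_simps)
    have "norm ((x - a) / (z - a)) < 1"
      using z xr insert.prems(2) by (simp add: norm_divide dist_norm norm_minus_commute)
    then have "Re ((x - a) / (z - a)) < 1"
      using complex_Re_le_cmod[of "(x - a) / (z - a)"] by linarith
    then show "q z \<notin> \<real>\<^sub>\<le>\<^sub>0" by (simp add: q_def complex_nonpos_Reals_iff)
  qed
  show ?case
  proof (intro exI conjI ballI)
    have "continuous_on (sphere a r) q" unfolding q_def
      by (intro continuous_intros) (use insert.prems(2) in auto)
    then show "continuous_on (sphere a r) (\<lambda>z. l z + of_int (n x) * Ln (q z))"
      by (intro continuous_intros l(1)) (use qRe in auto)
    fix z assume z: "z \<in> sphere a r"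
    have za: "z - a \<noteq> 0" using z insert.prems(2) by auto
    have zx: "z - x \<noteq> 0" using z xr by auto
    have "q z \<noteq> 0" using qRe[OF z] by auto
    have "z \<notin> cball x d" using de z by auto
    then have "h z = g z * (z - x) powi (- n x)" by (simp add: h_def f_def)
    then have "g z = h z * (z - x) powi (n x)" using zx by (simp add: power_int_minus)
    also have "\<dots> = (z - a) powi (\<Sum>x\<in>K. n x) * exp (l z) * ((z - a) powi n x * q z powi n x)"
      using l(2)[OF z] qRe(2)[OF z] by (simp add: power_int_mult_distrib)
    also have "q z powi n x = exp (of_int (n x) * Ln (q z))"
      using \<open>q z \<noteq> 0\<close> by (metis exp_Ln exp_power_int mult.commute)
    finally show "g z = (z - a) powi (\<Sum>x\<in>insert x K. n x) * exp (l z + of_int (n x) * Ln (q z))"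
      using insert.hyps za by (simp add: power_int_add exp_add)
  qed
qed

text \<open>Equating the two factorizations on the boundary circle provides a logarithm for a power
  of z - a. This is what preserves an index sum when a map is replaced inside a disc.\<close>

lemma sum_local_index_eq:
  fixes n n' :: "complex \<Rightarrow> int"
  assumes "finite K" "K \<subseteq> ball a r" "finite K'" "K' \<subseteq> ball a r" "r > 0"
    and "continuous_on (cball a r - K) g" "\<And>z. z \<in> cball a r - K \<Longrightarrow> g z \<noteq> 0"
    and "\<And>x. x \<in> K \<Longrightarrow> local_index g x (n x)"
    and "continuous_on (cball a r - K') g'" "\<And>z. z \<in> cball a r - K' \<Longrightarrow> g' z \<noteq> 0"
    and "\<And>x. x \<in> K' \<Longrightarrow> local_index g' x (n' x)"
    and "\<And>z. z \<in> sphere a r \<Longrightarrow> g z = g' z"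
  shows "(\<Sum>x\<in>K. n x) = (\<Sum>x\<in>K'. n' x)"
proof -
  obtain l where l: "continuous_on (sphere a r) l"
      "\<And>z. z \<in> sphere a r \<Longrightarrow> g z = (z - a) powi (\<Sum>x\<in>K. n x) * exp (l z)"
    using sphere_sum_local_index[OF assms(1,2,5-8)] by blast
  obtain l' where l': "continuous_on (sphere a r) l'"
      "\<And>z. z \<in> sphere a r \<Longrightarrow> g' z = (z - a) powi (\<Sum>x\<in>K'. n' x) * exp (l' z)"
    using sphere_sum_local_index[OF assms(3,4,5,9,10,11)] by blast
  have "(\<Sum>x\<in>K. n x) - (\<Sum>x\<in>K'. n' x) = 0"
  proof (rule circle_powi_eq_exp_imp_zero[OF assms(5)])
    show "continuous_on (sphere a r) (\<lambda>z. l' z - l z)" by (intro continuous_intros l l')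
    fix z assume z: "z \<in> sphere a r"
    then have "z - a \<noteq> 0" using assms(5) by auto
    then show "(z - a) powi ((\<Sum>x\<in>K. n x) - (\<Sum>x\<in>K'. n' x)) = exp (l' z - l z)"
      using l(2)[OF z] l'(2)[OF z] assms(12)[OF z]
      by (simp add: power_int_diff exp_diff field_simps)
  qed
  then show ?thesis by simp
qed

section \<open>Cocycles on compact Riemann surfaces\<close>

text \<open>Coordinates are arbitrary outside the domain of a chart, so the preimage is cut down to
  \<open>fst c\<close>.\<close>

definition chart_set :: "('m, 'e) chart \<Rightarrow> 'e set \<Rightarrow> 'm set" where
  "chart_set c B = {x \<in> fst c. snd c x \<in> B}"

locale compact_riemann_surface =
  fixes A :: "('a::t2_space, complex) chart set"
  assumes compact_surface: "compact (UNIV :: 'a set)"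
    and connected_surface: "connected (UNIV :: 'a set)"
    and surface: "riemann_surface A"
begin

lemma chart_at: "\<exists>c\<in>A. x \<in> fst c"
  using surface unfolding riemann_surface_def by blast

context
  fixes c assumes c: "c \<in> A"
begin

lemma open_chart: "open (fst c)" "open (chart_image c)"
  using surface c by (auto simp: riemann_surface_def)

lemma inj_on_chart: "inj_on (snd c) (fst c)"
proof -
  obtain k where "homeomorphism (fst c) (chart_image c) (snd c) k"
    using surface c by (auto simp: riemann_surface_def)
  then show ?thesis by (metis homeomorphism_def inj_on_inverseI)
qed

lemma chart_inv_chart [simp]: "x \<in> fst c \<Longrightarrow> chart_inv c (snd c x) = x"
  by (simp add: chart_inv_def inj_on_chart)

lemma chart_inv_in: "y \<in> chart_image c \<Longrightarrow> chart_inv c y \<in> fst c"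
  by (metis chart_inv_def chart_image_def inv_into_into)

lemma chart_chart_inv [simp]: "y \<in> chart_image c \<Longrightarrow> snd c (chart_inv c y) = y"
  by (metis chart_inv_def chart_image_def f_inv_into_f)

lemma continuous_on_chart: "continuous_on (fst c) (snd c)"
  using surface c by (auto simp: riemann_surface_def homeomorphism_def)

lemma continuous_on_chart_inv: "continuous_on (chart_image c) (chart_inv c)"
proof -
  obtain k where k: "homeomorphism (fst c) (chart_image c) (snd c) k"
    using surface c by (auto simp: riemann_surface_def)
  have "continuous_on (chart_image c) k" using k by (simp add: homeomorphism_def)
  then show ?thesis
  proof (rule continuous_on_eq)
    fix y assume "y \<in> chart_image c"
    then obtain x where "x \<in> fst c" "y = snd c x" by (auto simp: chart_image_def)
    then show "k y = chart_inv c y" using k by (simp add: homeomorphism_def)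
  qed
qed

lemma chart_set_eq_image: "B \<subseteq> chart_image c \<Longrightarrow> chart_set c B = chart_inv c ` B"
proof (intro equalityI subsetI)
  fix x assume "x \<in> chart_set c B"
  then have "x = chart_inv c (snd c x)" "snd c x \<in> B" by (auto simp: chart_set_def)
  then show "x \<in> chart_inv c ` B" by blast
next
  fix x assume B: "B \<subseteq> chart_image c" and "x \<in> chart_inv c ` B"
  then obtain y where "x = chart_inv c y" "y \<in> B" "y \<in> chart_image c" by blast
  then show "x \<in> chart_set c B" by (simp add: chart_set_def chart_inv_in)
qed

lemma open_chart_set: "open B \<Longrightarrow> open (chart_set c B)"
proof -
  assume "open B"
  then have "open (fst c \<inter> snd c -` B)"
    by (rule continuous_open_preimage[OF continuous_on_chart open_chart(1)])
  then show ?thesis by (simp add: chart_set_def vimage_def Int_def)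
qed

lemma compact_chart_set: "compact B \<Longrightarrow> B \<subseteq> chart_image c \<Longrightarrow> compact (chart_set c B)"
  by (simp add: chart_set_eq_image)
    (meson compact_continuous_image continuous_on_chart_inv continuous_on_subset)

lemma closed_chart_set: "compact B \<Longrightarrow> B \<subseteq> chart_image c \<Longrightarrow> closed (chart_set c B)"
  by (simp add: compact_chart_set compact_imp_closed)

lemma chart_inv_in_chart_set: "B \<subseteq> chart_image c \<Longrightarrow> y \<in> B \<Longrightarrow> chart_inv c y \<in> chart_set c B"
  by (auto simp: chart_set_def chart_inv_in subsetD)

lemma finite_chart_set: "finite B \<Longrightarrow> B \<subseteq> chart_image c \<Longrightarrow> finite (chart_set c B)"
  by (simp add: chart_set_eq_image)

lemma transition_holomorphic:
  "d \<in> A \<Longrightarrow> (snd d \<circ> chart_inv c) holomorphic_on (snd c ` (fst c \<inter> fst d))"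
  using surface c by (auto simp: riemann_surface_def)

lemma open_chart_image_subset:
  assumes "open W" shows "open (snd c ` (fst c \<inter> W))"
proof -
  have "snd c ` (fst c \<inter> W) = chart_image c \<inter> chart_inv c -` W"
    by (force simp: chart_image_def)
  then show ?thesis
    using continuous_open_preimage[OF continuous_on_chart_inv open_chart(2) assms] by simp
qed

end

lemma chart_disc_at:
  assumes "open W" "x \<in> W" "finite F"
  obtains c r where "c \<in> A" "x \<in> fst c" "r > 0" "cball (snd c x) r \<subseteq> chart_image c"
    "chart_set c (cball (snd c x) r) \<subseteq> W" "F \<inter> chart_set c (sphere (snd c x) r) = {}"
proof -
  obtain c where c: "c \<in> A" "x \<in> fst c" using chart_at by blast
  have "open (snd c ` (fst c \<inter> W))" by (rule open_chart_image_subset[OF c(1) assms(1)])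
  moreover have "snd c x \<in> snd c ` (fst c \<inter> W)" using c assms by auto
  ultimately obtain r0 where r0: "r0 > 0" "cball (snd c x) r0 \<subseteq> snd c ` (fst c \<inter> W)"
    using open_contains_cball by metis
  \<comment> \<open>Only finitely many radii put a point of \<open>F\<close> on the boundary
    circle.\<close>
  have "infinite ({0<..<r0} - (\<lambda>y. dist (snd c x) (snd c y)) ` F)"
    using r0(1) assms(3) by (intro Diff_infinite_finite) (auto simp: infinite_Ioo)
  then obtain r where r: "r \<in> {0<..<r0} - (\<lambda>y. dist (snd c x) (snd c y)) ` F"
    by (metis finite.emptyI equals0I)
  have sub: "cball (snd c x) r \<subseteq> snd c ` (fst c \<inter> W)" using r r0 by auto
  show thesis
  proof (rule that[OF c, of r])
    show "cball (snd c x) r \<subseteq> chart_image c" using sub by (auto simp: chart_image_def)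
    show "chart_set c (cball (snd c x) r) \<subseteq> W"
    proof
      fix y assume "y \<in> chart_set c (cball (snd c x) r)"
      then have "y \<in> fst c" "snd c y \<in> snd c ` (fst c \<inter> W)" using sub by (auto simp: chart_set_def)
      then show "y \<in> W" using inj_on_chart[OF c(1)] by (auto simp: inj_on_def)
    qed
    show "F \<inter> chart_set c (sphere (snd c x) r) = {}" using r by (auto simp: chart_set_def)
  qed (use r in auto)
qed

definition point_index :: "('a \<Rightarrow> complex) \<Rightarrow> 'a \<Rightarrow> int \<Rightarrow> bool" where
  "point_index F x n \<longleftrightarrow> (\<exists>c\<in>A. x \<in> fst c \<and> local_index (F \<circ> chart_inv c) (snd c x) n)"

text \<open>Coordinate changes are holomorphic, hence orientation preserving, so the sign of the index
  does not depend on the chart.\<close>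

lemma point_index_chart:
  assumes "point_index F x n" "c \<in> A" "x \<in> fst c"
  shows "local_index (F \<circ> chart_inv c) (snd c x) n"
proof -
  obtain d where d: "d \<in> A" "x \<in> fst d" "local_index (F \<circ> chart_inv d) (snd d x) n"
    using assms(1) by (auto simp: point_index_def)
  define S where "S = snd c ` (fst c \<inter> fst d)"
  define T where "T = snd d \<circ> chart_inv c"
  have S: "open S" "snd c x \<in> S" unfolding S_def
    using open_chart_image_subset[OF assms(2) open_chart(1)[OF d(1)]] d assms by auto
  have "inj_on T S" unfolding T_def S_def
    using inj_on_chart[OF assms(2)] inj_on_chart[OF d(1)] assms(2)
    by (auto simp: inj_on_def)
  moreover have "T holomorphic_on S"
    unfolding T_def S_def by (rule transition_holomorphic[OF assms(2) d(1)])
  moreover have "T (snd c x) = snd d x" using assms by (simp add: T_def)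
  ultimately have *: "local_index ((F \<circ> chart_inv d) \<circ> T) (snd c x) n"
    using local_index_compose[of "F \<circ> chart_inv d" T "snd c x" n S] d(3) S by simp
  obtain e where e: "e > 0" "ball (snd c x) e \<subseteq> S" using S by (metis openE)
  show ?thesis
  proof (rule local_index_cong[OF * e(1)])
    fix z assume "z \<in> ball (snd c x) e - {snd c x}"
    then have "z \<in> S" using e by auto
    then show "((F \<circ> chart_inv d) \<circ> T) z = (F \<circ> chart_inv c) z"
      using assms(2) d(1) by (auto simp: S_def T_def)
  qed
qed

lemma point_index_cong:
  assumes "point_index F x n" "open W" "x \<in> W" "\<And>y. y \<in> W - {x} \<Longrightarrow> F y = F' y"
  shows "point_index F' x n"
proof -
  obtain c where c: "c \<in> A" "x \<in> fst c" using chart_at by blast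
  have "open (snd c ` (fst c \<inter> W))" by (rule open_chart_image_subset[OF c(1) assms(2)])
  moreover have "snd c x \<in> snd c ` (fst c \<inter> W)" using c assms by auto
  ultimately obtain e where e: "e > 0" "ball (snd c x) e \<subseteq> snd c ` (fst c \<inter> W)" by (metis openE)
  have "local_index (F' \<circ> chart_inv c) (snd c x) n"
  proof (rule local_index_cong[OF point_index_chart[OF assms(1) c] e(1)])
    fix z assume z: "z \<in> ball (snd c x) e - {snd c x}"
    then obtain y where "y \<in> fst c \<inter> W" "z = snd c y" using e(2) by blast
    then show "(F \<circ> chart_inv c) z = (F' \<circ> chart_inv c) z" using z c assms(4)[of y] by auto
  qed
  then show ?thesis using c by (auto simp: point_index_def)
qed

lemma point_index_exists:
  assumes "open W" "x \<in> W" "continuous_on (W - {x}) F" "\<And>y. y \<in> W - {x} \<Longrightarrow> F y \<noteq> 0"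
  shows "\<exists>n. point_index F x n"
proof -
  obtain c r where c: "c \<in> A" "x \<in> fst c" "r > 0" "cball (snd c x) r \<subseteq> chart_image c"
    "chart_set c (cball (snd c x) r) \<subseteq> W"
    by (rule chart_disc_at[OF assms(1,2) finite.emptyI]) blast
  have in': "chart_inv c z \<in> W - {x}" "z \<in> chart_image c" if "z \<in> ball (snd c x) r - {snd c x}" for z
  proof -
    have z: "z \<in> cball (snd c x) r" using that by auto
    then show "z \<in> chart_image c" using c by auto
    then have "chart_inv c z \<noteq> x" using that c by auto
    then show "chart_inv c z \<in> W - {x}" using chart_inv_in_chart_set[OF c(1,4) z] c(5) by auto
  qed
  have "continuous_on (ball (snd c x) r - {snd c x}) (F \<circ> chart_inv c)"
    unfolding comp_def
    by (rule continuous_on_compose2[OF assms(3) continuous_on_subset[OF continuous_on_chart_inv[OF c(1)]]])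
      (use in' in blast)+
  then show ?thesis
    using local_index_exists[OF c(3), of "snd c x" "F \<circ> chart_inv c"] in'(1) assms(4) c
    by (auto simp: point_index_def)
qed

end

section \<open>Circle-valued cocycles, their sections, and surgery on discs\<close>

locale surface_cocycle = compact_riemann_surface A
  for A :: "('a::t2_space, complex) chart set" +
  fixes I :: "'i set" and U :: "'i \<Rightarrow> 'a set" and g :: "'i \<Rightarrow> 'i \<Rightarrow> 'a \<Rightarrow> complex"
  assumes open_U: "i \<in> I \<Longrightarrow> open (U i)"
    and cover_U: "(\<Union>i\<in>I. U i) = UNIV"
    and continuous_g: "i \<in> I \<Longrightarrow> j \<in> I \<Longrightarrow> continuous_on (U i \<inter> U j) (g i j)"
    and norm_g: "i \<in> I \<Longrightarrow> j \<in> I \<Longrightarrow> x \<in> U i \<inter> U j \<Longrightarrow> cmod (g i j x) = 1"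
    and cocycle: "i \<in> I \<Longrightarrow> j \<in> I \<Longrightarrow> k \<in> I \<Longrightarrow> x \<in> U i \<inter> U j \<inter> U k \<Longrightarrow>
      g i k x = g i j x * g j k x"
begin

lemma g_self: "i \<in> I \<Longrightarrow> x \<in> U i \<Longrightarrow> g i i x = 1"
  using cocycle[of i i i x] norm_g[of i i x] by force

text \<open>A unit section over \<open>S\<close> of the bundle with transition functions
  \<open>g\<close>, given by its local representatives; the values of \<open>v i\<close> outside
  \<open>U i\<close> and \<open>S\<close> are arbitrary.\<close>

definition section_on :: "'a set \<Rightarrow> ('i \<Rightarrow> 'a \<Rightarrow> complex) \<Rightarrow> bool" where
  "section_on S v \<longleftrightarrow> (\<forall>i\<in>I. continuous_on (U i \<inter> S) (v i) \<and> (\<forall>x\<in>U i \<inter> S. cmod (v i x) = 1) \<and>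
     (\<forall>j\<in>I. \<forall>x\<in>U i \<inter> U j \<inter> S. v j x = g i j x * v i x))"

lemma section_onD:
  assumes "section_on S v" "i \<in> I"
  shows "continuous_on (U i \<inter> S) (v i)" "\<And>x. x \<in> U i \<Longrightarrow> x \<in> S \<Longrightarrow> cmod (v i x) = 1"
    "\<And>j x. j \<in> I \<Longrightarrow> x \<in> U i \<Longrightarrow> x \<in> U j \<Longrightarrow> x \<in> S \<Longrightarrow> v j x = g i j x * v i x"
  using assms unfolding section_on_def by blast+

lemma section_on_mono:
  assumes "section_on S v" "T \<subseteq> S"
  shows "section_on T v"
  unfolding section_on_def
proof (intro ballI conjI)
  fix i assume i: "i \<in> I"
  show "continuous_on (U i \<inter> T) (v i)"
    by (rule continuous_on_subset[OF section_onD(1)[OF assms(1) i]]) (use assms(2) in auto)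
qed (use assms section_on_def in blast)+

text \<open>Inside a disc contained in \<open>U i\<close>, a section may be replaced by any unit
  function \<open>e\<close> that matches it on the boundary circle; the other representatives are
  then forced by the cocycle. \<open>K\<close> is the region treated so far, \<open>F\<close> holds
  the singularities there, and \<open>Q\<close> those of \<open>e\<close>. Matching is required only
  where the circle lies in \<open>K\<close>, so the same statement serves to enlarge
  \<open>K\<close> and, when \<open>K\<close> is the whole surface, to alter a section.\<close>

lemma surgery:
  assumes c: "c \<in> A" and sub: "cball a r \<subseteq> chart_image c"
    and i: "i \<in> I" "chart_set c (cball a r) \<subseteq> U i"
    and K: "closed K" and F: "F \<inter> chart_set c (sphere a r) = {}"
    and v: "section_on (K - F) v"
    and Q: "Q \<subseteq> cball a r" "chart_set c Q \<inter> K \<subseteq> chart_set c (ball a r)"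
    and e: "continuous_on (cball a r - Q) e" "\<And>y. y \<in> cball a r - Q \<Longrightarrow> cmod (e y) = 1"
    and ev: "\<And>y. y \<in> sphere a r \<Longrightarrow> chart_inv c y \<in> K \<Longrightarrow> e y = v i (chart_inv c y)"
  obtains v' where
    "section_on ((K \<union> chart_set c (cball a r)) - ((F - chart_set c (ball a r)) \<union> chart_set c Q)) v'"
    "\<And>j x. x \<notin> chart_set c (cball a r) \<Longrightarrow> v' j x = v j x"
    "\<And>x. x \<in> chart_set c (cball a r) \<Longrightarrow> v' i x = e (snd c x)"
proof -
  define D where "D = chart_set c (cball a r)"
  define B where "B = chart_set c (ball a r)"
  define \<Omega> where "\<Omega> = (K \<union> D) - ((F - B) \<union> chart_set c Q)"
  define v' where "v' = (\<lambda>j x. if x \<in> D then g i j x * e (snd c x) else v j x)"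
  have BD: "B \<subseteq> D" "chart_set c Q \<inter> K \<subseteq> B" "chart_set c Q \<subseteq> D"
    using Q by (auto simp: B_def D_def chart_set_def)
  have D: "closed D" unfolding D_def by (rule closed_chart_set[OF c compact_cball sub])
  have B: "open B" unfolding B_def by (rule open_chart_set[OF c open_ball])
  have DB: "D - B = chart_set c (sphere a r)" by (auto simp: B_def D_def chart_set_def)
  have FDB: "F \<inter> (D - B) = {}" using F DB by simp
  \<comment> \<open>Two relatively closed pieces of \<open>\<Omega>\<close>, overlapping only over
    the boundary circle, where \<open>ev\<close> makes the old and the new section agree.\<close>
  have Om: "\<Omega> = (D - chart_set c Q) \<union> (K - F - B)"
    unfolding \<Omega>_def using BD FDB by blast
  have e': "continuous_on (D - chart_set c Q) (\<lambda>x. e (snd c x))"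
  proof (rule continuous_on_compose2[OF e(1)])
    show "continuous_on (D - chart_set c Q) (snd c)"
      by (rule continuous_on_subset[OF continuous_on_chart[OF c]]) (auto simp: D_def chart_set_def)
  qed (auto simp: D_def chart_set_def)
  have en: "cmod (e (snd c x)) = 1" if "x \<in> D - chart_set c Q" for x
    using that e(2)[of "snd c x"] by (auto simp: D_def chart_set_def)
  have ve: "v j x = g i j x * e (snd c x)" if "j \<in> I" "x \<in> U j" "x \<in> D" "x \<in> K - F - B" for j x
  proof -
    have "x \<in> chart_set c (sphere a r)" using that DB by blast
    then have "e (snd c x) = v i x" using ev[of "snd c x"] that c by (auto simp: chart_set_def)
    then show ?thesis using section_onD(3)[OF v i(1) that(1), of x] that i(2) by (auto simp: D_def)
  qed
  have v'v: "v' j x = v j x" if "j \<in> I" "x \<in> U j" "x \<in> K - F - B" for j x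
    using ve[OF that(1,2)] that(3) by (auto simp: v'_def)
  have "section_on \<Omega> v'"
    unfolding section_on_def
  proof (intro ballI conjI)
    fix j assume j: "j \<in> I"
    have "continuous_on ((U j \<inter> (D - chart_set c Q)) \<union> (U j \<inter> (K - F - B))) (v' j)"
    proof (rule continuous_on_Un_local)
      have *: "U j \<inter> (D - chart_set c Q) \<union> U j \<inter> (K - F - B) = U j \<inter> \<Omega>" unfolding Om by blast
      show "closedin (top_of_set (U j \<inter> (D - chart_set c Q) \<union> U j \<inter> (K - F - B))) (U j \<inter> (D - chart_set c Q))"
        unfolding * closedin_closed
        by (rule exI[of _ D]) (use D FDB BD in \<open>auto simp: \<Omega>_def\<close>)
      show "closedin (top_of_set (U j \<inter> (D - chart_set c Q) \<union> U j \<inter> (K - F - B))) (U j \<inter> (K - F - B))"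
        unfolding * closedin_closed
        by (rule exI[of _ "K - B"]) (use K B BD in \<open>auto simp: \<Omega>_def closed_Diff\<close>)
      have "continuous_on (U j \<inter> (D - chart_set c Q)) (\<lambda>x. g i j x * e (snd c x))"
        by (intro continuous_intros continuous_on_subset[OF continuous_g[OF i(1) j]] continuous_on_subset[OF e'])
          (use i(2) in \<open>auto simp: D_def\<close>)
      then show "continuous_on (U j \<inter> (D - chart_set c Q)) (v' j)"
        by (rule continuous_on_eq) (auto simp: v'_def)
      have "continuous_on (U j \<inter> (K - F - B)) (v j)"
        by (rule continuous_on_subset[OF section_onD(1)[OF v j]]) auto
      then show "continuous_on (U j \<inter> (K - F - B)) (v' j)"
        by (rule continuous_on_eq) (use v'v j in auto)
    qed
    then show "continuous_on (U j \<inter> \<Omega>) (v' j)" unfolding Om by (simp add: Int_Un_distrib)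
  next
    fix j x assume j: "j \<in> I" and x: "x \<in> U j \<inter> \<Omega>"
    show "cmod (v' j x) = 1"
    proof (cases "x \<in> D")
      case True
      then have "x \<in> D - chart_set c Q" using x by (auto simp: \<Omega>_def)
      then show ?thesis using en norm_g[OF i(1) j, of x] x i(2) True 
        by (auto simp: v'_def norm_mult D_def)
    next
      case False
      then have "x \<in> K - F" using x BD by (auto simp: Om)
      then show ?thesis using False section_onD(2)[OF v j] x by (auto simp: v'_def)
    qed
  next
    fix j k x assume j: "j \<in> I" "k \<in> I" and x: "x \<in> U j \<inter> U k \<inter> \<Omega>"
    show "v' k x = g j k x * v' j x"
    proof (cases "x \<in> D")
      case True
      then have "x \<in> U i" using i(2) by (auto simp: D_def)
      then show ?thesis using cocycle[OF i(1) j, of x] x True by (simp add: v'_def)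
    next
      case False
      then have "x \<in> K - F" using x BD by (auto simp: Om)
      then show ?thesis using False section_onD(3)[OF v j] x by (auto simp: v'_def)
    qed
  qed
  then show thesis
    by (intro that[of v']) (use g_self i in \<open>auto simp: \<Omega>_def D_def B_def v'_def\<close>)
qed

text \<open>The discs of half the radius already cover. Every radius between r/2 and r remains
  available later, which leaves infinitely many choices when a boundary circle has to miss singular
  points.\<close>

lemma finite_disc_cover:
  obtains T where "finite T" "\<And>c a r i. (c,a,r,i) \<in> T \<Longrightarrow> c \<in> A \<and> r > 0 \<and> cball a r \<subseteq> chart_image c \<and>
    i \<in> I \<and> chart_set c (cball a r) \<subseteq> U i" "(\<Union>(c,a,r,i)\<in>T. chart_set c (cball a (r/2))) = UNIV"
proof -
  define P :: "(('a, complex) chart \<times> complex \<times> real \<times> 'i) set" where "P = {(c,a,r,i). c \<in> A \<and> r > 0 \<and> cball a r \<subseteq> chart_image c \<and>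
    i \<in> I \<and> chart_set c (cball a r) \<subseteq> U i}"
  define O' :: "('a, complex) chart \<times> complex \<times> real \<times> 'i \<Rightarrow> 'a set" where "O' = (\<lambda>(c,a,r,i::'i). chart_set c (ball a (r/2)))"
  have "\<exists>t\<in>P. x \<in> O' t" for x
  proof -
    obtain i where i: "i \<in> I" "x \<in> U i" using cover_U by blast
    obtain c r where "c \<in> A" "x \<in> fst c" "r > 0" "cball (snd c x) r \<subseteq> chart_image c"
      "chart_set c (cball (snd c x) r) \<subseteq> U i"
      by (rule chart_disc_at[OF open_U[OF i(1)] i(2) finite.emptyI]) blast
    then have "(c, snd c x, r, i) \<in> P" "x \<in> O' (c, snd c x, r, i)"
      using i by (auto simp: P_def O'_def chart_set_def)
    then show ?thesis by blast
  qed
  then have "UNIV \<subseteq> \<Union> (O' ` P)" by blast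
  moreover have "open (O' t)" if "t \<in> P" for t
    using that open_chart_set by (auto simp: P_def O'_def)
  ultimately obtain T where T: "T \<subseteq> P" "finite T" "UNIV \<subseteq> \<Union> (O' ` T)"
    using compactE_image[OF compact_surface, of P O'] by metis
  show thesis
  proof (rule that[OF T(2)])
    have "O' t \<subseteq> (case t of (c,a,r,i) \<Rightarrow> chart_set c (cball a (r/2)))" for t
      by (auto simp: O'_def chart_set_def split: prod.splits)
    then show "(\<Union>(c,a,r,i)\<in>T. chart_set c (cball a (r/2))) = UNIV" using T(3) by blast
  qed (use T(1) in \<open>auto simp: P_def\<close>)
qed

end

text \<open>The circle has dimension one less than the plane, so the obstruction to an extension can
  be confined to finitely many points off \<open>S\<close>.\<close>

lemma extend_circle_map_cofinite:
  fixes f :: "complex \<Rightarrow> complex"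
  assumes "compact S" "continuous_on S f" "\<And>x. x \<in> S \<Longrightarrow> cmod (f x) = 1"
  obtains K g where "finite K" "K \<inter> S = {}" "continuous_on (- K) g"
    "\<And>x. x \<notin> K \<Longrightarrow> cmod (g x) = 1" "\<And>x. x \<in> S \<Longrightarrow> g x = f x"
proof (rule extend_map_UNIV_to_sphere_cofinite[of 1 S f 0 UNIV])
  fix K g assume "finite K" "disjnt K S" "continuous_on (- K) g" "g \<in> (- K) \<rightarrow> sphere (0::complex) 1"
    "\<And>x. x \<in> S \<Longrightarrow> g x = f x"
  then show thesis by (intro that[of K g]) (auto simp: disjnt_def)
qed (use assms in \<open>auto dest: in_components_nonempty\<close>)

section \<open>The indices of a circle-valued map on the surface sum to zero\<close>

context compact_riemann_surface
begin

definition singular_map :: "('a \<Rightarrow> complex) \<Rightarrow> 'a set \<Rightarrow> ('a \<Rightarrow> int) \<Rightarrow> bool" where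
  "singular_map F K n \<longleftrightarrow> finite K \<and> continuous_on (- K) F \<and> (\<forall>x\<in>- K. cmod (F x) = 1) \<and>
     (\<forall>x\<in>K. point_index F x (n x))"

text \<open>Circle-valued maps are sections of the trivial bundle; surgery and disc covers are
  reused with a single trivialization and the cocycle 1.\<close>

interpretation triv: surface_cocycle A "{()}" "\<lambda>_. UNIV" "\<lambda>_ _ _. 1"
  by unfold_locales auto

lemma triv_section_on:
  "triv.section_on S (\<lambda>_. F) \<longleftrightarrow> continuous_on S F \<and> (\<forall>x\<in>S. cmod (F x) = 1)"
  by (auto simp: triv.section_on_def)

text \<open>The map is altered only inside one disc, whose boundary circle misses the singularities.
  Inside, the index sum depends on the boundary values alone, so the total is preserved, although
  singularities may appear and disappear. Prescribing 1 also on the part of \<open>S\<close> in the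
  disc keeps the progress made so far.\<close>

lemma singular_map_step:
  assumes F: "singular_map F K n" and S: "closed S" "S \<inter> K = {}" "\<And>x. x \<in> S \<Longrightarrow> F x = 1"
    and c: "c \<in> A" and r: "0 < r" "cball a r \<subseteq> chart_image c"
  shows "\<exists>F' K' n'. singular_map F' K' n' \<and> (\<Sum>x\<in>K'. n' x) = (\<Sum>x\<in>K. n x) \<and>
    (S \<union> chart_set c (cball a (r/2))) \<inter> K' = {} \<and> (\<forall>x\<in>S \<union> chart_set c (cball a (r/2)). F' x = 1)"
proof -
  have Fin: "finite K" and Fc: "continuous_on (- K) F" and F1: "\<And>x. x \<notin> K \<Longrightarrow> cmod (F x) = 1"
    and Fi: "\<And>x. x \<in> K \<Longrightarrow> point_index F x (n x)"
    using F by (auto simp: singular_map_def)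
  \<comment> \<open>The radius s avoids all singularities, so that \<open>F\<close> is defined on
    the circle, and still exceeds r/2, so that the half disc lies strictly inside.\<close>
  have "infinite ({r/2<..<r} - (\<lambda>y. dist a (snd c y)) ` K)"
    using r(1) Fin by (intro Diff_infinite_finite) (auto simp: infinite_Ioo)
  then obtain s where s: "s \<in> {r/2<..<r} - (\<lambda>y. dist a (snd c y)) ` K"
    by (metis finite.emptyI equals0I)
  have s0: "s > 0" "r/2 < s" "s < r" using s r by auto
  have sub: "cball a s \<subseteq> chart_image c" using s0 r(2) by (meson less_imp_le order_trans subset_cball)
  have sub2: "ball a s \<subseteq> chart_image c" using sub ball_subset_cball by blast
  define D where "D = chart_set c (cball a s)"
  define B where "B = chart_set c (ball a s)"
  have KS: "K \<inter> chart_set c (sphere a s) = {}" using s by (auto simp: chart_set_def)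
  have DB: "D - B = chart_set c (sphere a s)" by (auto simp: B_def D_def chart_set_def)
  have B: "open B" unfolding B_def by (rule open_chart_set[OF c open_ball])
  have inD: "chart_inv c y \<in> D" "snd c (chart_inv c y) = y" if "y \<in> cball a s" for y
    using that chart_inv_in_chart_set[OF c sub] sub c by (auto simp: D_def)
  have cinv: "continuous_on (cball a s) (chart_inv c)"
    by (rule continuous_on_subset[OF continuous_on_chart_inv[OF c] sub])
  define E1 where "E1 = cball a (r/2) \<union> (cball a s \<inter> chart_inv c -` S)"
  have cE1: "compact E1" unfolding E1_def
    using continuous_closed_preimage[OF cinv closed_cball S(1)] 
    by (intro compact_Un) (auto simp: compact_eq_bounded_closed intro: bounded_subset[OF bounded_cball])
  have E1s: "E1 \<subseteq> cball a s" using s0 by (auto simp: E1_def)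
  \<comment> \<open>The two prescriptions are compatible: the half disc does not reach the circle,
    and on the rest of \<open>E1\<close> the map \<open>F\<close> is 1 already.\<close>
  define e0 where "e0 = (\<lambda>y. if y \<in> sphere a s then F (chart_inv c y) else 1)"
  have sphK: "chart_inv c y \<notin> K" if "y \<in> sphere a s" for y
    using that KS chart_inv_in_chart_set[OF c order_trans[OF sphere_cball sub] that] by auto
  have e01: "e0 y = 1" if "y \<in> E1" for y
    using that S(3) s0 by (auto simp: e0_def E1_def)
  have e0c: "continuous_on (sphere a s \<union> E1) e0"
  proof (rule continuous_on_closed_Un)
    have "continuous_on (sphere a s) (\<lambda>y. F (chart_inv c y))"
      by (rule continuous_on_compose2[OF Fc continuous_on_subset[OF cinv]]) (use sphK in auto)
    then show "continuous_on (sphere a s) e0" by (rule continuous_on_eq) (simp add: e0_def)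
    have "continuous_on E1 (\<lambda>y. 1 :: complex)" by simp
    then show "continuous_on E1 e0" by (rule continuous_on_eq) (simp add: e01)
  qed (auto simp: cE1 compact_imp_closed)
  have e0n: "cmod (e0 y) = 1" if "y \<in> sphere a s \<union> E1" for y
    using F1 sphK by (auto simp: e0_def)
  have "compact (sphere a s \<union> E1)" using cE1 by auto
  then obtain K1 e where e: "finite K1" "K1 \<inter> (sphere a s \<union> E1) = {}" "continuous_on (- K1) e"
      "\<And>x. x \<notin> K1 \<Longrightarrow> cmod (e x) = 1" "\<And>x. x \<in> sphere a s \<union> E1 \<Longrightarrow> e x = e0 x"
    by (rule extend_circle_map_cofinite[OF _ e0c e0n]) blast+
  \<comment> \<open>\<open>K1\<close> avoids the circle, so its points in the open disc are all the
    new singularities; those outside are irrelevant after the surgery.\<close>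
  define Q where "Q = K1 \<inter> ball a s"
  have Q: "Q \<subseteq> ball a s" "finite Q" "Q \<inter> E1 = {}" using e(1,2) by (auto simp: Q_def)
  have QK: "cball a s - Q \<subseteq> - K1" using e(2) by (auto simp: Q_def)
  have ec: "continuous_on (cball a s - Q) e" by (rule continuous_on_subset[OF e(3) QK])
  have en: "cmod (e y) = 1" if "y \<in> cball a s - Q" for y
    using that QK e(4) by auto
  obtain v' where v': "triv.section_on ((UNIV \<union> chart_set c (cball a s)) - ((K - chart_set c (ball a s)) \<union> chart_set c Q)) v'"
    "\<And>j x. x \<notin> chart_set c (cball a s) \<Longrightarrow> v' j x = F x"
    "\<And>x. x \<in> chart_set c (cball a s) \<Longrightarrow> v' () x = e (snd c x)"
  proof (rule triv.surgery[OF c sub, of "()" UNIV K "\<lambda>_. F" Q e])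
    show "triv.section_on (UNIV - K) (\<lambda>_. F)" 
      using Fc F1 by (auto simp: triv_section_on Compl_eq_Diff_UNIV)
    show "e y = F (chart_inv c y)" if "y \<in> sphere a s" for y
      using e(5)[of y] that by (simp add: e0_def)
    show "Q \<subseteq> cball a s" "chart_set c Q \<inter> UNIV \<subseteq> chart_set c (ball a s)"
      using Q(1) by (auto simp: chart_set_def)
  qed (use KS ec en in auto)
  define F' where "F' = v' ()"
  define K' where "K' = (K - B) \<union> chart_set c Q"
  have "triv.section_on (- K') (\<lambda>_. F')"
  proof -
    have "v' = (\<lambda>_. F')" by (auto simp: F'_def)
    moreover have "(UNIV \<union> chart_set c (cball a s)) - ((K - chart_set c (ball a s)) \<union> chart_set c Q) = - K'"
      by (auto simp: K'_def B_def)
    ultimately show ?thesis using v'(1) by simp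
  qed
  then have F'c: "continuous_on (- K') F'" and F'1: "\<And>x. x \<notin> K' \<Longrightarrow> cmod (F' x) = 1"
    by (auto simp: triv_section_on)
  have F'F: "F' x = F x" if "x \<notin> B" for x
  proof (cases "x \<in> D")
    case False
    then show ?thesis using v'(2) by (simp add: F'_def D_def)
  next
    case True
    then have x: "x \<in> chart_set c (sphere a s)" using that DB by auto
    then have "e (snd c x) = F x" using e(5)[of "snd c x"] c by (auto simp: e0_def chart_set_def)
    then show ?thesis using v'(3)[of x] True by (simp add: F'_def D_def)
  qed
  have finK': "finite K'" using Fin finite_chart_set[OF c Q(2)] Q(1) sub2 by (auto simp: K'_def)
  have QB: "chart_set c Q \<subseteq> B" using Q by (auto simp: B_def chart_set_def)
  have i1: "point_index F' x (n x)" if x: "x \<in> K - B" for x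
  proof (rule point_index_cong[OF Fi, of x "- D"])
    show "open (- D)" using closed_chart_set[OF c compact_cball sub] by (simp add: D_def open_Compl)
    show "x \<in> - D" using x KS DB by blast
    show "F y = F' y" if "y \<in> - D - {x}" for y using that v'(2) by (simp add: F'_def D_def)
  qed (use x in auto)
  have i2: "\<exists>k. point_index F' x k" if x: "x \<in> chart_set c Q" for x
  proof (rule point_index_exists)
    show "open (- (K' - {x}))" using finK' by (intro open_Compl finite_imp_closed) auto
    have "- (K' - {x}) - {x} = - K'" using x by (auto simp: K'_def)
    then show "continuous_on (- (K' - {x}) - {x}) F'" using F'c by simp
    show "F' y \<noteq> 0" if "y \<in> - (K' - {x}) - {x}" for y
      using that F'1[of y] x by (auto simp: K'_def)
  qed auto
  \<comment> \<open>Outside the disc the map is unchanged near each singularity and keeps its index;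
    inside, an index is known only to exist, whence the choice.\<close>
  define n' where "n' = (\<lambda>x. if x \<in> K - B then n x else (SOME k. point_index F' x k))"
  have n': "point_index F' x (n' x)" if "x \<in> K'" for x
    using that i1 someI_ex[OF i2] QB by (auto simp: n'_def K'_def)
  have sum: "(\<Sum>x\<in>K'. n' x) = (\<Sum>x\<in>K. n x)"
  proof -
    have "(\<Sum>x\<in>K'. n' x) = (\<Sum>x\<in>K - B. n' x) + (\<Sum>x\<in>chart_set c Q. n' x)"
      unfolding K'_def by (rule sum.union_disjoint) (use finK' QB in \<open>auto simp: K'_def\<close>)
    also have "(\<Sum>x\<in>K - B. n' x) = (\<Sum>x\<in>K - B. n x)" by (rule sum.cong) (auto simp: n'_def)
    also have "(\<Sum>x\<in>chart_set c Q. n' x) = (\<Sum>y\<in>Q. n' (chart_inv c y))"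
      using Q(1) sub2 inj_on_inverseI[of Q "snd c" "chart_inv c"] c
      by (subst chart_set_eq_image[OF c]) (auto simp: sum.reindex subset_iff)
    \<comment> \<open>The individual indices inside the disc are unrelated; only their sums agree,
      by the common boundary values.\<close>
    also have "\<dots> = (\<Sum>y\<in>snd c ` (K \<inter> B). n (chart_inv c y))"
    proof (rule sum_local_index_eq[of _ a s _ "F' \<circ> chart_inv c" _ "F \<circ> chart_inv c"])
      show "finite Q" "Q \<subseteq> ball a s" "finite (snd c ` (K \<inter> B))" "snd c ` (K \<inter> B) \<subseteq> ball a s" "s > 0"
        using Q Fin s0 by (auto simp: B_def chart_set_def)
      have *: "(F' \<circ> chart_inv c) y = e y" if "y \<in> cball a s - Q" for y
        using that v'(3)[of "chart_inv c y"] inD[of y] by (simp add: F'_def D_def)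
      show "continuous_on (cball a s - Q) (F' \<circ> chart_inv c)"
        using ec by (rule continuous_on_eq) (use * in auto)
      show "(F' \<circ> chart_inv c) y \<noteq> 0" if "y \<in> cball a s - Q" for y
        using *[OF that] en[OF that] by auto
      show "local_index (F' \<circ> chart_inv c) y (n' (chart_inv c y))" if "y \<in> Q" for y
      proof -
        have y: "y \<in> ball a s" "y \<in> chart_image c" using that Q sub2 by auto
        have "chart_inv c y \<in> K'" 
          using that c y by (auto simp: K'_def chart_set_def chart_inv_in)
        then show ?thesis using point_index_chart[OF n' c, of "chart_inv c y"] c y chart_inv_in[OF c y(2)] by simp
      qed
      have notK: "chart_inv c y \<notin> K" if y: "y \<in> cball a s - snd c ` (K \<inter> B)" for y
      proof
        assume k: "chart_inv c y \<in> K"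
        have "chart_inv c y \<in> D" "snd c (chart_inv c y) = y" using inD[of y] y by auto
        moreover have "chart_inv c y \<in> B" using calculation k KS DB by blast
        ultimately show False using y k by (metis DiffD2 IntI imageI)
      qed
      show "continuous_on (cball a s - snd c ` (K \<inter> B)) (F \<circ> chart_inv c)"
        unfolding comp_def
        by (rule continuous_on_compose2[OF Fc continuous_on_subset[OF cinv]]) (use notK in auto)
      show "(F \<circ> chart_inv c) y \<noteq> 0" if "y \<in> cball a s - snd c ` (K \<inter> B)" for y
        using notK[OF that] F1[of "chart_inv c y"] by auto
      show "local_index (F \<circ> chart_inv c) y (n (chart_inv c y))" if y: "y \<in> snd c ` (K \<inter> B)" for y
      proof -
        obtain x where "x \<in> K" "x \<in> fst c" "y = snd c x" using y by (auto simp: B_def chart_set_def)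
        then show ?thesis using point_index_chart[OF Fi c, of x] c by simp
      qed
      show "(F' \<circ> chart_inv c) y = (F \<circ> chart_inv c) y" if "y \<in> sphere a s" for y
      proof -
        have "chart_inv c y \<notin> B" using that inD(2)[of y] by (auto simp: B_def chart_set_def)
        then show ?thesis using F'F by simp
      qed
    qed
    also have "\<dots> = (\<Sum>x\<in>K \<inter> B. n x)"
    proof -
      have "inj_on (snd c) (K \<inter> B)"
        by (rule inj_on_subset[OF inj_on_chart[OF c]]) (auto simp: B_def chart_set_def)
      moreover have "chart_inv c (snd c x) = x" if "x \<in> K \<inter> B" for x
        using that c by (simp add: B_def chart_set_def)
      ultimately show ?thesis by (simp add: sum.reindex)
    qed
    also have "(\<Sum>x\<in>K - B. n x) + (\<Sum>x\<in>K \<inter> B. n x) = (\<Sum>x\<in>K. n x)"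
      using sum.Int_Diff[OF Fin, of n B] by simp
    finally show ?thesis .
  qed
  have D1: "x \<notin> K' \<and> F' x = 1" if x: "x \<in> D" "snd c x \<in> E1" for x
  proof
    have xc: "x \<in> fst c" using x by (auto simp: D_def chart_set_def)
    have "F' x = e (snd c x)" using x v'(3) by (simp add: F'_def D_def)
    then show "F' x = 1" using e(5)[of "snd c x"] e01[OF x(2)] x by simp
    have "x \<notin> chart_set c Q" using x Q(3) by (auto simp: chart_set_def)
    moreover have "x \<notin> K - B" using x KS DB by blast
    ultimately show "x \<notin> K'" by (simp add: K'_def)
  qed
  have S1: "x \<notin> K' \<and> F' x = 1" if x: "x \<in> S" for x
  proof (cases "x \<in> D")
    case True
    then have "snd c x \<in> E1" using x c by (auto simp: E1_def D_def chart_set_def)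
    then show ?thesis using D1 True by blast
  next
    case False
    then have "x \<notin> B" by (auto simp: B_def D_def chart_set_def)
    then show ?thesis using F'F S x QB by (auto simp: K'_def)
  qed
  have C1: "x \<notin> K' \<and> F' x = 1" if "x \<in> chart_set c (cball a (r/2))" for x
    by (rule D1) (use that s0 in \<open>auto simp: D_def chart_set_def E1_def\<close>)
  have "singular_map F' K' n'" unfolding singular_map_def
    using finK' F'c F'1 n' by auto
  then show ?thesis using sum S1 C1 by (intro exI[of _ F'] exI[of _ K'] exI[of _ n']) auto
qed

text \<open>After all half discs of a cover have been treated, the singular set is disjoint from the
  whole surface, and the preserved sum is an empty one.\<close>

theorem sum_point_index_eq_0:
  assumes "singular_map F K n"
  shows "(\<Sum>x\<in>K. n x) = 0"
proof -
  obtain T where T: "finite T" "\<And>c a r i. (c,a,r,i) \<in> T \<Longrightarrow> c \<in> A \<and> r > 0 \<and> cball a r \<subseteq> chart_image c \<and>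
    i \<in> {()} \<and> chart_set c (cball a r) \<subseteq> UNIV" "(\<Union>(c,a,r,i)\<in>T. chart_set c (cball a (r/2))) = UNIV"
    using triv.finite_disc_cover by metis
  define C where "C = (\<lambda>(c::('a, complex) chart,a,r::real,i::unit). chart_set c (cball a (r/2)))"
  have clC: "closed (C t)" if "t \<in> T" for t
  proof -
    obtain c a r i where t: "t = (c,a,r,i)" by (metis prod.exhaust)
    have "cball a (r/2) \<subseteq> cball a r" using T(2)[of c a r i] that t by auto
    then have "cball a (r/2) \<subseteq> chart_image c" using T(2)[of c a r i] that t by blast
    then show ?thesis using closed_chart_set[of c "cball a (r/2)"] T(2)[of c a r i] that t by (auto simp: C_def)
  qed
  have "\<exists>F' K' n'. singular_map F' K' n' \<and> (\<Sum>x\<in>K'. n' x) = (\<Sum>x\<in>K. n x) \<and>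
    (\<Union>(C ` T')) \<inter> K' = {} \<and> (\<forall>x\<in>\<Union>(C ` T'). F' x = 1)" if "T' \<subseteq> T" for T'
    using finite_subset[OF that T(1)] that
  proof (induction T' rule: finite_induct)
    case empty
    then show ?case using assms by (intro exI[of _ F] exI[of _ K] exI[of _ n]) auto
  next
    case (insert t T')
    obtain F1 K1 n1 where 1: "singular_map F1 K1 n1" "(\<Sum>x\<in>K1. n1 x) = (\<Sum>x\<in>K. n x)"
      "(\<Union>(C ` T')) \<inter> K1 = {}" "\<forall>x\<in>\<Union>(C ` T'). F1 x = 1"
      using insert.IH insert.prems by auto
    obtain c a r i where t: "t = (c,a,r,i)" by (metis prod.exhaust)
    have cl: "closed (\<Union>(C ` T'))" using insert clC by (intro closed_UN) auto
    have cr: "c \<in> A" "0 < r" "cball a r \<subseteq> chart_image c"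
      using T(2)[of c a r i] t insert.prems by auto
    have "\<exists>F' K' n'. singular_map F' K' n' \<and> (\<Sum>x\<in>K'. n' x) = (\<Sum>x\<in>K1. n1 x) \<and>
      (\<Union>(C ` T') \<union> chart_set c (cball a (r/2))) \<inter> K' = {} \<and>
      (\<forall>x\<in>\<Union>(C ` T') \<union> chart_set c (cball a (r/2)). F' x = 1)"
      by (rule singular_map_step[OF 1(1) cl 1(3) _ cr]) (rule 1(4)[rule_format])
    then obtain F' K' n' where 2: "singular_map F' K' n'" "(\<Sum>x\<in>K'. n' x) = (\<Sum>x\<in>K1. n1 x)"
      "(\<Union>(C ` T') \<union> chart_set c (cball a (r/2))) \<inter> K' = {}"
      "\<forall>x\<in>\<Union>(C ` T') \<union> chart_set c (cball a (r/2)). F' x = 1"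
      by blast
    have "\<Union>(C ` insert t T') = \<Union>(C ` T') \<union> chart_set c (cball a (r/2))" by (auto simp: C_def t)
    then show ?case using 1(2) 2 by metis
  qed
  from this[OF order_refl] obtain F' K' n' where "singular_map F' K' n'" "(\<Sum>x\<in>K'. n' x) = (\<Sum>x\<in>K. n x)"
    "(\<Union>(C ` T)) \<inter> K' = {}" by blast
  moreover have "\<Union>(C ` T) = UNIV" using T(3) by (simp add: C_def)
  ultimately show ?thesis by auto
qed

end

section \<open>Sections with one singularity, and triviality of torsion cocycles\<close>

context surface_cocycle
begin

text \<open>The section is continued over one disc of a finite cover at a time. Each continuation
  extends a circle-valued function from a compact subset of the plane, and thus costs finitely many
  points.\<close>

lemma section_off_finite_exists: "\<exists>F v. finite F \<and> section_on (- F) v"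
proof -
  obtain T where T: "finite T" "\<And>c a r i. (c,a,r,i) \<in> T \<Longrightarrow> c \<in> A \<and> r > 0 \<and> cball a r \<subseteq> chart_image c \<and>
    i \<in> I \<and> chart_set c (cball a r) \<subseteq> U i" "(\<Union>(c,a,r,i)\<in>T. chart_set c (cball a (r/2))) = UNIV"
    using finite_disc_cover by metis
  define C where "C = (\<lambda>(c::('a, complex) chart,a,r::real,i::'i). chart_set c (cball a (r/2)))"
  have clC: "closed (C t)" if "t \<in> T" for t
  proof -
    obtain c a r i where t: "t = (c,a,r,i)" by (metis prod.exhaust)
    have "cball a (r/2) \<subseteq> cball a r" using T(2)[of c a r i] that t by auto
    then have "cball a (r/2) \<subseteq> chart_image c" using T(2)[of c a r i] that t by blast
    then show ?thesis using closed_chart_set[of c "cball a (r/2)"] T(2)[of c a r i] that t by (auto simp: C_def)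
  qed
  have "\<exists>F v. finite F \<and> section_on (\<Union>(C ` T') - F) v" if "T' \<subseteq> T" for T'
    using finite_subset[OF that T(1)] that
  proof (induction T' rule: finite_induct)
    case empty
    have "section_on ({} - {}) v" for v by (simp add: section_on_def)
    then show ?case by auto
  next
    case (insert t T')
    define K where "K = \<Union>(C ` T')"
    obtain F v where F: "finite F" "section_on (K - F) v"
      using insert.IH insert.prems by (auto simp: K_def)
    obtain c a r i where t: "t = (c,a,r,i)" by (metis prod.exhaust)
    have cl: "closed K" unfolding K_def using insert clC by (intro closed_UN) auto
    have cr: "c \<in> A" "0 < r" "cball a r \<subseteq> chart_image c" "i \<in> I" "chart_set c (cball a r) \<subseteq> U i"
      using T(2)[of c a r i] t insert.prems by auto
    have "infinite ({r/2<..<r} - (\<lambda>y. dist a (snd c y)) ` F)"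
      using cr(2) F(1) by (intro Diff_infinite_finite) (auto simp: infinite_Ioo)
    then obtain s where s: "s \<in> {r/2<..<r} - (\<lambda>y. dist a (snd c y)) ` F"
      by (metis finite.emptyI equals0I)
    have s0: "s > 0" "r/2 < s" "s < r" using s cr by auto
    have sub: "cball a s \<subseteq> chart_image c" using s0 cr(3) by (meson less_imp_le order_trans subset_cball)
    have FS: "F \<inter> chart_set c (sphere a s) = {}" using s by (auto simp: chart_set_def)
    have Ui: "chart_set c (cball a s) \<subseteq> U i" using cr(5) s0 by (force simp: chart_set_def)
    have cinv: "continuous_on (sphere a s) (chart_inv c)"
      by (rule continuous_on_subset[OF continuous_on_chart_inv[OF cr(1)] order_trans[OF sphere_cball sub]])
    \<comment> \<open>Only this part of the circle carries prescribed values; over the rest of it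
      nothing has to be matched yet.\<close>
    define S where "S = sphere a s \<inter> chart_inv c -` K"
    have "compact S" unfolding S_def
      using continuous_closed_preimage[OF cinv closed_sphere cl]
      by (auto simp: compact_eq_bounded_closed intro: bounded_subset[OF bounded_sphere])
    have inv: "chart_inv c y \<in> U i \<inter> (K - F)" if "y \<in> S" for y
    proof -
      have "chart_inv c y \<in> chart_set c (sphere a s)"
        using that by (intro chart_inv_in_chart_set[OF cr(1) order_trans[OF sphere_cball sub]]) (auto simp: S_def)
      moreover have "chart_set c (sphere a s) \<subseteq> U i" using Ui by (force simp: chart_set_def)
      ultimately show ?thesis using that FS by (auto simp: S_def)
    qed
    have e0c: "continuous_on S (\<lambda>y. v i (chart_inv c y))"
    proof (rule continuous_on_compose2[OF section_onD(1)[OF F(2) cr(4)]])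
      show "continuous_on S (chart_inv c)" by (rule continuous_on_subset[OF cinv]) (auto simp: S_def)
    qed (use inv in auto)
    have e0n: "cmod (v i (chart_inv c y)) = 1" if "y \<in> S" for y
      using section_onD(2)[OF F(2) cr(4)] inv[OF that] by auto
    obtain K1 e where e: "finite K1" "K1 \<inter> S = {}" "continuous_on (- K1) e"
      "\<And>x. x \<notin> K1 \<Longrightarrow> cmod (e x) = 1" "\<And>x. x \<in> S \<Longrightarrow> e x = v i (chart_inv c x)"
      by (rule extend_circle_map_cofinite[OF \<open>compact S\<close> e0c e0n]) blast+
    \<comment> \<open>The closed disc is taken, since new singularities may sit on the boundary
      circle where it leaves \<open>K\<close>.\<close>
    define Q where "Q = K1 \<inter> cball a s"
    obtain v' where v': "section_on ((K \<union> chart_set c (cball a s)) - ((F - chart_set c (ball a s)) \<union> chart_set c Q)) v'"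
    proof (rule surgery[OF cr(1) sub cr(4) Ui cl FS F(2), of Q e])
      show "Q \<subseteq> cball a s" by (simp add: Q_def)
      show "chart_set c Q \<inter> K \<subseteq> chart_set c (ball a s)"
      proof
        fix x assume x: "x \<in> chart_set c Q \<inter> K"
        then have "snd c x \<notin> S" "x \<in> fst c" "snd c x \<in> cball a s" using e(2) by (auto simp: Q_def chart_set_def)
        then show "x \<in> chart_set c (ball a s)" using x cr(1) by (auto simp: S_def chart_set_def)
      qed
      show "continuous_on (cball a s - Q) e" by (rule continuous_on_subset[OF e(3)]) (auto simp: Q_def)
      show "cmod (e y) = 1" if "y \<in> cball a s - Q" for y using e(4)[of y] that by (auto simp: Q_def)
      show "e y = v i (chart_inv c y)" if "y \<in> sphere a s" "chart_inv c y \<in> K" for y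
        using e(5)[of y] that by (auto simp: S_def)
    qed
    have "finite Q" "Q \<subseteq> chart_image c" using e(1) sub by (auto simp: Q_def)
    then have "finite ((F - chart_set c (ball a s)) \<union> chart_set c Q)"
      using F(1) finite_chart_set[OF cr(1)] by blast
    moreover have "\<Union>(C ` insert t T') \<subseteq> K \<union> chart_set c (cball a s)"
      using s0 by (auto simp: K_def C_def t chart_set_def)
    moreover from this have "section_on (\<Union>(C ` insert t T') - ((F - chart_set c (ball a s)) \<union> chart_set c Q)) v'"
      by (intro section_on_mono[OF v'] Diff_mono) auto
    ultimately show ?case by (intro exI conjI)
  qed
  from this[OF order_refl] show ?thesis using T(3) by (simp add: C_def Compl_eq_Diff_UNIV)
qed

text \<open>Composing the boundary values with a retraction of the punctured plane onto the circle
  extends them over the disc minus the one point \<open>y\<close>, at which all singularities of the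
  disc are thereby merged.\<close>

lemma section_shrink_singularities:
  assumes c: "c \<in> A" and r: "r > 0" and sub: "cball a r \<subseteq> chart_image c"
    and i: "i \<in> I" "chart_set c (cball a r) \<subseteq> U i"
    and F: "F \<inter> chart_set c (sphere a r) = {}" "section_on (- F) v" 
    and y: "y \<in> chart_set c (ball a r)"
  shows "\<exists>v'. section_on (- (F - chart_set c (ball a r) \<union> {y})) v'"
proof -
  have yb: "snd c y \<in> ball a r" "y \<in> fst c" using y by (auto simp: chart_set_def)
  have "sphere a r retract_of (- {snd c y})"
    using frontier_retract_of_punctured_universe[of "cball a r" "snd c y"] yb r by simp
  then obtain \<rho> where \<rho>: "continuous_on (- {snd c y}) \<rho>" "\<rho> ` (- {snd c y}) \<subseteq> sphere a r"
     "\<And>x. x \<in> sphere a r \<Longrightarrow> \<rho> x = x"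
    by (auto simp: retract_of_def retraction_def image_subset_iff_funcset)
  have inv: "chart_inv c z \<in> U i \<inter> - F" if "z \<in> sphere a r" for z
  proof -
    have "chart_inv c z \<in> chart_set c (sphere a r)"
      using that by (intro chart_inv_in_chart_set[OF c order_trans[OF sphere_cball sub]])
    moreover have "chart_set c (sphere a r) \<subseteq> U i" using i(2) by (force simp: chart_set_def)
    ultimately show ?thesis using F by auto
  qed
  have cinv: "continuous_on (sphere a r) (chart_inv c)"
    by (rule continuous_on_subset[OF continuous_on_chart_inv[OF c] order_trans[OF sphere_cball sub]])
  have vc: "continuous_on (sphere a r) (\<lambda>z. v i (chart_inv c z))"
    by (rule continuous_on_compose2[OF section_onD(1)[OF F(2) i(1)] cinv]) (use inv in auto)
  obtain v' where "section_on ((UNIV \<union> chart_set c (cball a r)) - ((F - chart_set c (ball a r)) \<union> chart_set c {snd c y})) v'"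
  proof (rule surgery[OF c sub i closed_UNIV F(1), of v "{snd c y}" "\<lambda>z. v i (chart_inv c (\<rho> z))"])
    show "section_on (UNIV - F) v" using F(2) by (simp add: Compl_eq_Diff_UNIV)
    show "{snd c y} \<subseteq> cball a r" "chart_set c {snd c y} \<inter> UNIV \<subseteq> chart_set c (ball a r)"
      using yb by (auto simp: chart_set_def)
    show "continuous_on (cball a r - {snd c y}) (\<lambda>z. v i (chart_inv c (\<rho> z)))"
      by (rule continuous_on_compose2[OF vc continuous_on_subset[OF \<rho>(1)]]) (use \<rho>(2) in auto)
    show "cmod (v i (chart_inv c (\<rho> z))) = 1" if "z \<in> cball a r - {snd c y}" for z
      using section_onD(2)[OF F(2) i(1)] inv[of "\<rho> z"] \<rho>(2) that by blast
  qed (use \<rho>(3) in auto)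
  moreover have "chart_set c {snd c y} = {y}"
    using yb inj_on_chart[OF c] by (auto simp: chart_set_def inj_on_def)
  ultimately show ?thesis by (simp add: Compl_eq_Diff_UNIV) blast
qed

text \<open>Take a section with as few singularities as possible. If there were two, one of them
  could be dragged through the connected surface onto the other, which lowers the number.\<close>

lemma section_off_point_exists: "\<exists>p v. section_on (- {p}) v"
proof -
  define P where "P = (\<lambda>n. \<exists>F v. finite F \<and> card F = n \<and> section_on (- F) v)"
  have "\<exists>n. P n" using section_off_finite_exists unfolding P_def by blast
  then have P: "P (LEAST n. P n)" by (metis LeastI)
  then obtain F v where F: "finite F" "card F = (LEAST n. P n)" "section_on (- F) v"
    unfolding P_def by blast
  have least: "card F \<le> card G" if "finite G" "section_on (- G) w" for G w
    unfolding F(2) by (rule Least_le) (use that in \<open>auto simp: P_def\<close>)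
  have "card F \<le> 1"
  proof (rule ccontr)
    assume "\<not> card F \<le> 1"
    then obtain x0 y0 where xy: "x0 \<in> F" "y0 \<in> F" "x0 \<noteq> y0"
      using F(1) by (metis card_le_Suc0_iff_eq One_nat_def)
    define F0 where "F0 = F - {x0}"
    have F0: "finite F0" using F by (simp add: F0_def)
    \<comment> \<open>The positions to which \<open>x0\<close> can be moved while the others stay in
      \<open>F0\<close>. Inclusion replaces equality because a disc may swallow further points of
      \<open>F0\<close> on the way.\<close>
    define R where "R = {y. \<exists>G w. G \<subseteq> insert y F0 \<and> section_on (- G) w}"
    \<comment> \<open>Each point has a neighbourhood that lies in \<open>R\<close> as soon as it
      meets \<open>R\<close>, so \<open>R\<close> is both open and closed.\<close>
    have nb: "\<exists>B. open B \<and> x \<in> B \<and> (\<forall>y\<in>B \<inter> R. B \<subseteq> R)" for x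
    proof -
      obtain i where i: "i \<in> I" "x \<in> U i" using cover_U by blast
      obtain c r where c: "c \<in> A" "x \<in> fst c" "r > 0" "cball (snd c x) r \<subseteq> chart_image c"
        "chart_set c (cball (snd c x) r) \<subseteq> U i" "F0 \<inter> chart_set c (sphere (snd c x) r) = {}"
        by (rule chart_disc_at[OF open_U[OF i(1)] i(2) F0]) blast
      define B where "B = chart_set c (ball (snd c x) r)"
      have "open B" unfolding B_def by (rule open_chart_set[OF c(1) open_ball])
      moreover have "x \<in> B" using c by (auto simp: B_def chart_set_def)
      moreover have "z \<in> R" if y: "y \<in> B" "y \<in> R" and z: "z \<in> B" for y z
      proof -
        obtain G w where G: "G \<subseteq> insert y F0" "section_on (- G) w" using y by (auto simp: R_def)
        have "y \<notin> chart_set c (sphere (snd c x) r)" using y by (auto simp: B_def chart_set_def)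
        then have GS: "G \<inter> chart_set c (sphere (snd c x) r) = {}" using G(1) c(6) by auto
        obtain w' where "section_on (- (G - B \<union> {z})) w'"
          using section_shrink_singularities[OF c(1,3,4) i(1) c(5) GS G(2)] z by (auto simp: B_def)
        moreover have "G - B \<union> {z} \<subseteq> insert z F0" using G(1) y(1) by auto
        ultimately show ?thesis unfolding R_def by blast
      qed
      ultimately show ?thesis by blast
    qed
    have "open R"
    proof (subst open_subopen, intro ballI)
      fix x assume "x \<in> R"
      then show "\<exists>T. open T \<and> x \<in> T \<and> T \<subseteq> R" using nb[of x] by blast
    qed
    moreover have "open (- R)"
    proof (subst open_subopen, intro ballI)
      fix x assume "x \<in> - R"
      then show "\<exists>T. open T \<and> x \<in> T \<and> T \<subseteq> - R" using nb[of x] by blast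
    qed
    moreover have "x0 \<in> R" using F(3) xy(1) by (auto simp: R_def F0_def intro!: exI[of _ F])
    ultimately have "R = UNIV"
      using connectedD[OF connected_surface, of R "- R"] by blast
    then have "y0 \<in> R" by blast
    then obtain G w where G: "G \<subseteq> insert y0 F0" "section_on (- G) w" by (auto simp: R_def)
    \<comment> \<open>Having arrived at \<open>y0\<close>, the moved point coincides with a
      remaining singularity, so one singularity less is left.\<close>
    have "insert y0 F0 = F0" using xy by (auto simp: F0_def)
    then have "card G < card F"
      using G(1) F(1) xy(1) psubset_card_mono[of F G] unfolding F0_def by blast
    moreover have "finite G" using G(1) F0 finite_subset by auto
    ultimately show False using least[OF _ G(2)] by simp
  qed
  then have "F = {} \<or> (\<exists>p. F = {p})" using F(1) by (metis card_le_Suc0_iff_eq One_nat_def is_singletonE is_singletonI' )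
  then show ?thesis
  proof
    assume "F = {}"
    then show ?thesis using section_on_mono[OF F(3)] by blast
  qed (use F(3) in blast)
qed

text \<open>The family \<open>f\<close> is a unit section of the m-th power of the bundle. In v^m /
  f the transition factors cancel, so this is a map on the surface off \<open>p\<close>.\<close>

theorem torsion_cocycle_trivial:
  assumes m: "m \<noteq> 0"
    and f: "\<And>i. i \<in> I \<Longrightarrow> continuous_on (U i) (f i)" "\<And>i x. i \<in> I \<Longrightarrow> x \<in> U i \<Longrightarrow> cmod (f i x) = 1"
      "\<And>i j x. i \<in> I \<Longrightarrow> j \<in> I \<Longrightarrow> x \<in> U i \<Longrightarrow> x \<in> U j \<Longrightarrow> f j x = g i j x powi m * f i x"
  shows "\<exists>v. section_on UNIV v"
proof -
  obtain p v where v: "section_on (- {p}) v" using section_off_point_exists by blast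
  define F where "F = (\<lambda>x. let i = (SOME i. i \<in> I \<and> x \<in> U i) in v i x powi m / f i x)"
  have F: "F x = v i x powi m / f i x" if "i \<in> I" "x \<in> U i" "x \<noteq> p" for i x
  proof -
    define j where "j = (SOME i. i \<in> I \<and> x \<in> U i)"
    have j: "j \<in> I" "x \<in> U j" using someI[of "\<lambda>i. i \<in> I \<and> x \<in> U i" i] that by (auto simp: j_def)
    have "g i j x \<noteq> 0" using norm_g[OF that(1) j(1), of x] that j by auto
    moreover have "v j x = g i j x * v i x" using section_onD(3)[OF v that(1) j(1)] that j by blast
    moreover have "f j x = g i j x powi m * f i x" by (rule f(3)[OF that(1) j(1) that(2) j(2)])
    ultimately show ?thesis by (simp add: F_def j_def[symmetric] power_int_mult_distrib)
  qed
  have "continuous_on (\<Union>i\<in>I. U i \<inter> - {p}) F"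
  proof (rule continuous_on_open_UN)
    fix i assume i: "i \<in> I"
    show "open (U i \<inter> - {p})" using open_U[OF i] by auto
    have "continuous_on (U i \<inter> - {p}) (\<lambda>x. v i x powi m / f i x)"
      by (intro continuous_intros section_onD(1)[OF v i] continuous_on_subset[OF f(1)[OF i]])
       (use section_onD(2)[OF v i] f(2)[OF i] in force)+
    then show "continuous_on (U i \<inter> - {p}) F" by (rule continuous_on_eq) (use F[OF i] in auto)
  qed
  moreover have "(\<Union>i\<in>I. U i \<inter> - {p}) = - {p}" using cover_U by blast
  ultimately have Fc: "continuous_on (- {p}) F" by simp
  have F1: "cmod (F x) = 1" if "x \<noteq> p" for x
  proof -
    obtain i where i: "i \<in> I" "x \<in> U i" using cover_U by blast
    show ?thesis using F[OF i that] section_onD(2)[OF v i] f(2)[OF i] that by (simp add: norm_divide norm_power_int)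
  qed
  obtain n where n: "point_index F p n"
    using point_index_exists[of UNIV p F] Fc F1 by (force simp: Compl_eq_Diff_UNIV)
  have "singular_map F {p} (\<lambda>_. n)" using Fc F1 n by (auto simp: singular_map_def)
  then have n0: "n = 0" using sum_point_index_eq_0 by force
  obtain i where i: "i \<in> I" "p \<in> U i" using cover_U by blast
  obtain c r where c: "c \<in> A" "p \<in> fst c" "r > 0" "cball (snd c p) r \<subseteq> chart_image c"
    "chart_set c (cball (snd c p) r) \<subseteq> U i"
    by (rule chart_disc_at[OF open_U[OF i(1)] i(2) finite.emptyI]) blast
  define a where "a = snd c p"
  have inU: "chart_inv c z \<in> U i" "z \<in> chart_image c" if "z \<in> cball a r" for z
    using that c chart_inv_in_chart_set[OF c(1,4)] unfolding a_def by auto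
  have notp: "chart_inv c z \<noteq> p" if "z \<in> cball a r" "z \<noteq> a" for z
    using that inU[of z] c(1) by (auto simp: a_def)
  have cinv: "continuous_on (cball a r) (chart_inv c)"
    by (rule continuous_on_subset[OF continuous_on_chart_inv[OF c(1)] c(4)[folded a_def]])
  have "chart_inv c z \<in> U i \<inter> - {p}" if "z \<in> ball a r - {a}" for z
    using inU[of z] notp[of z] that by auto
  then have "chart_inv c ` (ball a r - {a}) \<subseteq> U i \<inter> - {p}" by blast
  moreover have "ball a r - {a} \<subseteq> cball a r" by auto
  ultimately have "continuous_on (ball a r - {a}) (v i \<circ> chart_inv c)" unfolding comp_def
    by (intro continuous_on_compose2[OF section_onD(1)[OF v i(1)] continuous_on_subset[OF cinv]])
  moreover have v1: "cmod ((v i \<circ> chart_inv c) z) = 1" if "z \<in> cball a r - {a}" for z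
    using section_onD(2)[OF v i(1), of "chart_inv c z"] inU[of z] notp[of z] that by auto
  ultimately obtain k where k: "local_index (v i \<circ> chart_inv c) a k"
    using local_index_exists[OF c(3), of a "v i \<circ> chart_inv c"]
    by (metis Diff_iff ball_subset_cball norm_zero subsetD zero_neq_one)
  have "continuous_on (ball a r) (f i \<circ> chart_inv c)" unfolding comp_def
    by (rule continuous_on_compose2[OF f(1)[OF i(1)] continuous_on_subset[OF cinv]]) (use inU in auto)
  then have f0: "local_index (f i \<circ> chart_inv c) a 0"
  proof (rule local_index_nonzero[OF c(3)])
    show "(f i \<circ> chart_inv c) z \<noteq> 0" if "z \<in> ball a r" for z
      using f(2)[OF i(1), of "chart_inv c z"] inU[of z] that by auto
  qed
  \<comment> \<open>The index of \<open>F\<close> at \<open>p\<close> is computed twice: it is m k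
    because \<open>f i\<close> has no zero at \<open>p\<close>, and 0 because \<open>p\<close> is
    the only singularity of \<open>F\<close>.\<close>
  have "local_index (\<lambda>z. (v i \<circ> chart_inv c) z powi m * (f i \<circ> chart_inv c) z powi (-1)) a (m * k + (-1) * 0)"
    by (intro local_index_mult local_index_powi k f0)
  then have "local_index (F \<circ> chart_inv c) a (m * k + (-1) * 0)"
  proof (rule local_index_cong[OF _ c(3)])
    fix z assume z: "z \<in> ball a r - {a}"
    then show "(v i \<circ> chart_inv c) z powi m * (f i \<circ> chart_inv c) z powi (-1) = (F \<circ> chart_inv c) z"
      using F[OF i(1), of "chart_inv c z"] inU[of z] notp[of z] by (simp add: power_int_minus divide_inverse)
  qed
  moreover have "local_index (F \<circ> chart_inv c) a 0"
    using point_index_chart[OF n c(1,2)] n0 by (simp add: a_def)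
  ultimately have "m * k + (-1) * 0 = 0" by (rule local_index_unique)
  then have "k = 0" using m by simp
  then have "local_index (v i \<circ> chart_inv c) a 0" using k by simp
  then obtain e d where e: "0 < d" "d < r" "continuous_on (cball a d) e"
    "\<And>z. z \<in> cball a d \<Longrightarrow> e z \<noteq> 0" "\<And>z. z \<in> sphere a d \<Longrightarrow> e z = (v i \<circ> chart_inv c) z"
    by (rule index_zero_remove[OF _ c(3)]) blast
  have dr: "cball a d \<subseteq> cball a r" using e by auto
  \<comment> \<open>The filling \<open>e\<close> is merely nonzero and has to be normalized; on the
    circle this changes nothing, as \<open>v i\<close> has modulus 1 there.\<close>
  have ce: "continuous_on (cball a d - {}) (\<lambda>z. e z / of_real (cmod (e z)))"
    by (intro continuous_intros continuous_on_subset[OF e(3)]) (use e(4) in auto)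
  obtain w where "section_on ((UNIV \<union> chart_set c (cball a d)) - (({p} - chart_set c (ball a d)) \<union> chart_set c {})) w"
  proof (rule surgery[OF c(1) _ i(1) _ closed_UNIV _ _ _ _ ce, of "{p}" v])
    show "cball a d \<subseteq> chart_image c" using dr c(4) by (auto simp: a_def)
    show "chart_set c (cball a d) \<subseteq> U i" using dr c(5) by (force simp: chart_set_def a_def)
    show "{p} \<inter> chart_set c (sphere a d) = {}" using e(1) by (auto simp: chart_set_def a_def)
    show "section_on (UNIV - {p}) v" using v by (simp add: Compl_eq_Diff_UNIV)
    show "cmod (e z / of_real (cmod (e z))) = 1" if "z \<in> cball a d - {}" for z
      using e(4)[of z] that by (simp add: norm_divide)
    show "e z / of_real (cmod (e z)) = v i (chart_inv c z)" if "z \<in> sphere a d" for z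
    proof -
      have "z \<in> cball a r - {a}" using that e(1,2) by auto
      then show ?thesis using e(5)[OF that] v1[of z] by simp
    qed
  qed (auto simp: chart_set_def)
  moreover have "p \<in> chart_set c (ball a d)" using c e(1) by (auto simp: chart_set_def a_def)
  moreover have "chart_set c {} = {}" by (simp add: chart_set_def)
  ultimately show ?thesis by auto
qed

end

section \<open>Smooth functions in the sense of the definitions\<close>

lemma Ck_on_SucD:
  assumes "Ck_on (Suc k) S f" "x \<in> S"
  shows "(f has_derivative frechet_derivative f (at x)) (at x)"
  using assms by (simp add: frechet_derivative_works)

text \<open>On an open set two functions that agree also have equal derivatives, so agreement passes
  through the recursion.\<close>

lemma Ck_on_cong:
  assumes "open S" "\<And>x. x \<in> S \<Longrightarrow> f x = g x" "Ck_on k S f"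
  shows "Ck_on k S g"
  using assms(2,3)
proof (induction k arbitrary: f g)
  case 0
  then show ?case by (simp cong: continuous_on_cong)
next
  case (Suc k)
  have d: "(g has_derivative frechet_derivative f (at x)) (at x)" if "x \<in> S" for x
    by (rule has_derivative_transform_within_open[OF Ck_on_SucD[OF Suc.prems(2) that] assms(1) that])
      (use Suc.prems in auto)
  then have "frechet_derivative f (at x) v = frechet_derivative g (at x) v" if "x \<in> S" for x v
    using that by (metis frechet_derivative_at)
  moreover have "Ck_on k S (\<lambda>x. frechet_derivative f (at x) v)" for v
    using Suc.prems(2) by simp
  ultimately have "Ck_on k S (\<lambda>x. frechet_derivative g (at x) v)" for v
    by (rule Suc.IH)
  then show ?case using d by (auto simp: differentiable_def)
qed

text \<open>Lets an explicit derivative replace \<open>frechet_derivative\<close>, so that the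
  recursion can be run on formulas.\<close>

lemma Ck_on_SucI:
  assumes "open S" "\<And>x. x \<in> S \<Longrightarrow> (f has_derivative f' x) (at x)" "\<And>v. Ck_on k S (\<lambda>x. f' x v)"
  shows "Ck_on (Suc k) S f"
proof -
  have "f' x = frechet_derivative f (at x)" if "x \<in> S" for x
    using assms(2)[OF that] by (rule frechet_derivative_at)
  then have "f' x v = frechet_derivative f (at x) v" if "x \<in> S" for x v
    using that by metis
  then have "Ck_on k S (\<lambda>x. frechet_derivative f (at x) v)" for v
    by (rule Ck_on_cong[OF assms(1) _ assms(3)])
  then show ?thesis using assms(2) by (auto simp: differentiable_def)
qed

lemma Ck_on_Suc_imp: "Ck_on (Suc k) S f \<Longrightarrow> Ck_on k S f"
proof (induction k arbitrary: f)
  case 0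
  then show ?case
    by (auto intro!: continuous_at_imp_continuous_on differentiable_imp_continuous_within)
next
  case (Suc k)
  then show ?case by (metis Ck_on.simps(2))
qed

lemma Ck_on_Un: "open S \<Longrightarrow> open T \<Longrightarrow> Ck_on k S f \<Longrightarrow> Ck_on k T f \<Longrightarrow> Ck_on k (S \<union> T) f"
  by (induction k arbitrary: f) (auto intro: continuous_on_open_Un)

lemma Ck_on_const: "open S \<Longrightarrow> Ck_on k S (\<lambda>x. c)"
proof (induction k arbitrary: c)
  case (Suc k)
  show ?case by (rule Ck_on_SucI[of _ _ "\<lambda>_ _. 0"]) (use Suc in auto)
qed auto

lemma Ck_on_add:
  "open S \<Longrightarrow> Ck_on k S f \<Longrightarrow> Ck_on k S g \<Longrightarrow> Ck_on k S (\<lambda>x. f x + g x)"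
proof (induction k arbitrary: f g)
  case (Suc k)
  show ?case
    by (rule Ck_on_SucI[OF Suc.prems(1) has_derivative_add[OF Ck_on_SucD[OF Suc.prems(2)] Ck_on_SucD[OF Suc.prems(3)]]])
      (use Suc in auto)
qed (auto intro: continuous_intros)

lemma Ck_on_mult:
  fixes f g :: "_ \<Rightarrow> 'b::real_normed_algebra"
  shows "open S \<Longrightarrow> Ck_on k S f \<Longrightarrow> Ck_on k S g \<Longrightarrow> Ck_on k S (\<lambda>x. f x * g x)"
proof (induction k arbitrary: f g)
  case (Suc k)
  have "Ck_on k S f" "Ck_on k S g" using Suc.prems Ck_on_Suc_imp by blast+
  then show ?case
    by (intro Ck_on_SucI[OF Suc.prems(1) has_derivative_mult[OF Ck_on_SucD[OF Suc.prems(2)] Ck_on_SucD[OF Suc.prems(3)]]]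
        Ck_on_add Suc.IH Suc.prems(1))
      (use Suc.prems(2,3) in auto)
qed (auto intro: continuous_intros)

lemma Ck_on_bounded_linear:
  assumes "bounded_linear B" "open S"
  shows "Ck_on k S f \<Longrightarrow> Ck_on k S (\<lambda>x. B (f x))"
proof (induction k arbitrary: f)
  case (Suc k)
  show ?case
    by (rule Ck_on_SucI[OF assms(2) bounded_linear.has_derivative[OF assms(1) Ck_on_SucD[OF Suc.prems]]])
      (use Suc in auto)
qed (use assms(1) in \<open>auto intro: bounded_linear.continuous_on\<close>)

lemma Ck_on_holomorphic: "open S \<Longrightarrow> f holomorphic_on S \<Longrightarrow> Ck_on k S f"
proof (induction k arbitrary: f)
  case 0
  then show ?case by (simp add: holomorphic_on_imp_continuous_on)
next
  case (Suc k)
  have "(f has_derivative (\<lambda>v. deriv f x * v)) (at x)" if "x \<in> S" for x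
    using holomorphic_derivI[OF Suc.prems(2,1) that, of UNIV] by (simp add: has_field_derivative_def)
  moreover have "Ck_on k S (\<lambda>x. deriv f x * v)" for v
    by (intro Suc.IH Suc.prems holomorphic_intros holomorphic_deriv)
  ultimately show ?case by (rule Ck_on_SucI[OF Suc.prems(1)])
qed

text \<open>The classical flat function e^(-1/t) is the case n = 0. The factor t^(-n) makes the
  family closed under differentiation up to linear combinations.\<close>

definition bump :: "nat \<Rightarrow> real \<Rightarrow> real" where
  "bump n t = (if t > 0 then (1 / t) ^ n * exp (- (1 / t)) else 0)"

lemma bump_nonneg: "0 \<le> bump n t" by (simp add: bump_def)

text \<open>With s = 1/t, the term of order n + 2 in the series of e^s bounds s^(n + 2) by (n + 2)!
  e^s. A quadratic bound is what makes the derivative at 0 vanish.\<close>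

lemma bump_le: "bump n t \<le> fact (n + 2) * t\<^sup>2"
proof (cases "t > 0")
  case True
  define s where "s = 1 / t"
  have s: "s > 0" using True by (simp add: s_def)
  have "s ^ (n+2) / fact (n+2) \<le> exp s"
  proof -
    have "summable (\<lambda>k. inverse (fact k) * s ^ k)" using summable_exp[of s] by simp
    then have "sum (\<lambda>k. inverse (fact k) * s ^ k) {n+2} \<le> (\<Sum>k. inverse (fact k) * s ^ k)"
      using s by (intro sum_le_suminf) auto
    then show ?thesis by (simp add: exp_def scaleR_conv_of_real divide_inverse mult.commute)
  qed
  then have "s ^ (n+2) \<le> fact (n+2) * exp s" by (simp add: divide_le_eq mult.commute)
  then have "s ^ (n+2) * exp (- s) \<le> fact (n+2)"
    by (simp add: exp_minus field_simps)
  then have "s ^ (n+2) * exp (- s) * t^2 \<le> fact (n+2) * t^2" by (rule mult_right_mono) simp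
  moreover have "s ^ (n+2) * t^2 = s ^ n" using True by (simp add: s_def power_add power_divide power2_eq_square)
  ultimately have "s ^ n * exp (- s) \<le> fact (n+2) * t^2" by (metis mult.commute mult.left_commute)
  then show ?thesis using True by (simp add: bump_def s_def)
qed (simp add: bump_def)

lemma has_real_derivative_bump:
  "(bump n has_real_derivative (- real n * bump (Suc n) t + bump (n + 2) t)) (at t)"
proof -
  consider "t > 0" | "t < 0" | "t = 0" by linarith
  then show ?thesis
  proof cases
    case 1
    have "((\<lambda>t. (1 / t) ^ n * exp (- (1 / t))) has_real_derivative
       (- real n * bump (Suc n) t + bump (n + 2) t)) (at t)"
    proof -
      have d: "((\<lambda>t. 1 / t) has_real_derivative - ((1 / t)\<^sup>2)) (at t)"
        using 1 by (auto intro!: derivative_eq_intros simp: field_simps power2_eq_square)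
      have e: "((\<lambda>t. exp (- (1 / t))) has_real_derivative exp (- (1 / t)) * (1 / t)\<^sup>2) (at t)"
        using DERIV_chain2[OF DERIV_exp DERIV_minus[OF d]] by simp
      have "real n * (- (s\<^sup>2) * s ^ (n - Suc 0)) * E + E * s\<^sup>2 * s ^ n =
        - real n * (s ^ Suc n * E) + s ^ (n + 2) * E" for s E :: real
        by (cases n) (simp_all add: algebra_simps power2_eq_square)
      then show ?thesis
        using DERIV_mult[OF DERIV_power[OF d, of n] e] 1 by (simp add: bump_def)
    qed
    then show ?thesis
      by (rule DERIV_cong_ev[THEN iffD1, rotated -1])
       (use 1 eventually_nhds_in_open[of "{0<..}" t] in \<open>auto simp: bump_def elim!: eventually_mono\<close>)
  next
    case 2
    have "((\<lambda>t. 0) has_real_derivative (- real n * bump (Suc n) t + bump (n + 2) t)) (at t)"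
      using 2 by (simp add: bump_def)
    then show ?thesis
      by (rule DERIV_cong_ev[THEN iffD1, rotated -1])
       (use 2 eventually_nhds_in_open[of "{..<0}" t] in \<open>auto simp: bump_def elim!: eventually_mono\<close>)
  next
    case 3
    have "((\<lambda>h. bump n h / h) \<longlongrightarrow> 0) (at 0)"
    proof (rule Lim_null_comparison)
      have "norm (bump n h / h) \<le> fact (n+2) * \<bar>h\<bar>" for h
        using bump_le[of n h] bump_nonneg[of n h]
        by (cases "h = 0") (auto simp: divide_simps power2_eq_square abs_mult_self_eq mult.assoc)
      then show "\<forall>\<^sub>F h in at 0. norm (bump n h / h) \<le> fact (n+2) * \<bar>h\<bar>" by simp
      show "((\<lambda>h::real. fact (n+2) * \<bar>h\<bar>) \<longlongrightarrow> 0) (at 0)"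
        by (rule tendsto_eq_intros | simp)+
    qed
    then show ?thesis using 3 by (simp add: DERIV_def bump_def)
  qed
qed

text \<open>Induction on \<open>k\<close> with \<open>n\<close> left free, since each
  differentiation raises \<open>n\<close>.\<close>

lemma Ck_on_bump:
  assumes "open S" "\<And>k. Ck_on k S \<phi>"
  shows "Ck_on k S (\<lambda>x. bump n (\<phi> x))"
proof (induction k arbitrary: n)
  case 0
  have "continuous_on UNIV (bump n)"
    using has_real_derivative_bump by (intro continuous_at_imp_continuous_on) (blast intro: DERIV_isCont)
  then show ?case
    using assms(2)[of 0] by (auto intro: continuous_on_compose2)
next
  case (Suc k)
  define \<phi>' where "\<phi>' = (\<lambda>x. frechet_derivative \<phi> (at x))"
  show ?case
  proof (rule Ck_on_SucI[OF assms(1)])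
    fix x assume "x \<in> S"
    then have "(\<phi> has_derivative \<phi>' x) (at x)"
      unfolding \<phi>'_def by (rule Ck_on_SucD[OF assms(2)])
    then show "((\<lambda>x. bump n (\<phi> x)) has_derivative
       (\<lambda>v. (- real n * bump (Suc n) (\<phi> x) + bump (n+2) (\<phi> x)) * \<phi>' x v)) (at x)"
      using has_derivative_compose[of \<phi> "\<phi>' x" x UNIV "bump n"] has_real_derivative_bump[of n "\<phi> x"]
      by (simp add: has_field_derivative_def)
  next
    fix v
    have "Ck_on k S (\<lambda>x. \<phi>' x v)" using assms(2)[of "Suc k"] by (simp add: \<phi>'_def)
    then show "Ck_on k S (\<lambda>x. (- real n * bump (Suc n) (\<phi> x) + bump (n+2) (\<phi> x)) * \<phi>' x v)"
      by (intro Ck_on_mult Ck_on_add Ck_on_const Suc.IH assms(1))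
  qed
qed

section \<open>Hermitian line bundles\<close>

lemma continuous_on_locally:
  fixes f :: "'a::t2_space \<Rightarrow> 'b::topological_space"
  assumes "\<And>x. x \<in> S \<Longrightarrow> \<exists>W. open W \<and> x \<in> W \<and> continuous_on W f"
  shows "continuous_on S f"
proof (rule continuous_at_imp_continuous_on, rule ballI)
  fix x assume "x \<in> S"
  then obtain W where "open W" "x \<in> W" "continuous_on W f" using assms by blast
  then show "isCont f x" by (simp add: continuous_on_eq_continuous_at)
qed

locale hermitian_line_bundle = compact_riemann_surface A
  for A :: "('a::t2_space, complex) chart set" +
  fixes L :: "('a, 'l::topological_space) line_bundle" and h :: "'l \<Rightarrow> 'l \<Rightarrow> complex"
  assumes holomorphic: "holomorphic_line_bundle A L" and hermitian: "hermitian_metric A L h"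
begin

lemma triv_at: "\<exists>t\<in>trivs L. z \<in> fst t"
  using holomorphic unfolding holomorphic_line_bundle_def by blast

lemma open_triv: "t \<in> trivs L \<Longrightarrow> open (fst t)"
  using holomorphic unfolding holomorphic_line_bundle_def by blast

lemma fibre_linear:
  assumes "t \<in> trivs L" "z \<in> fst t" "v \<in> fibre L z" "w \<in> fibre L z"
  shows "fadd L v w \<in> fibre L z" "snd t (fadd L v w) = snd t v + snd t w"
    "fscale L a v \<in> fibre L z" "snd t (fscale L a v) = a * snd t v"
  using holomorphic assms unfolding holomorphic_line_bundle_def by blast+

context
  fixes t assumes t: "t \<in> trivs L"
begin

lemma fibre_coord_inj:
  assumes "z \<in> fst t" "v \<in> fibre L z" "w \<in> fibre L z" "snd t v = snd t w"
  shows "v = w"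
proof -
  obtain k where k: "homeomorphism (proj L -` fst t) (fst t \<times> UNIV) (\<lambda>v. (proj L v, snd t v)) k"
    using holomorphic t unfolding holomorphic_line_bundle_def by blast
  have "v \<in> proj L -` fst t" "w \<in> proj L -` fst t" using assms by (auto simp: fibre_def)
  then have "k (proj L v, snd t v) = v" "k (proj L w, snd t w) = w"
    using k unfolding homeomorphism_def by blast+
  then show ?thesis using assms by (simp add: fibre_def)
qed

lemma frame:
  assumes "z \<in> fst t"
  shows "frame L t z \<in> fibre L z" "snd t (frame L t z) = 1"
proof -
  obtain k where k: "homeomorphism (proj L -` fst t) (fst t \<times> UNIV) (\<lambda>v. (proj L v, snd t v)) k"
    using holomorphic t unfolding holomorphic_line_bundle_def by blast
  have "(z, 1) \<in> (\<lambda>v. (proj L v, snd t v)) ` (proj L -` fst t)"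
    using k assms by (auto simp: homeomorphism_def)
  then obtain v where "v \<in> fibre L z" "snd t v = 1" by (auto simp: fibre_def)
  then have "\<exists>!v. v \<in> fibre L z \<and> snd t v = 1"
    using fibre_coord_inj[OF assms] by metis
  from theI'[OF this] have "frame L t z \<in> fibre L z \<and> snd t (frame L t z) = 1"
    unfolding frame_def .
  then show "frame L t z \<in> fibre L z" "snd t (frame L t z) = 1" by auto
qed

lemma fibre_eq_fscale_frame:
  assumes "z \<in> fst t" "v \<in> fibre L z"
  shows "v = fscale L (snd t v) (frame L t z)"
  using frame[OF assms(1)] fibre_linear[OF t assms(1)] assms
  by (intro fibre_coord_inj[OF assms(1)]) auto

lemma coord_change:
  assumes "u \<in> trivs L" "z \<in> fst t" "z \<in> fst u" "v \<in> fibre L z"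
  shows "snd u v = snd t v * snd u (frame L t z)"
  by (subst fibre_eq_fscale_frame[OF assms(2,4)])
    (rule fibre_linear(4)[OF assms(1,3) frame(1)[OF assms(2)] frame(1)[OF assms(2)]])

lemma continuous_transition:
  assumes "u \<in> trivs L"
  shows "continuous_on (fst t \<inter> fst u) (\<lambda>z. snd u (frame L t z))"
proof (rule continuous_on_locally)
  fix z assume z: "z \<in> fst t \<inter> fst u"
  obtain c where c: "c \<in> A" "z \<in> fst c" using chart_at by blast
  define W where "W = fst c \<inter> fst t \<inter> fst u"
  have "open W" unfolding W_def by (intro open_Int open_chart(1)[OF c(1)] open_triv t assms)
  have "(\<lambda>x. snd u (frame L t (chart_inv c x))) holomorphic_on (snd c ` W)"
    using holomorphic t assms c unfolding holomorphic_line_bundle_def W_def by blast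
  then have "continuous_on (snd c ` W) (\<lambda>x. snd u (frame L t (chart_inv c x)))"
    by (rule holomorphic_on_imp_continuous_on)
  then have "continuous_on W (\<lambda>z. snd u (frame L t (chart_inv c (snd c z))))"
    by (rule continuous_on_compose2) (auto intro: continuous_on_subset[OF continuous_on_chart[OF c(1)]] simp: W_def)
  then have "continuous_on W (\<lambda>z. snd u (frame L t z))"
    by (rule continuous_on_eq) (use c in \<open>auto simp: W_def\<close>)
  then show "\<exists>W. open W \<and> z \<in> W \<and> continuous_on W (\<lambda>z. snd u (frame L t z))"
    using \<open>open W\<close> c z by (intro exI[of _ W]) (auto simp: W_def)
qed

end

lemma hermitian_fibre:
  assumes "v \<in> fibre L z" "w \<in> fibre L z"
  shows "h (fscale L a v) w = a * h v w" "h w v = cnj (h v w)" "v \<noteq> fscale L 0 v \<Longrightarrow> 0 < Re (h v v)"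
  using hermitian assms unfolding hermitian_metric_def by blast+

lemma hermitian_fscale:
  assumes "v \<in> fibre L z"
  shows "h (fscale L a v) (fscale L a v) = of_real ((cmod a)\<^sup>2) * h v v"
proof -
  obtain t where t: "t \<in> trivs L" "z \<in> fst t" using triv_at by blast
  have "fscale L a v \<in> fibre L z" using fibre_linear(3)[OF t assms assms] .
  then have "h (fscale L a v) (fscale L a v) = a * cnj (a * h v v)"
    using hermitian_fibre(1,2) assms by metis
  moreover have "cnj (h v v) = h v v" using hermitian_fibre(2)[OF assms assms] by simp
  ultimately show ?thesis by (simp only: complex_norm_square complex_cnj_mult mult.assoc)
qed

text \<open>The length of the holomorphic frame; dividing by it passes to a unitary frame.\<close>

definition rho :: "'a set \<times> ('l \<Rightarrow> complex) \<Rightarrow> 'a \<Rightarrow> real" where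
  "rho t z = sqrt (Re (h (frame L t z) (frame L t z)))"

lemma rho_pos:
  assumes "t \<in> trivs L" "z \<in> fst t"
  shows "rho t z > 0"
proof -
  note f = frame[OF assms]
  have "snd t (fscale L 0 (frame L t z)) = 0" using fibre_linear(4)[OF assms f(1) f(1), of 0] by simp
  then have "frame L t z \<noteq> fscale L 0 (frame L t z)" using f(2) by auto
  then show ?thesis using hermitian_fibre(3)[OF f(1) f(1)] by (simp add: rho_def)
qed

lemma fibre_norm:
  assumes "t \<in> trivs L" "z \<in> fst t" "v \<in> fibre L z"
  shows "sqrt (Re (h v v)) = cmod (snd t v) * rho t z"
proof -
  have "h v v = of_real ((cmod (snd t v))\<^sup>2) * h (frame L t z) (frame L t z)"
    using hermitian_fscale[OF frame(1)[OF assms(1,2)], of "snd t v"]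
      fibre_eq_fscale_frame[OF assms] by simp
  then show ?thesis by (simp add: rho_def real_sqrt_mult)
qed

lemma rho_change:
  assumes "t \<in> trivs L" "u \<in> trivs L" "z \<in> fst t" "z \<in> fst u"
  shows "rho t z = cmod (snd u (frame L t z)) * rho u z"
  using fibre_norm[OF assms(2,4) frame(1)[OF assms(1,3)]] by (simp add: rho_def)

text \<open>A \<open>line_bundle\<close> records no zero vector, so it is produced as 0 times a
  frame; every trivialization gives it the coordinate 0.\<close>

definition zero_section :: "'a \<Rightarrow> 'l" where
  "zero_section z = (let u = (SOME u. u \<in> trivs L \<and> z \<in> fst u) in fscale L 0 (frame L u z))"

lemma zero_section:
  shows "zero_section z \<in> fibre L z" "t \<in> trivs L \<Longrightarrow> z \<in> fst t \<Longrightarrow> snd t (zero_section z) = 0"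
proof -
  define u where "u = (SOME u. u \<in> trivs L \<and> z \<in> fst u)"
  have u: "u \<in> trivs L" "z \<in> fst u"
    using someI_ex[of "\<lambda>u. u \<in> trivs L \<and> z \<in> fst u"] triv_at unfolding u_def by blast+
  have z: "zero_section z = fscale L 0 (frame L u z)" by (simp add: zero_section_def u_def)
  show "zero_section z \<in> fibre L z" unfolding z
    by (rule fibre_linear(3)[OF u frame(1)[OF u] frame(1)[OF u]])
  show "snd t (zero_section z) = 0" if "t \<in> trivs L" "z \<in> fst t" unfolding z
    using fibre_linear(4)[OF that frame(1)[OF u] frame(1)[OF u], of 0] by simp
qed

text \<open>Turns a local frame into a global smooth section, as required to exploit the smoothness
  clause of \<open>hermitian_metric\<close>. The argument of the bump is positive exactly in the
  open disc, so the section vanishes to infinite order at its boundary.\<close>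

lemma bump_section:
  assumes c: "c \<in> A" and t: "t \<in> trivs L" and r: "r > 0" "cball b r \<subseteq> chart_image c"
    "chart_set c (cball b r) \<subseteq> fst t"
  shows "smooth_section A L (\<lambda>z. if z \<in> chart_set c (cball b r)
    then fscale L (of_real (bump 0 (r\<^sup>2 - (cmod (snd c z - b))\<^sup>2))) (frame L t z) else zero_section z)"
    (is "smooth_section A L ?s")
  unfolding smooth_section_def
proof (intro conjI allI ballI)
  define D where "D = chart_set c (cball b r)"
  have s_in: "?s z \<in> fibre L z" for z
    using fibre_linear(3)[OF t _ frame(1)[OF t] frame(1)[OF t]] r(3) zero_section(1) by auto
  then show "?s z \<in> fibre L z" for z .
  fix u d assume u: "u \<in> trivs L" and d: "d \<in> A"
  define \<Omega>1 where "\<Omega>1 = snd d ` (fst d \<inter> (fst c \<inter> fst t \<inter> fst u))"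
  define \<Omega>2 where "\<Omega>2 = snd d ` (fst d \<inter> (fst u - D))"
  have "closed D" unfolding D_def by (rule closed_chart_set[OF c compact_cball r(2)])
  then have o: "open \<Omega>1" "open \<Omega>2"
    unfolding \<Omega>1_def \<Omega>2_def
    by (intro open_chart_image_subset[OF d] open_Int open_Diff open_chart(1)[OF c] open_triv t u; simp)+
  have "D \<subseteq> fst c \<inter> fst t" using r(3) by (auto simp: D_def chart_set_def)
  then have un: "snd d ` (fst d \<inter> fst u) = \<Omega>1 \<union> \<Omega>2" by (auto simp: \<Omega>1_def \<Omega>2_def)
  define T where "T = snd c \<circ> chart_inv d"
  \<comment> \<open>The squared distance is written as the real part of a product with a conjugate,
    so that the closure properties of \<open>Ck_on\<close> apply.\<close>
  define \<phi> where "\<phi> = (\<lambda>x. r\<^sup>2 + (- 1) * Re ((T x + (- b)) * cnj (T x + (- b))))"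
  define g where "g = (\<lambda>x. snd u (frame L t (chart_inv d x)))"
  have "T holomorphic_on snd d ` (fst d \<inter> fst c)"
    unfolding T_def by (rule transition_holomorphic[OF d c])
  then have "T holomorphic_on \<Omega>1" by (rule holomorphic_on_subset) (auto simp: \<Omega>1_def)
  then have kT: "Ck_on k \<Omega>1 T" for k by (rule Ck_on_holomorphic[OF o(1)])
  have "g holomorphic_on snd d ` (fst d \<inter> fst t \<inter> fst u)"
    using holomorphic t u d unfolding holomorphic_line_bundle_def g_def by blast
  then have "g holomorphic_on \<Omega>1" by (rule holomorphic_on_subset) (auto simp: \<Omega>1_def)
  then have kg: "Ck_on k \<Omega>1 g" for k by (rule Ck_on_holomorphic[OF o(1)])
  have "Ck_on k \<Omega>1 \<phi>" for k unfolding \<phi>_def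
    by (intro Ck_on_add Ck_on_mult Ck_on_const kT o(1) Ck_on_bounded_linear[OF bounded_linear_Re]
      Ck_on_bounded_linear[OF bounded_linear_cnj])
  then have kb: "Ck_on k \<Omega>1 (\<lambda>x. bump 0 (\<phi> x))" for k by (rule Ck_on_bump[OF o(1)])
  have "Ck_on k \<Omega>1 (\<lambda>x. of_real (bump 0 (\<phi> x)) * g x)" for k
    by (intro Ck_on_mult kg o(1) Ck_on_bounded_linear[OF bounded_linear_of_real] kb)
  then have k1: "Ck_on k \<Omega>1 (\<lambda>x. snd u (?s (chart_inv d x)))" for k
  proof (rule Ck_on_cong[OF o(1), rotated])
    fix x assume "x \<in> \<Omega>1"
    then obtain z where z: "z \<in> fst d" "z \<in> fst c" "z \<in> fst t" "z \<in> fst u" "x = snd d z"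
      by (auto simp: \<Omega>1_def)
    then have x: "chart_inv d x = z" using d by simp
    have ph: "\<phi> x = r\<^sup>2 - (cmod (snd c z - b))\<^sup>2"
      unfolding \<phi>_def by (simp add: T_def x cmod_power2) (simp add: power2_eq_square algebra_simps)
    show "of_real (bump 0 (\<phi> x)) * g x = snd u (?s (chart_inv d x))"
    proof (cases "z \<in> D")
      case True
      then show ?thesis
        using fibre_linear(4)[OF u z(4) frame(1)[OF t z(3)] frame(1)[OF t z(3)]]
        by (simp add: x ph g_def D_def)
    next
      case False
      then have "r < cmod (snd c z - b)"
        using z by (auto simp: D_def chart_set_def dist_norm norm_minus_commute)
      then have "\<phi> x \<le> 0" using r(1) power_mono[of r "cmod (snd c z - b)" 2] by (simp add: ph)
      then show ?thesis using False zero_section(2)[OF u z(4)] by (simp add: x D_def bump_def)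
    qed
  qed
  have "Ck_on k \<Omega>2 (\<lambda>x. 0 :: complex)" for k by (rule Ck_on_const[OF o(2)])
  then have k2: "Ck_on k \<Omega>2 (\<lambda>x. snd u (?s (chart_inv d x)))" for k
  proof (rule Ck_on_cong[OF o(2), rotated])
    fix x assume "x \<in> \<Omega>2"
    then obtain z where z: "z \<in> fst d" "z \<notin> D" "z \<in> fst u" "x = snd d z"
      by (auto simp: \<Omega>2_def)
    then have x: "chart_inv d x = z" using d by simp
    show "0 = snd u (?s (chart_inv d x))"
      unfolding x using z(2) zero_section(2)[OF u z(3)] by (simp add: D_def)
  qed
  show "smooth_on (snd d ` (fst d \<inter> fst u)) (\<lambda>x. snd u (?s (chart_inv d x)))"
    unfolding smooth_on_def un using Ck_on_Un[OF o k1 k2] by blast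
qed

text \<open>For the bump section \<open>s\<close> with factor \<beta>, h(s, s) is \<beta>^2 times
  the squared length of the frame. Near the centre \<beta> is positive and can be divided
  out.\<close>

lemma continuous_rho:
  assumes t: "t \<in> trivs L"
  shows "continuous_on (fst t) (rho t)"
proof (rule continuous_on_locally)
  fix z assume z: "z \<in> fst t"
  obtain c r where c: "c \<in> A" "z \<in> fst c" "r > 0" "cball (snd c z) r \<subseteq> chart_image c"
    "chart_set c (cball (snd c z) r) \<subseteq> fst t"
    by (rule chart_disc_at[OF open_triv[OF t] z finite.emptyI]) blast
  define b where "b = snd c z"
  define \<beta> where "\<beta> = (\<lambda>z. bump 0 (r\<^sup>2 - (cmod (snd c z - b))\<^sup>2))"
  define s where "s = (\<lambda>z. if z \<in> chart_set c (cball b r)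
    then fscale L (of_real (\<beta> z)) (frame L t z) else zero_section z)"
  have "smooth_section A L s"
    unfolding s_def \<beta>_def by (rule bump_section[OF c(1) t c(3) c(4,5)[folded b_def]])
  then have "smooth_map A (\<lambda>z. h (s z) (s z))" using hermitian by (simp add: hermitian_metric_def)
  then have "Ck_on 0 (chart_image c) ((\<lambda>z. h (s z) (s z)) \<circ> chart_inv c)"
    using c(1) unfolding smooth_map_def smooth_on_def by blast
  then have "continuous_on (chart_image c) (\<lambda>y. h (s (chart_inv c y)) (s (chart_inv c y)))"
    by (simp add: comp_def)
  then have "continuous_on (fst c) (\<lambda>z. h (s (chart_inv c (snd c z))) (s (chart_inv c (snd c z))))"
    by (rule continuous_on_compose2[OF _ continuous_on_chart[OF c(1)]]) (simp add: chart_image_def)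
  then have hc: "continuous_on (fst c) (\<lambda>z. h (s z) (s z))"
    by (rule continuous_on_eq) (use c(1) in auto)
  define W where "W = chart_set c (ball b r)"
  have W: "open W" "z \<in> W" "W \<subseteq> fst c" "W \<subseteq> chart_set c (cball b r)"
    using open_chart_set[OF c(1) open_ball] c by (auto simp: W_def b_def chart_set_def)
  have \<beta>0: "\<beta> y > 0" if "y \<in> W" for y
  proof -
    have "cmod (snd c y - b) < r" using that by (auto simp: W_def chart_set_def dist_norm norm_minus_commute)
    then have "(cmod (snd c y - b))\<^sup>2 < r\<^sup>2" by (intro power_strict_mono) auto
    then show ?thesis by (simp add: \<beta>_def bump_def)
  qed
  have "continuous_on UNIV (bump 0)"
    using has_real_derivative_bump by (intro continuous_at_imp_continuous_on) (blast intro: DERIV_isCont)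
  then have "continuous_on W \<beta>" unfolding \<beta>_def
    by (rule continuous_on_compose2)
      (auto intro!: continuous_intros continuous_on_subset[OF continuous_on_chart[OF c(1)] W(3)])
  then have "continuous_on W (\<lambda>y. sqrt (Re (h (s y) (s y)) / (\<beta> y)\<^sup>2))"
    by (intro continuous_intros continuous_on_subset[OF hc W(3)]) (auto dest: \<beta>0)
  then have "continuous_on W (rho t)"
  proof (rule continuous_on_eq)
    fix y assume y: "y \<in> W"
    then have "y \<in> fst t" using W(4) c(5) by (auto simp: b_def)
    have "s y = fscale L (of_real (\<beta> y)) (frame L t y)" using y W(4) by (auto simp: s_def)
    then have "h (s y) (s y) = of_real ((\<beta> y)\<^sup>2) * h (frame L t y) (frame L t y)"
      using hermitian_fscale[OF frame(1)[OF t \<open>y \<in> fst t\<close>], of "of_real (\<beta> y)"] by simp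
    then have "Re (h (s y) (s y)) = (\<beta> y)\<^sup>2 * Re (h (frame L t y) (frame L t y))"
      by (simp del: of_real_power)
    then show "sqrt (Re (h (s y) (s y)) / (\<beta> y)\<^sup>2) = rho t y"
      using \<beta>0[OF y] by (simp add: rho_def)
  qed
  then show "\<exists>W. open W \<and> z \<in> W \<and> continuous_on W (rho t)" using W by blast
qed

end

section \<open>The circle bundle\<close>

context hermitian_line_bundle
begin

text \<open>The functional with coordinate \<open>w\<close> in the unitary trivialization. The
  factor \<open>rho\<close> makes its dual norm equal to |w|, so the circle bundle corresponds to
  |w| = 1.\<close>

definition pt :: "'a set \<times> ('l \<Rightarrow> complex) \<Rightarrow> 'a \<Rightarrow> complex \<Rightarrow> 'a \<times> ('l \<Rightarrow> complex)" where
  "pt t z w = (z, \<lambda>v. if v \<in> fibre L z then w * of_real (rho t z) * snd t v else 0)"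

definition coord :: "'a set \<times> ('l \<Rightarrow> complex) \<Rightarrow> 'a \<times> ('l \<Rightarrow> complex) \<Rightarrow> complex" where
  "coord t p = snd p (frame L t (fst p)) / of_real (rho t (fst p))"

lemma fst_pt [simp]: "fst (pt t z w) = z"
  by (simp add: pt_def)

lemma act_pt [simp]: "circle_act u (pt t z w) = pt t z (u * w)"
  by (auto simp: circle_act_def pt_def)

lemma pt_frame:
  assumes "t \<in> trivs L" "z \<in> fst t" "u \<in> trivs L" "z \<in> fst u"
  shows "snd (pt t z w) (frame L u z) = w * of_real (rho t z) * snd t (frame L u z)"
  using frame(1)[OF assms(3,4)] by (simp add: pt_def)

lemma coord_pt [simp]:
  assumes "t \<in> trivs L" "z \<in> fst t"
  shows "coord t (pt t z w) = w"
  using frame[OF assms] rho_pos[OF assms] by (simp add: coord_def pt_def)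

lemma pt_in_dual:
  assumes "t \<in> trivs L" "z \<in> fst t"
  shows "pt t z w \<in> dual_bundle L"
  using fibre_linear[OF assms] by (auto simp: dual_bundle_def pt_def algebra_simps)

lemma pt_coord:
  assumes "t \<in> trivs L" "fst p \<in> fst t" "p \<in> dual_bundle L"
  shows "pt t (fst p) (coord t p) = p"
proof -
  define z l where "z = fst p" "l = snd p"
  then have p: "p = (z, l)" by simp
  have z: "z \<in> fst t" using assms by (simp add: p)
  have l: "l (fscale L a v) = a * l v" if "v \<in> fibre L z" for a v
    using assms(3) that unfolding p dual_bundle_def by blast
  have l0: "l v = 0" if "v \<notin> fibre L z" for v
    using assms(3) that unfolding p dual_bundle_def by blast
  have "l v = snd t v * l (frame L t z)" if "v \<in> fibre L z" for v
    using l[OF frame(1)[OF assms(1) z], of "snd t v"] fibre_eq_fscale_frame[OF assms(1) z that] by simp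
  then show ?thesis
    using l0 rho_pos[OF assms(1) z] by (auto simp: pt_def coord_def p)
qed

lemma dual_norm_coord:
  assumes "t \<in> trivs L" "fst p \<in> fst t" "p \<in> dual_bundle L"
  shows "dual_norm L h p = cmod (coord t p)"
proof -
  define z where "z = fst p"
  have z: "z \<in> fst t" using assms by (simp add: z_def)
  define w where "w = coord t p"
  have p: "p = pt t z w" using pt_coord[OF assms] by (simp add: z_def w_def)
  note r = rho_pos[OF assms(1) z]
  define S where "S = {cmod (snd p v) | v. v \<in> fibre L (fst p) \<and> sqrt (Re (h v v)) \<le> 1}"
  have val: "cmod (snd p v) = cmod w * (cmod (snd t v) * rho t z)" if "v \<in> fibre L z" for v
    using that r by (simp add: p pt_def norm_mult)
  have "Sup S = cmod w"
  proof (rule cSup_eq_maximum)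
    \<comment> \<open>The unit vector along the frame attains the supremum.\<close>
    define v where "v = fscale L (of_real (1 / rho t z)) (frame L t z)"
    have v: "v \<in> fibre L z" "snd t v = of_real (1 / rho t z)"
      unfolding v_def using fibre_linear(3,4)[OF assms(1) z frame(1)[OF assms(1) z] frame(1)[OF assms(1) z]]
        frame(2)[OF assms(1) z] by auto
    have "sqrt (Re (h v v)) \<le> 1" "cmod (snd p v) = cmod w"
      using fibre_norm[OF assms(1) z v(1)] val[OF v(1)] r by (simp_all add: v(2) norm_divide)
    then show "cmod w \<in> S" using v(1) unfolding S_def z_def[symmetric] by (metis (mono_tags, lifting) mem_Collect_eq)
  next
    fix x assume "x \<in> S"
    then obtain v where v: "x = cmod (snd p v)" "v \<in> fibre L z" "sqrt (Re (h v v)) \<le> 1"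
      by (auto simp: S_def z_def)
    then show "x \<le> cmod w"
      using fibre_norm[OF assms(1) z v(2)] val[OF v(2)] r by (simp add: mult_left_le)
  qed
  then show ?thesis by (simp add: dual_norm_def S_def w_def)
qed

lemma circle_bundle_iff:
  assumes "t \<in> trivs L" "fst p \<in> fst t"
  shows "p \<in> circle_bundle L h \<longleftrightarrow> p \<in> dual_bundle L \<and> cmod (coord t p) = 1"
  using dual_norm_coord[OF assms] by (auto simp: circle_bundle_def)

lemma pt_in_circle:
  assumes "t \<in> trivs L" "z \<in> fst t" "cmod w = 1"
  shows "pt t z w \<in> circle_bundle L h"
  using assms circle_bundle_iff[of t "pt t z w"] pt_in_dual by simp

lemma circle_bundle_pt:
  assumes "t \<in> trivs L" "fst p \<in> fst t" "p \<in> circle_bundle L h"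
  shows "pt t (fst p) (coord t p) = p" "cmod (coord t p) = 1"
  using assms circle_bundle_iff[OF assms(1,2)] pt_coord by auto

lemma act_in_circle:
  assumes "p \<in> circle_bundle L h" "cmod u = 1"
  shows "circle_act u p \<in> circle_bundle L h"
proof -
  obtain t where t: "t \<in> trivs L" "fst p \<in> fst t" using triv_at by blast
  have "circle_act u (pt t (fst p) (coord t p)) \<in> circle_bundle L h"
    unfolding act_pt by (rule pt_in_circle[OF t]) (use circle_bundle_pt[OF t assms(1)] assms(2) in \<open>simp add: norm_mult\<close>)
  then show ?thesis using circle_bundle_pt(1)[OF t assms(1)] by simp
qed

lemma fst_act [simp]: "fst (circle_act u p) = fst p"
  by (simp add: circle_act_def)

lemma coord_act: "coord t (circle_act u p) = u * coord t p"
  by (simp add: coord_def circle_act_def)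

text \<open>The transition functions of \<open>L\<close> in unitary frames. Coordinates on the dual
  circle bundle transform inversely, so that coord t p * v t (fst p) does not depend on
  \<open>t\<close> when \<open>v\<close> is a section for this cocycle.\<close>

definition cocyc :: "'a set \<times> ('l \<Rightarrow> complex) \<Rightarrow> 'a set \<times> ('l \<Rightarrow> complex) \<Rightarrow> 'a \<Rightarrow> complex" where
  "cocyc t u z = snd u (frame L t z) * of_real (rho u z) / of_real (rho t z)"

lemma pt_change:
  assumes "t \<in> trivs L" "u \<in> trivs L" "z \<in> fst t" "z \<in> fst u"
  shows "pt u z w = pt t z (w * cocyc t u z)"
  using rho_pos[OF assms(1,3)] coord_change[OF assms(1,2,3,4)] by (auto simp: pt_def cocyc_def)

lemma coord_eq_coord_cocyc:
  assumes "t \<in> trivs L" "u \<in> trivs L" "fst p \<in> fst t" "fst p \<in> fst u" "p \<in> circle_bundle L h"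
  shows "coord t p = coord u p * cocyc t u (fst p)"
  using circle_bundle_pt(1)[OF assms(2,4,5)] pt_change[OF assms(1-4)] coord_pt[OF assms(1,3)] by metis

sublocale cc: surface_cocycle A "trivs L" fst cocyc
proof
  show "t \<in> trivs L \<Longrightarrow> open (fst t)" for t by (rule open_triv)
  show "(\<Union>t\<in>trivs L. fst t) = UNIV" using triv_at by blast
  show "continuous_on (fst t \<inter> fst u) (cocyc t u)" if "t \<in> trivs L" "u \<in> trivs L" for t u
    unfolding cocyc_def using that
    by (intro continuous_intros continuous_transition continuous_on_subset[OF continuous_rho])
      (auto dest: rho_pos)
  show "cmod (cocyc t u z) = 1" if "t \<in> trivs L" "u \<in> trivs L" "z \<in> fst t \<inter> fst u" for t u z
  proof -
    have z: "z \<in> fst t" "z \<in> fst u" using that by auto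
    note r = rho_pos[OF that(1) z(1)] rho_pos[OF that(2) z(2)]
    have "cmod (cocyc t u z) = cmod (snd u (frame L t z)) * rho u z / rho t z"
      using r by (simp add: cocyc_def norm_mult norm_divide)
    then show ?thesis using rho_change[OF that(1,2) z] r by auto
  qed
  show "cocyc t w z = cocyc t u z * cocyc u w z"
    if "t \<in> trivs L" "u \<in> trivs L" "w \<in> trivs L" "z \<in> fst t \<inter> fst u \<inter> fst w" for t u w z
  proof -
    have z: "z \<in> fst t" "z \<in> fst u" "z \<in> fst w" using that by auto
    have "pt t z (cocyc t w z) = pt w z 1" using pt_change[OF that(1,3) z(1,3), of 1] by simp
    also have "\<dots> = pt t z (cocyc u w z * cocyc t u z)"
      using pt_change[OF that(2,3) z(2,3), of 1] pt_change[OF that(1,2) z(1,2)] by simp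
    finally show ?thesis using coord_pt[OF that(1) z(1)] by (metis mult.commute)
  qed
qed

lemma topspace_circle: "topspace (circle_topology L h) = circle_bundle L h"
proof -
  have "p \<in> \<Union> {{(z, l) \<in> dual_bundle L. z \<in> fst t \<and> (z, l (frame L t z)) \<in> W} | t W. t \<in> trivs L \<and> open W}"
    if p: "p \<in> dual_bundle L" for p
  proof -
    obtain t where t: "t \<in> trivs L" "fst p \<in> fst t" using triv_at by blast
    have "{(z, l) \<in> dual_bundle L. z \<in> fst t \<and> (z, l (frame L t z)) \<in> UNIV} \<in>
      {{(z, l) \<in> dual_bundle L. z \<in> fst t \<and> (z, l (frame L t z)) \<in> W} | t W. t \<in> trivs L \<and> open W}"
      using t(1) open_UNIV by blast
    then show ?thesis by (rule UnionI) (use t p in \<open>simp add: case_prod_unfold\<close>)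
  qed
  then show ?thesis
    by (auto simp: circle_topology_def dual_topology_def circle_bundle_def)
qed

abbreviation over :: "'a set \<Rightarrow> ('a \<times> ('l \<Rightarrow> complex)) set" where
  "over V \<equiv> {p \<in> circle_bundle L h. fst p \<in> V}"

lemma openin_over_chart:
  assumes "t \<in> trivs L" "open W"
  shows "openin (circle_topology L h)
    {p \<in> circle_bundle L h. fst p \<in> fst t \<and> (fst p, snd p (frame L t (fst p))) \<in> W}"
proof -
  have "openin (dual_topology L) {(z, l) \<in> dual_bundle L. z \<in> fst t \<and> (z, l (frame L t z)) \<in> W}"
    unfolding dual_topology_def by (rule topology_generated_by_Basis) (use assms in blast)
  then have "openin (circle_topology L h) ({(z, l) \<in> dual_bundle L. z \<in> fst t \<and> (z, l (frame L t z)) \<in> W} \<inter> circle_bundle L h)"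
    unfolding circle_topology_def by (rule openin_subtopology_Int)
  moreover have "{(z, l) \<in> dual_bundle L. z \<in> fst t \<and> (z, l (frame L t z)) \<in> W} \<inter> circle_bundle L h =
    {p \<in> circle_bundle L h. fst p \<in> fst t \<and> (fst p, snd p (frame L t (fst p))) \<in> W}"
    by (auto simp: circle_bundle_def)
  ultimately show ?thesis by simp
qed

lemma openin_over:
  assumes "t \<in> trivs L"
  shows "openin (circle_topology L h) (over (fst t))"
  using openin_over_chart[OF assms open_UNIV] by simp

lemma continuous_map_coord:
  assumes "t \<in> trivs L"
  shows "continuous_map (subtopology (circle_topology L h) (over (fst t)))
    (top_of_set (fst t \<times> sphere 0 1)) (\<lambda>p. (fst p, coord t p))"
proof -
  define X where "X = subtopology (circle_topology L h) (over (fst t))"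
  have X: "topspace X = over (fst t)" by (auto simp: X_def topspace_circle)
  have "continuous_map X euclidean (\<lambda>p. (fst p, snd p (frame L t (fst p))))"
    unfolding continuous_map
  proof (intro conjI allI impI)
    fix W :: "('a \<times> complex) set" assume "openin euclidean W"
    then have "openin (circle_topology L h)
      {p \<in> circle_bundle L h. fst p \<in> fst t \<and> (fst p, snd p (frame L t (fst p))) \<in> W}"
      using openin_over_chart[OF assms] by simp
    then have "openin X ({p \<in> circle_bundle L h. fst p \<in> fst t \<and> (fst p, snd p (frame L t (fst p))) \<in> W} \<inter> over (fst t))"
      unfolding X_def by (rule openin_subtopology_Int)
    moreover have "{p \<in> circle_bundle L h. fst p \<in> fst t \<and> (fst p, snd p (frame L t (fst p))) \<in> W} \<inter> over (fst t) =
      {p \<in> topspace X. (fst p, snd p (frame L t (fst p))) \<in> W}" by (auto simp: X)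
    ultimately show "openin X {p \<in> topspace X. (fst p, snd p (frame L t (fst p))) \<in> W}" by simp
  qed auto
  then have 1: "continuous_map X (top_of_set (fst t \<times> UNIV)) (\<lambda>p. (fst p, snd p (frame L t (fst p))))"
    by (auto simp: continuous_map_in_subtopology X)
  have "continuous_on (fst t \<times> UNIV) (\<lambda>(z, w). (z, w / complex_of_real (rho t z)))"
    unfolding case_prod_unfold
    by (intro continuous_intros continuous_on_compose2[OF continuous_rho[OF assms]])
      (auto dest: rho_pos[OF assms])
  then have 2: "continuous_map (top_of_set (fst t \<times> UNIV)) euclidean (\<lambda>(z, w). (z, w / complex_of_real (rho t z)))"
    by simp
  have "continuous_map X euclidean (\<lambda>p. (fst p, coord t p))"
    using continuous_map_compose[OF 1 2] by (simp add: comp_def coord_def)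
  then show ?thesis
    unfolding X_def[symmetric] continuous_map_in_subtopology
    using circle_bundle_pt(2)[OF assms] by (auto simp: X)
qed

text \<open>The topology is generated by sets from all trivializations, so preimages are tested in
  an arbitrary second one \<open>u\<close>. There the fibre value is w rho(t) times a transition
  function, which is continuous in (z, w).\<close>

lemma continuous_map_pt:
  assumes "t \<in> trivs L"
  shows "continuous_map (top_of_set (fst t \<times> sphere 0 1)) (circle_topology L h) (\<lambda>(z, w). pt t z w)"
proof -
  define X where "X = top_of_set (fst t \<times> sphere (0::complex) 1)"
  have "continuous_map X (dual_topology L) (\<lambda>(z, w). pt t z w)"
    unfolding dual_topology_def
  proof (rule continuous_on_generated_topo)
    fix O' assume "O' \<in> {{(z, l) \<in> dual_bundle L. z \<in> fst t \<and> (z, l (frame L t z)) \<in> W} |t W. t \<in> trivs L \<and> open W}"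
    then obtain u W where u: "u \<in> trivs L" "open W"
      and O': "O' = {(z, l) \<in> dual_bundle L. z \<in> fst u \<and> (z, l (frame L u z)) \<in> W}" by blast
    define Y where "Y = (fst t \<inter> fst u) \<times> sphere (0::complex) 1"
    define q where "q = (\<lambda>(z, w). (z, w * of_real (rho t z) * snd t (frame L u z)))"
    have "continuous_on Y q"
      unfolding q_def case_prod_unfold
      by (intro continuous_intros continuous_on_compose2[OF continuous_rho[OF assms]]
        continuous_on_compose2[OF continuous_transition[OF u(1) assms]]) (auto simp: Y_def)
    then have "openin (top_of_set Y) (Y \<inter> q -` W)"
      using u(2) by (simp add: continuous_openin_preimage_gen)
    moreover have "openin X Y"
      unfolding X_def openin_open
      using open_triv[OF u(1)] by (intro exI[of _ "fst u \<times> UNIV"]) (auto simp: Y_def open_Times)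
    then have "openin X V" if "openin (top_of_set Y) V" for V
      using that openin_subset[of X Y] unfolding X_def by (metis openin_trans)
    ultimately have "openin X (Y \<inter> q -` W)" by blast
    moreover have "(\<lambda>(z, w). pt t z w) -` O' \<inter> topspace X = Y \<inter> q -` W"
      using pt_in_dual[OF assms] pt_frame[OF assms _ u(1)]
      by (auto simp: O' X_def Y_def q_def case_prod_unfold)
    ultimately show "openin X ((\<lambda>(z, w). pt t z w) -` O' \<inter> topspace X)" by simp
  next
    have "pt t z w \<in> topspace (dual_topology L)" if "z \<in> fst t" "cmod w = 1" for z w
      using pt_in_circle[OF assms that] topspace_circle by (auto simp: circle_topology_def)
    then show "(\<lambda>(z, w). pt t z w) ` topspace X \<subseteq> \<Union> {{(z, l) \<in> dual_bundle L. z \<in> fst t \<and> (z, l (frame L t z)) \<in> W} |t W. t \<in> trivs L \<and> open W}"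
      by (auto simp: X_def dual_topology_def)
  qed
  then show ?thesis
    unfolding circle_topology_def X_def[symmetric] continuous_map_in_subtopology
    using pt_in_circle[OF assms] by (auto simp: X_def)
qed

end

section \<open>Nodal sets\<close>

context hermitian_line_bundle
begin

text \<open>Evaluating a functional on the unit section gives its circle coordinate. In a
  trivialization this multiplies the fibre coordinate by \<open>v t\<close>, the inverse divides by
  it, and the local formulas agree on overlaps, so both maps are glued.\<close>

lemma trivial_circle_bundle_if_section:
  assumes v: "cc.section_on UNIV v"
  shows "trivial_circle_bundle L h"
proof -
  define T where "T = (\<lambda>z. SOME t. t \<in> trivs L \<and> z \<in> fst t)"
  have T: "T z \<in> trivs L" "z \<in> fst (T z)" for z
    using someI_ex[of "\<lambda>t. t \<in> trivs L \<and> z \<in> fst t"] triv_at unfolding T_def by blast+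
  have v0: "v t z \<noteq> 0" "cmod (v t z) = 1" if "t \<in> trivs L" "z \<in> fst t" for t z
    using cc.section_onD(2)[OF v that(1), of z] that by auto
  have vc: "v u z = cocyc t u z * v t z" if "t \<in> trivs L" "u \<in> trivs L" "z \<in> fst t" "z \<in> fst u" for t u z
    using cc.section_onD(3)[OF v that(1,2,3,4)] by simp
  have vcont: "continuous_on (fst t) (v t)" if "t \<in> trivs L" for t
    using cc.section_onD(1)[OF v that] by simp
  define F where "F = (\<lambda>p. (fst p, coord (T (fst p)) p * v (T (fst p)) (fst p)))"
  define Fi where "Fi = (\<lambda>(z, w). pt (T z) z (w / v (T z) z))"
  have F_eq: "coord t p * v t (fst p) = coord u p * v u (fst p)"
    if "t \<in> trivs L" "u \<in> trivs L" "fst p \<in> fst t" "fst p \<in> fst u" "p \<in> circle_bundle L h" for t u p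
    using coord_eq_coord_cocyc[OF that] vc[OF that(1-4)] by simp
  have Fi_eq: "pt u z (w / v u z) = pt t z (w / v t z)"
    if "t \<in> trivs L" "u \<in> trivs L" "z \<in> fst t" "z \<in> fst u" for t u z w
    using pt_change[OF that] vc[OF that] v0(1)[OF that(2,4)] by simp
  define Y where "Y = top_of_set (UNIV \<times> sphere (0::complex) 1 :: ('a \<times> complex) set)"
  have Y: "prod_topology (euclidean :: 'a topology) (top_of_set (sphere (0::complex) 1)) = Y"
    unfolding Y_def by (metis prod_topology_subtopology_eu subtopology_UNIV)
  have "continuous_map (circle_topology L h) Y F"
  proof (rule pasting_lemma[where I = "trivs L" and T = "\<lambda>t. over (fst t)"
        and f = "\<lambda>t p. (fst p, coord t p * v t (fst p))"])
    fix t assume t: "t \<in> trivs L"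
    show "openin (circle_topology L h) (over (fst t))" by (rule openin_over[OF t])
    have "continuous_on (fst t \<times> sphere 0 1) (\<lambda>(z, w). (z, w * v t z))"
      unfolding case_prod_unfold
      by (intro continuous_intros continuous_on_compose2[OF vcont[OF t]]) auto
    then have "continuous_map (top_of_set (fst t \<times> sphere 0 1)) Y (\<lambda>(z, w). (z, w * v t z))"
      unfolding Y_def continuous_map_in_subtopology using v0(2)[OF t] by (auto simp: norm_mult)
    from continuous_map_compose[OF continuous_map_coord[OF t] this]
    show "continuous_map (subtopology (circle_topology L h) (over (fst t))) Y (\<lambda>p. (fst p, coord t p * v t (fst p)))"
      by (simp add: comp_def)
  next
    fix t u p
    assume "t \<in> trivs L" "u \<in> trivs L" "p \<in> topspace (circle_topology L h) \<inter> over (fst t) \<inter> over (fst u)"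
    then show "(fst p, coord t p * v t (fst p)) = (fst p, coord u p * v u (fst p))"
      using F_eq by blast
  next
    fix p assume "p \<in> topspace (circle_topology L h)"
    then show "\<exists>t. t \<in> trivs L \<and> p \<in> over (fst t) \<and> F p = (fst p, coord t p * v t (fst p))"
      using T[of "fst p"] by (intro exI[of _ "T (fst p)"]) (auto simp: topspace_circle F_def)
  qed
  moreover have "continuous_map Y (circle_topology L h) Fi"
  proof (rule pasting_lemma[where I = "trivs L" and T = "\<lambda>t. fst t \<times> sphere 0 1"
        and f = "\<lambda>t (z, w). pt t z (w / v t z)"])
    fix t assume t: "t \<in> trivs L"
    show "openin Y (fst t \<times> sphere 0 1)"
      unfolding Y_def openin_open using open_triv[OF t]
      by (intro exI[of _ "fst t \<times> UNIV"]) (auto simp: open_Times)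
    have "continuous_on (fst t \<times> sphere 0 1) (\<lambda>(z, w). (z, w / v t z))"
      unfolding case_prod_unfold using v0(1)[OF t]
      by (intro continuous_intros continuous_on_compose2[OF vcont[OF t]]) auto
    then have "continuous_map (top_of_set (fst t \<times> sphere 0 1)) (top_of_set (fst t \<times> sphere 0 1)) (\<lambda>(z, w). (z, w / v t z))"
      unfolding continuous_map_in_subtopology using v0(2)[OF t] by (auto simp: norm_divide)
    from continuous_map_compose[OF this continuous_map_pt[OF t]]
    show "continuous_map (subtopology Y (fst t \<times> sphere 0 1)) (circle_topology L h) (\<lambda>(z, w). pt t z (w / v t z))"
      by (simp add: comp_def case_prod_unfold Y_def subtopology_subtopology Times_Int_Times)
  next
    fix t u x
    assume tu: "t \<in> trivs L" "u \<in> trivs L" and "x \<in> topspace Y \<inter> fst t \<times> sphere 0 1 \<inter> fst u \<times> sphere 0 1"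
    then obtain z w where x: "x = (z, w)" "z \<in> fst t" "z \<in> fst u" by auto
    show "(case x of (z, w) \<Rightarrow> pt t z (w / v t z)) = (case x of (z, w) \<Rightarrow> pt u z (w / v u z))"
      unfolding x(1) prod.case by (rule Fi_eq[OF tu(2,1) x(3,2)])
  next
    fix x assume "x \<in> topspace Y"
    then show "\<exists>t. t \<in> trivs L \<and> x \<in> fst t \<times> sphere 0 1 \<and> Fi x = (case x of (z, w) \<Rightarrow> pt t z (w / v t z))"
      using T[of "fst x"] by (intro exI[of _ "T (fst x)"]) (auto simp: Y_def Fi_def)
  qed
  moreover have "Fi (F p) = p" if "p \<in> circle_bundle L h" for p
    using circle_bundle_pt(1)[OF T that] v0(1)[OF T] by (simp add: F_def Fi_def)
  moreover have "F (Fi x) = x" if "x \<in> topspace Y" for x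
    using v0(1)[OF T] coord_pt[OF T] by (auto simp: F_def Fi_def case_prod_unfold)
  ultimately have "homeomorphic_maps (circle_topology L h) Y F Fi"
    by (simp add: homeomorphic_maps_def topspace_circle)
  then have "homeomorphic_map (circle_topology L h) Y F" using homeomorphic_map_maps by blast
  moreover have "fst (F p) = fst p \<and> (\<forall>u\<in>sphere 0 1. F (circle_act u p) = (fst p, u * snd (F p)))" for p
    by (auto simp: F_def coord_act)
  ultimately show ?thesis unfolding trivial_circle_bundle_def Y by blast
qed

text \<open>Nontriviality is used at the outset to produce a zero \<open>p0\<close>; the separation
  argument then only has to exclude that the two projections meet over all of the base.\<close>

lemma nodal_set_connected:
  fixes \<phi> :: "'a \<times> ('l \<Rightarrow> complex) \<Rightarrow> complex"
  assumes m: "m \<noteq> 0"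
    and eq: "\<And>p u. p \<in> circle_bundle L h \<Longrightarrow> cmod u = 1 \<Longrightarrow> \<phi> (circle_act u p) = u powi m * \<phi> p"
    and cont: "\<And>t. t \<in> trivs L \<Longrightarrow> continuous_on (fst t) (\<lambda>z. \<phi> (pt t z 1))"
    and nontriv: "\<not> trivial_circle_bundle L h"
  shows "connectedin (circle_topology L h) (nodal_set L h (\<lambda>p. Re (\<phi> p)))"
proof -
  define N where "N = nodal_set L h (\<lambda>p. Re (\<phi> p))"
  have N_iff: "p \<in> N \<longleftrightarrow> p \<in> circle_bundle L h \<and> Re (\<phi> p) = 0" for p
    by (auto simp: N_def nodal_set_def)
  have phi: "\<phi> (pt t z w) = w powi m * \<phi> (pt t z 1)" if "t \<in> trivs L" "z \<in> fst t" "cmod w = 1" for t z w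
    using eq[OF pt_in_circle[OF that(1,2), of 1] that(3)] by simp
  have "\<exists>p\<in>circle_bundle L h. \<phi> p = 0"
  proof (rule ccontr)
    assume "\<not> ?thesis"
    then have nz: "\<phi> (pt t z w) \<noteq> 0" if "t \<in> trivs L" "z \<in> fst t" "cmod w = 1" for t z w
      using pt_in_circle[OF that] by blast
    \<comment> \<open>The phases of \<phi> along the unitary frames transform by the m-th power of
      the cocycle.\<close>
    define f where "f = (\<lambda>t z. \<phi> (pt t z 1) / of_real (cmod (\<phi> (pt t z 1))))"
    have "\<exists>v. cc.section_on UNIV v"
    proof (rule cc.torsion_cocycle_trivial[OF m, of f])
      show "continuous_on (fst t) (f t)" if "t \<in> trivs L" for t
        unfolding f_def using nz[OF that] by (intro continuous_intros cont[OF that]) auto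
      show "cmod (f t z) = 1" if "t \<in> trivs L" "z \<in> fst t" for t z
        using nz[OF that, of 1] by (simp add: f_def norm_divide)
      show "f u z = cocyc t u z powi m * f t z"
        if "t \<in> trivs L" "u \<in> trivs L" "z \<in> fst t" "z \<in> fst u" for t u z
      proof -
        have c1: "cmod (cocyc t u z) = 1" using cc.norm_g[OF that(1,2)] that by simp
        have "\<phi> (pt u z 1) = cocyc t u z powi m * \<phi> (pt t z 1)"
          using pt_change[OF that, of 1] phi[OF that(1,3) c1] by simp
        then show ?thesis using c1 by (simp add: f_def norm_mult norm_power_int)
      qed
    qed
    then show False using trivial_circle_bundle_if_section nontriv by blast
  qed
  then obtain p0 where p0: "p0 \<in> circle_bundle L h" "\<phi> p0 = 0" by blast
  have fibre0: "\<phi> (pt t z 1) = 0" if "t \<in> trivs L" "p \<in> circle_bundle L h" "fst p = z" "z \<in> fst t" "\<phi> p = 0" for t z p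
    using circle_bundle_pt[OF that(1) _ that(2)] phi[OF that(1,4)] that by (metis mult_eq_0_iff norm_zero power_int_eq_0_iff zero_neq_one)
  show ?thesis
    unfolding N_def[symmetric] connectedin_closedin
  proof (intro conjI notI)
    show "N \<subseteq> topspace (circle_topology L h)" by (auto simp: N_iff topspace_circle)
    assume "\<exists>E1 E2. closedin (circle_topology L h) E1 \<and> closedin (circle_topology L h) E2 \<and>
      N \<subseteq> E1 \<union> E2 \<and> E1 \<inter> E2 \<inter> N = {} \<and> E1 \<inter> N \<noteq> {} \<and> E2 \<inter> N \<noteq> {}"
    then obtain E1 E2 where E: "closedin (circle_topology L h) E1" "closedin (circle_topology L h) E2"
      "N \<subseteq> E1 \<union> E2" "E1 \<inter> E2 \<inter> N = {}" "E1 \<inter> N \<noteq> {}" "E2 \<inter> N \<noteq> {}" by blast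
    define B where "B = (\<lambda>E. fst ` (N \<inter> E))"
    \<comment> \<open>Over a trivialization the part of the nodal set in \<open>E\<close> is closed
      in \<open>fst t\<close> times the circle, and projecting along a compact factor is a closed
      map.\<close>
    have closedB: "closed (B E)" if E: "closedin (circle_topology L h) E" for E
    proof -
      have "open (fst t - B E)" if t: "t \<in> trivs L" for t
      proof -
        define X where "X = top_of_set (fst t \<times> sphere (0::complex) 1)"
        have c1: "closedin X {x \<in> topspace X. (case x of (z, w) \<Rightarrow> pt t z w) \<in> E}"
          unfolding X_def by (rule closedin_continuous_map_preimage[OF continuous_map_pt[OF t] E])
        have "continuous_on (fst t \<times> sphere (0::complex) 1) (\<lambda>(z, w). Re (w powi m * \<phi> (pt t z 1)))"
          unfolding case_prod_unfold
          by (intro continuous_intros continuous_on_compose2[OF cont[OF t]]) auto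
        then have "continuous_map X euclidean (\<lambda>(z, w). Re (w powi m * \<phi> (pt t z 1)))"
          by (simp add: X_def)
        then have c2: "closedin X {x \<in> topspace X. (case x of (z, w) \<Rightarrow> Re (w powi m * \<phi> (pt t z 1))) \<in> {0}}"
          by (rule closedin_continuous_map_preimage) simp
        define C where "C = {x \<in> topspace X. (case x of (z, w) \<Rightarrow> pt t z w) \<in> E} \<inter>
          {x \<in> topspace X. (case x of (z, w) \<Rightarrow> Re (w powi m * \<phi> (pt t z 1))) \<in> {0}}"
        have "closedin X C" unfolding C_def by (rule closedin_Int[OF c1 c2])
        moreover have "closed_map X (top_of_set (fst t)) fst"
          unfolding X_def prod_topology_subtopology_eu[symmetric]
          by (rule Abstract_Topological_Spaces.closed_map_fst) (simp add: compact_space_subtopology)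
        ultimately have "closedin (top_of_set (fst t)) (fst ` C)" by (simp add: closed_map_def)
        moreover have "fst ` C = fst t \<inter> B E"
        proof (intro equalityI subsetI)
          fix z assume "z \<in> fst ` C"
          then obtain w where w: "z \<in> fst t" "cmod w = 1" "pt t z w \<in> E" "Re (w powi m * \<phi> (pt t z 1)) = 0"
            by (auto simp: C_def X_def)
          then have "pt t z w \<in> N" using phi[OF t w(1,2)] pt_in_circle[OF t w(1,2)] by (simp add: N_iff)
          then show "z \<in> fst t \<inter> B E" using w by (force simp: B_def)
        next
          fix z assume "z \<in> fst t \<inter> B E"
          then obtain p where p: "p \<in> N" "p \<in> E" "fst p = z" "z \<in> fst t" by (auto simp: B_def)
          then have pc: "pt t z (coord t p) = p" "cmod (coord t p) = 1"
            using circle_bundle_pt[OF t, of p] by (auto simp: N_iff)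
          then have "(z, coord t p) \<in> C"
            using p phi[OF t p(4) pc(2)] by (simp add: C_def X_def N_iff)
          then show "z \<in> fst ` C" by force
        qed
        ultimately have "openin (top_of_set (fst t)) (fst t - B E)"
          by (simp add: closedin_def Diff_Int)
        then show ?thesis using open_triv[OF t] openin_open_eq by blast
      qed
      then have "open (\<Union>t\<in>trivs L. fst t - B E)" by blast
      moreover have "(\<Union>t\<in>trivs L. fst t - B E) = - B E" using triv_at by blast
      ultimately show ?thesis by (simp add: closed_def)
    qed
    \<comment> \<open>The sheet of the nodal set through a point of \<open>E1\<close> is followed
      continuously; near \<open>z\<close> it avoids the closed set \<open>E2\<close> and hence stays
      in \<open>E1\<close>. The two sets are quantified anew so that their roles can be
      exchanged.\<close>
    have openB: "\<exists>V. open V \<and> z \<in> V \<and> V \<subseteq> B E1"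
      if E: "closedin (circle_topology L h) E2" "N \<subseteq> E1 \<union> E2" "E1 \<inter> E2 \<inter> N = {}"
        and z: "z \<in> B E1" and nz: "\<And>t. t \<in> trivs L \<Longrightarrow> z \<in> fst t \<Longrightarrow> \<phi> (pt t z 1) \<noteq> 0" for E1 E2 z
    proof -
      obtain t where t: "t \<in> trivs L" "z \<in> fst t" using triv_at by blast
      obtain p where p: "p \<in> N" "p \<in> E1" "fst p = z" using z by (auto simp: B_def)
      define w1 where "w1 = coord t p"
      have w1: "pt t z w1 = p" "cmod w1 = 1"
        using circle_bundle_pt[OF t(1), of p] p t(2) by (auto simp: N_iff w1_def)
      define \<phi>0 where "\<phi>0 = \<phi> (pt t z 1)"
      have \<phi>0: "\<phi>0 \<noteq> 0" using nz[OF t] by (simp add: \<phi>0_def)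
      have Re0: "Re (w1 powi m * \<phi>0) = 0" using p phi[OF t w1(2)] w1(1) by (simp add: N_iff \<phi>0_def)
      define q where "q = (\<lambda>z'. \<phi> (pt t z' 1) / \<phi>0)"
      have qc: "continuous_on (fst t) q" unfolding q_def using \<phi>0 by (intro continuous_intros cont[OF t(1)]) auto
      define V where "V = fst t \<inter> q -` (- \<real>\<^sub>\<le>\<^sub>0)"
      have "open V" unfolding V_def
        by (rule continuous_open_preimage[OF qc open_triv[OF t(1)]]) (intro open_Compl closed_nonpos_Reals_complex)
      moreover have "z \<in> V" using t \<phi>0 by (simp add: V_def q_def \<phi>0_def)
      ultimately have V: "open V" "z \<in> V" by auto
      define lq where "lq = (\<lambda>z'. Ln (q z'))"
      \<comment> \<open>This rotation cancels the change of argument of \<phi>: the value at the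
        moved point is |q| times the value at \<open>p\<close>, so it stays imaginary.\<close>
      define w where "w = (\<lambda>z'. w1 * cis (- Im (lq z') / of_int m))"
      have wn: "cmod (w z') = 1" for z' by (simp add: w_def norm_mult w1)
      have "continuous_on V lq" unfolding lq_def
        by (intro continuous_intros continuous_on_subset[OF qc]) (auto simp: V_def)
      then have "continuous_on V w" unfolding w_def using m by (intro continuous_intros) auto
      then have "continuous_map (top_of_set V) (top_of_set (fst t \<times> sphere 0 1)) (\<lambda>z'. (z', w z'))"
        unfolding continuous_map_in_subtopology by (auto simp: wn V_def intro!: continuous_intros)
      from continuous_map_compose[OF this continuous_map_pt[OF t(1)]]
      have \<sigma>: "continuous_map (top_of_set V) (circle_topology L h) (\<lambda>z'. pt t z' (w z'))"
        by (simp add: comp_def)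
      have \<sigma>N: "pt t z' (w z') \<in> N" if "z' \<in> V" for z'
      proof -
        have z': "z' \<in> fst t" "q z' \<noteq> 0" using that by (auto simp: V_def)
        have "cis (- Im (lq z') / of_int m) powi m = cis (- Im (lq z'))"
          using m by (simp add: cis_power_int)
        moreover have "q z' = of_real (cmod (q z')) * cis (Im (lq z'))"
          using z'(2) unfolding lq_def by (metis exp_Ln exp_eq_polar norm_exp_eq_Re)
        ultimately have "cis (- Im (lq z') / of_int m) powi m * q z' = of_real (cmod (q z'))"
          by (metis cis_mult add.right_neutral add.left_inverse cis_zero mult.left_commute mult.right_neutral)
        moreover have "\<phi> (pt t z' 1) = q z' * \<phi>0" using \<phi>0 by (simp add: q_def)
        moreover have "\<phi> (pt t z' (w z')) = w z' powi m * \<phi> (pt t z' 1)" by (rule phi[OF t(1) z'(1) wn])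
        moreover have "(w1 * e) powi m * (x * y) = (e powi m * x) * (w1 powi m * y)" for e x y
          unfolding power_int_mult_distrib by (simp only: mult_ac)
        ultimately have "\<phi> (pt t z' (w z')) = of_real (cmod (q z')) * (w1 powi m * \<phi>0)"
          unfolding w_def by metis
        then have "Re (\<phi> (pt t z' (w z'))) = 0" using Re0 by simp
        then show ?thesis using pt_in_circle[OF t(1) z'(1) wn] by (simp add: N_iff)
      qed
      have "openin (top_of_set V) {z' \<in> topspace (top_of_set V). pt t z' (w z') \<in> topspace (circle_topology L h) - E2}"
        by (rule openin_continuous_map_preimage[OF \<sigma>]) (use E(1) in blast)
      then have "open {z' \<in> V. pt t z' (w z') \<in> topspace (circle_topology L h) - E2}" (is "open ?V")
        using V(1) openin_open_eq by fastforce
      moreover have "q z = 1" using \<phi>0 by (simp add: q_def \<phi>0_def)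
      then have "pt t z (w z) = p" using w1(1) by (simp add: w_def lq_def)
      then have "z \<in> ?V" using V(2) p E(3) by (auto simp: topspace_circle N_iff)
      moreover have "?V \<subseteq> B E1"
      proof
        fix z' assume "z' \<in> ?V"
        then have "pt t z' (w z') \<in> N \<inter> E1" using \<sigma>N E(2) by blast
        then show "z' \<in> B E1" unfolding B_def by (metis fst_pt imageI)
      qed
      ultimately show ?thesis by blast
    qed
    have cover: "z \<in> B E1 \<union> B E2" for z
    proof -
      obtain t where t: "t \<in> trivs L" "z \<in> fst t" using triv_at by blast
      define \<phi>0 where "\<phi>0 = \<phi> (pt t z 1)"
      \<comment> \<open>The angle is chosen to rotate \<phi>0 to i |\<phi>0|; the computation also
        covers \<phi>0 = 0.\<close>
      define w where "w = cis ((pi / 2 - Arg \<phi>0) / of_int m)"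
      have "w powi m = cis (pi / 2 - Arg \<phi>0)" using m by (simp add: w_def cis_power_int)
      moreover have "\<phi>0 = of_real (cmod \<phi>0) * cis (Arg \<phi>0)" by (metis rcis_cmod_Arg rcis_def)
      ultimately have "w powi m * \<phi>0 = of_real (cmod \<phi>0) * (cis (pi / 2 - Arg \<phi>0) * cis (Arg \<phi>0))"
        by (metis mult.left_commute)
      then have "Re (w powi m * \<phi>0) = 0" by (simp add: cis_mult)
      then have "pt t z w \<in> N"
        using phi[OF t, of w] pt_in_circle[OF t, of w] by (simp add: N_iff w_def \<phi>0_def)
      then have "pt t z w \<in> N \<inter> E1 \<or> pt t z w \<in> N \<inter> E2" using E(3) by blast
      then show ?thesis unfolding B_def by (metis UnCI fst_pt imageI)
    qed
    have nzM: "\<phi> (pt t z 1) \<noteq> 0" if z: "z \<in> B E1" "z \<in> B E2" and t: "t \<in> trivs L" "z \<in> fst t" for z t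
    proof
      assume 0: "\<phi> (pt t z 1) = 0"
      define P where "P = (\<lambda>(z, w). pt t z w) ` ({z} \<times> sphere 0 1)"
      have "pt t z w \<in> N" if "cmod w = 1" for w
        using phi[OF t that] pt_in_circle[OF t that] unfolding 0 by (simp add: N_iff)
      then have PN: "P \<subseteq> N" by (auto simp: P_def)
      have "connected ({z} \<times> sphere (0::complex) 1)"
        by (intro connected_Times connected_sphere) auto
      then have "connectedin (top_of_set (fst t \<times> sphere 0 1)) ({z} \<times> sphere (0::complex) 1)"
        using t by (auto simp: connectedin_subtopology)
      then have conP: "connectedin (circle_topology L h) P"
        unfolding P_def by (rule connectedin_continuous_map_image[OF continuous_map_pt[OF t(1)]])
      have PE: "E \<inter> P \<noteq> {}" if zE: "z \<in> B E" for E
      proof -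
        obtain p where p: "p \<in> N" "p \<in> E" "fst p = z" using zE by (auto simp: B_def)
        then have "pt t z (coord t p) = p" "cmod (coord t p) = 1"
          using circle_bundle_pt[OF t(1), of p] t by (auto simp: N_iff)
        then have "p \<in> P" by (force simp: P_def)
        then show ?thesis using p by blast
      qed
      have "P \<subseteq> E1 \<union> E2" "E1 \<inter> E2 \<inter> P = {}" using PN E(3,4) by auto
      then show False
        using conP E(1,2) PE[OF z(1)] PE[OF z(2)] unfolding connectedin_closedin by metis
    qed
    have "open (B E1 \<inter> B E2)"
    proof (subst open_subopen, intro ballI)
      fix z assume z: "z \<in> B E1 \<inter> B E2"
      have sw: "N \<subseteq> E2 \<union> E1" "E2 \<inter> E1 \<inter> N = {}" using E by auto
      have z12: "z \<in> B E1" "z \<in> B E2" using z by auto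
      obtain V1 where "open V1" "z \<in> V1" "V1 \<subseteq> B E1"
        using openB[OF E(2,3,4) z12(1) nzM[OF z12]] by blast
      moreover obtain V2 where "open V2" "z \<in> V2" "V2 \<subseteq> B E2"
        using openB[OF E(1) sw z12(2) nzM[OF z12]] by blast
      ultimately show "\<exists>V. open V \<and> z \<in> V \<and> V \<subseteq> B E1 \<inter> B E2"
        by (intro exI[of _ "V1 \<inter> V2"]) auto
    qed
    moreover have "open (- (B E1 \<inter> B E2))"
      using closedB[OF E(1)] closedB[OF E(2)] by (intro open_Compl closed_Int)
    ultimately have "B E1 \<inter> B E2 = {} \<or> B E1 \<inter> B E2 = UNIV"
      using connectedD[OF connected_surface, of "B E1 \<inter> B E2" "- (B E1 \<inter> B E2)"] by auto
    \<comment> \<open>\<phi> vanishes on the whole fibre through \<open>p0\<close>, and a common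
      projection point has no such fibre; this excludes \<open>UNIV\<close>.\<close>
    moreover have "fst p0 \<notin> B E1 \<inter> B E2"
    proof
      assume p: "fst p0 \<in> B E1 \<inter> B E2"
      obtain t where t: "t \<in> trivs L" "fst p0 \<in> fst t" using triv_at by blast
      then show False using nzM[of "fst p0" t] fibre0[OF t(1) p0(1) refl t(2) p0(2)] p by blast
    qed
    ultimately have disj: "B E1 \<inter> B E2 = {}" by blast
    have "B E1 \<noteq> {}" "B E2 \<noteq> {}" using E(5,6) by (auto simp: B_def)
    moreover have "- B E1 \<inter> UNIV = {} \<or> - B E2 \<inter> UNIV = {}"
    proof (rule connectedD[OF connected_surface])
      show "open (- B E1)" "open (- B E2)" using closedB E(1,2) by (auto intro: open_Compl)
      show "- B E1 \<inter> - B E2 \<inter> UNIV = {}" using cover by blast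
      show "UNIV \<subseteq> - B E1 \<union> - B E2" using disj by blast
    qed
    ultimately show False using disj by blast
  qed
qed

end

section \<open>Equivariance and continuity of joint eigenfunctions\<close>

context hermitian_line_bundle
begin

text \<open>The weight condition gives a derivative at s = 0 only; the group law moves it to every
  s. The orbit function then solves f' = i m f, so e^(-i m s) f is constant.\<close>

lemma eigenfunction_equivariant:
  assumes \<phi>: "joint_eigenfunction A L h G m ev \<phi>"
    and p: "p \<in> circle_bundle L h" and u: "cmod u = 1"
  shows "\<phi> (circle_act u p) = u powi m * \<phi> p"
proof -
  have act_act: "circle_act a (circle_act b p) = circle_act (a * b) p" for a b
    by (simp add: circle_act_def mult.assoc)
  have d0: "((\<lambda>s. \<phi> (circle_act (cis s) q)) has_vector_derivative \<i> * of_int m * \<phi> q) (at 0)"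
    if "q \<in> circle_bundle L h" for q
    using \<phi> that by (simp add: joint_eigenfunction_def)
  define f where "f = (\<lambda>s. \<phi> (circle_act (cis s) p))"
  have d: "(f has_vector_derivative \<i> * of_int m * f s) (at s)" for s
  proof -
    have 1: "((\<lambda>x. x - s) has_vector_derivative 1) (at s)"
      by (auto intro!: derivative_eq_intros)
    have "((\<lambda>r. \<phi> (circle_act (cis r) (circle_act (cis s) p))) has_vector_derivative \<i> * of_int m * f s) (at (s - s))"
      using d0[OF act_in_circle[OF p, of "cis s"]] by (simp add: f_def)
    from vector_diff_chain_at[OF 1 this]
    have "((\<lambda>x. \<phi> (circle_act (cis (x - s)) (circle_act (cis s) p))) has_vector_derivative \<i> * of_int m * f s) (at s)"
      by (simp add: comp_def)
    then show ?thesis by (simp add: act_act cis_mult f_def)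
  qed
  have dc: "((\<lambda>s. cis (- of_int m * s)) has_vector_derivative - \<i> * of_int m * cis (- of_int m * s)) (at s)" for s
  proof -
    have "cis (- of_int m * s) = exp (s *\<^sub>R (- \<i> * of_int m))" for s
      by (simp add: cis_conv_exp scaleR_conv_of_real mult.assoc mult.left_commute mult.commute)
    then show ?thesis
      using exp_scaleR_has_vector_derivative_right[where A = "- \<i> * of_int m" and t = s] by (simp add: mult.commute)
  qed
  have "((\<lambda>s. cis (- of_int m * s) * f s) has_vector_derivative 0) (at s)" for s
    using has_vector_derivative_mult[OF dc d, of s] by (simp add: algebra_simps)
  then obtain c where c: "\<And>s. cis (- of_int m * s) * f s = c"
    using has_vector_derivative_zero_constant[of UNIV "\<lambda>s. cis (- of_int m * s) * f s"] by auto
  obtain s where s: "u = cis s"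
    using u by (metis rcis_cmod_Arg rcis_def mult_1 of_real_1)
  have "cis (of_int m * s) * (cis (- of_int m * s) * f s) = cis (of_int m * s) * f 0"
    using c[of s] c[of 0] by simp
  then have "f s = cis (of_int m * s) * f 0"
    by (simp add: mult.assoc[symmetric] cis_mult)
  then show ?thesis
    by (simp add: f_def s cis_power_int circle_act_def)
qed

text \<open>In the angle chart with base angle 0 the point \<open>pt t z 1\<close> has third
  coordinate 0, since its fibre value is the positive number \<open>rho t z\<close>. Its coordinates
  thus depend continuously on z.\<close>

lemma eigenfunction_continuous:
  assumes \<phi>: "smooth_map (circle_atlas A L h) \<phi>" and t: "t \<in> trivs L"
  shows "continuous_on (fst t) (\<lambda>z. \<phi> (pt t z 1))"
proof (rule continuous_on_locally)
  fix z0 assume z0: "z0 \<in> fst t"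
  obtain c where c: "c \<in> A" "z0 \<in> fst c" using chart_at by blast
  define W where "W = fst c \<inter> fst t"
  have W: "open W" "z0 \<in> W" unfolding W_def using open_chart(1)[OF c(1)] open_triv[OF t] c z0 by auto
  define k where "k = angle_chart L h c t 0"
  have "k \<in> circle_atlas A L h" unfolding circle_atlas_def k_def using c(1) t by blast
  then have "Ck_on 0 (chart_image k) (\<phi> \<circ> chart_inv k)"
    using \<phi> unfolding smooth_map_def smooth_on_def by blast
  then have kc: "continuous_on (chart_image k) (\<phi> \<circ> chart_inv k)" by simp
  have in_k: "pt t z 1 \<in> fst k" and coord_k: "snd k (pt t z 1) = vector [Re (snd c z), Im (snd c z), 0]"
    if "z \<in> W" for z
  proof -
    have z: "z \<in> fst c" "z \<in> fst t" using that by (auto simp: W_def)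
    have r: "snd (pt t z 1) (frame L t z) = of_real (rho t z)"
      using pt_frame[OF t z(2) t z(2)] frame(2)[OF t z(2)] by simp
    note r0 = rho_pos[OF t z(2)]
    show "pt t z 1 \<in> fst k"
      using pt_in_circle[OF t z(2), of 1] r r0 z
      by (simp add: k_def angle_chart_def case_prod_unfold complex_nonpos_Reals_iff)
    show "snd k (pt t z 1) = vector [Re (snd c z), Im (snd c z), 0]"
      using r r0 by (simp add: k_def angle_chart_def case_prod_unfold Arg_of_real)
  qed
  \<comment> \<open>\<open>chart_inv\<close> is an \<open>inv_into\<close> and recovers points only
    for an injective chart. Injectivity holds because on the circle bundle the modulus of the fibre
    value is \<open>rho\<close>, so the angle determines the rest.\<close>
  have inj: "inj_on (snd k) (fst k)"
  proof (rule inj_onI)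
    fix p q assume p: "p \<in> fst k" and q: "q \<in> fst k" and e: "snd k p = snd k q"
    have pq: "p \<in> circle_bundle L h" "q \<in> circle_bundle L h" "fst p \<in> fst c" "fst q \<in> fst c"
      "fst p \<in> fst t" "fst q \<in> fst t"
      using p q by (auto simp: k_def angle_chart_def)
    have "snd k p $ i = snd k q $ i" for i using e by simp
    from this[of 1] this[of 2] this[of 3]
    have "snd c (fst p) = snd c (fst q)" 
      and A: "Arg (snd p (frame L t (fst p))) = Arg (snd q (frame L t (fst q)))"
      by (auto simp: k_def angle_chart_def case_prod_unfold complex_eq_iff)
    then have fe: "fst p = fst q" using inj_on_chart[OF c(1)] pq by (auto simp: inj_on_def)
    note r0 = rho_pos[OF t pq(5)]
    have "cmod (snd p (frame L t (fst p))) = cmod (snd q (frame L t (fst q)))"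
      using circle_bundle_pt(2)[OF t pq(5,1)] circle_bundle_pt(2)[OF t pq(6,2)] r0 fe
      by (simp add: coord_def norm_divide field_simps)
    then have "snd p (frame L t (fst p)) = snd q (frame L t (fst q))"
      using A by (metis rcis_cmod_Arg)
    then have "coord t p = coord t q" by (simp add: coord_def fe)
    then show "p = q" using circle_bundle_pt(1)[OF t pq(5,1)] circle_bundle_pt(1)[OF t pq(6,2)] fe by metis
  qed
  have "continuous_on W (\<lambda>z. vector [Re (snd c z), Im (snd c z), 0] :: real^3)"
  proof -
    have "continuous_on W (\<lambda>z. \<chi> i. (vector [Re (snd c z), Im (snd c z), 0] :: real^3) $ i)"
    proof (rule continuous_on_vec_lambda)
      fix i :: 3
      have "continuous_on W (snd c)"
        by (rule continuous_on_subset[OF continuous_on_chart[OF c(1)]]) (auto simp: W_def)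
      moreover have "i = 1 \<or> i = 2 \<or> i = 3" using exhaust_3 by blast
      ultimately show "continuous_on W (\<lambda>z. (vector [Re (snd c z), Im (snd c z), 0] :: real^3) $ i)"
        by (elim disjE) (simp_all add: continuous_on_Re continuous_on_Im)
    qed
    then show ?thesis by simp
  qed
  then have "continuous_on W (\<lambda>z. (\<phi> \<circ> chart_inv k) (vector [Re (snd c z), Im (snd c z), 0]))"
    by (rule continuous_on_compose2[OF kc]) (use in_k coord_k in \<open>force simp: chart_image_def\<close>)
  then have "continuous_on W (\<lambda>z. \<phi> (pt t z 1))"
  proof (rule continuous_on_eq)
    fix z assume z: "z \<in> W"
    have "chart_inv k (snd k (pt t z 1)) = pt t z 1"
      unfolding chart_inv_def by (rule inv_into_f_f[OF inj in_k[OF z]])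
    then show "(\<phi> \<circ> chart_inv k) (vector [Re (snd c z), Im (snd c z), 0]) = \<phi> (pt t z 1)"
      by (simp add: coord_k[OF z])
  qed
  then show "\<exists>W. open W \<and> z0 \<in> W \<and> continuous_on W (\<lambda>z. \<phi> (pt t z 1))" using W by blast
qed

end

theorem theorem1p9:
  fixes A :: "('a::t2_space, complex) chart set"
    and g :: "('a, complex) metric"
    and L :: "('a, 'l::topological_space) line_bundle"
    and h :: "'l \<Rightarrow> 'l \<Rightarrow> complex"
    and D :: "('a, 'l) conn"
    and G :: "('a \<times> ('l \<Rightarrow> complex), real^3) metric"
  assumes "compact (UNIV :: 'a set)" and "connected (UNIV :: 'a set)"
    and "riemann_surface A"
    and "riemannian_metric A g" and "conformal_metric A g"
    and "holomorphic_line_bundle A L"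
    and "hermitian_metric A L h"
    and "metric_connection A L h D"
    and "kaluza_klein_metric A g L h D G"
    and "\<not> trivial_circle_bundle L h"
  shows "\<forall>m ev \<phi>. m \<noteq> 0 \<longrightarrow> joint_eigenfunction A L h G m ev \<phi> \<longrightarrow>
           connectedin (circle_topology L h) (nodal_set L h (\<lambda>p. Re (\<phi> p)))"
proof (intro allI impI)
  fix m :: int and ev :: real and \<phi> :: "'a \<times> ('l \<Rightarrow> complex) \<Rightarrow> complex"
  assume m: "m \<noteq> 0" and \<phi>: "joint_eigenfunction A L h G m ev \<phi>"
  interpret hermitian_line_bundle A L h
    by unfold_locales (use assms in auto)
  have "smooth_map (circle_atlas A L h) \<phi>" using \<phi> by (simp add: joint_eigenfunction_def)
  then show "connectedin (circle_topology L h) (nodal_set L h (\<lambda>p. Re (\<phi> p)))"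
    by (intro nodal_set_connected[OF m eigenfunction_equivariant[OF \<phi>] eigenfunction_continuous assms(10)])
qed

end
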